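(* Let $t_\infty$ be the explosion time of the minimal PDMP with characteristics $(\pi,\varphi,\mathcal J)$, and $\{P(t)\}_{t\ge0}$ the minimal semigroup on $L^1$ corresponding to $(\pi,\varphi,\mathcal J)$. The semigroup $\{P(t)\}_{t\ge0}$ is strongly stable if and only if $$m\{x\in E:\mathbb P_x(t_\infty=\infty)>0\}=0.$$
   Context: Process. $E$ is a Borel subset of a Polish space with Borel $\sigma$-algebra $\mathcal B(E)$. The characteristics are: (i) a semidynamical system $\pi\colon\mathbb R_+\times E\to E$: $\pi_0x=x$, $\pi_{t+s}x=\pi_t(\pi_sx)$, and $(t,x)\mapsto\pi_tx$ is continuous; (ii) a Borel measurable jump rate function $\varphi\colon E\to\mathbb R_+$ such that for every $x\in E$, $t>0$ the function $s\mapsto\varphi(\pi_sx)$ is integrable on $[0,t)$, and $\lim_{t\to\infty}\int_0^t\varphi(\pi_sx)ds=+\infty$ for all $x\in E$; (iii) a stochastic transition kernel $\mathcal J\colon E\times\mathcal B(E)\to[0,1]$ ($\mathcal J(x,\cdot)$ a probability measure, $x\mapsto\mathcal J(x,B)$ measurable) with $\mathcal J(x,\{x\})=0$ for all $x\in E$. Put $\phi_x(t)=\int_0^t\varphi(\pi_sx)ds$, $\phi_x^{\leftarrow}(q)=\inf\{t:\phi_x(t)\ge q\}$, and let $\kappa\colon[0,1]\times E\to E$ be measurable with $\mathcal J(x,B)$ equal to the Lebesgue measure of $\{q\in[0,1]:\kappa(q,x)\in B\}$ for all $x,B$. Let $\varepsilon_n,\vartheta_n$, $n\ge1$, be independent,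 $\varepsilon_n$ exponential with mean $1$, $\vartheta_n$ uniform on $(0,1)$. Starting from $\xi_0=x\in E$, define $\Delta t_n=\phi_{\xi_{n-1}}^{\leftarrow}(\varepsilon_n)$, $\xi_n=\kappa(\vartheta_n,\pi_{\Delta t_n}\xi_{n-1})$ for $n\ge1$, jump times $t_0=0$, $t_n=\sum_{l=1}^n\Delta t_l$, and explosion time $t_\infty=\lim_n t_n$. The minimal PDMP is $X(t)=\pi_{t-t_n}(\xi_n)$ for $t_n\le t<t_{n+1}$, $n\ge0$, and $X(t)=\Delta$ (a cemetery state $\Delta\notin E$) for $t\ge t_\infty$. $\mathbb P_x$ denotes probability when $X(0)=\xi_0=x$. Semigroup. $m$ is a $\sigma$-finite measure on $\mathcal B(E)$, $L^1=L^1(E,\mathcal B(E),m)$, $L^1_+$ its nonnegative cone, $\mathcal D(A)_+=\mathcal D(A)\cap L^1_+$. Densities are elements of $L^1_+$ of norm 1; a stochastic operator on $L^1$ is a linear operator mapping densities to densities; a stochastic operator $T$ is the transition operator corresponding to a stochastic kernel $\mathcal N$ if $\int_E\mathcal N(x,B)u(x)m(dx)=\int_BTu(x)m(dx)$ for all $B\in\mathcal B(E)$ and all densities $u$. A substochastic semigroup is a strongly continuous semigroup of positive contractions on $L^1$; a semigroup $\{P(t)\}_{t\ge0}$ is strongly stable if $\lim_{t\to\infty}P(t)u=0$ in $L^1$ for all $u\in L^1$. $L^1_\varphi=\{u\in L^1:\int_E\varphi|u|\,dm<\infty\}$. Assumptions: there is a stochastic operator $P$ on $L^1$ which is the transition operator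 corresponding to $\mathcal J$; and there is a substochastic semigroup $\{S(t)\}_{t\ge0}$ on $L^1$ with generator $(A,\mathcal D(A))$ such that $\mathcal D(A)\subseteq L^1_\varphi$, $\int_EAu\,dm=-\int_E\varphi u\,dm$ for $u\in\mathcal D(A)_+$, and $$\int_Ee^{-\int_0^t\varphi(\pi_rx)dr}1_B(\pi_tx)u(x)\,m(dx)=\int_BS(t)u(x)\,m(dx)\quad (t\ge0,\ u\in L^1_+,\ B\in\mathcal B(E)).$$ The minimal semigroup $\{P(t)\}_{t\ge0}$ corresponding to $(\pi,\varphi,\mathcal J)$ is the smallest substochastic semigroup on $L^1$ whose generator is an extension of the operator $u\mapsto Au+P(\varphi u)$, $u\in\mathcal D(A)$ (it exists by the Kato--Voigt perturbation theorem; smallest means $P(t)u\le\widetilde P(t)u$ for $t\ge0$, $u\in L^1_+$ and any other such semigroup $\widetilde P$); its generator $C$ satisfies $(\lambda-C)^{-1}u=\lim_{N\to\infty}R(\lambda,A)\sum_{n=0}^N(P(\varphi R(\lambda,A)))^nu$ for $\lambda>0$, $u\in L^1$, where $R(\lambda,A)=(\lambda-A)^{-1}$ and $P(\varphi R(\lambda,A))$ is the operator $u\mapsto P(\varphi R(\lambda,A)u)$. *)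

theory Defs
  imports "HOL-Probability.Probability"
begin

abbreviation borel_on :: "'a::topological_space set \<Rightarrow> 'a measure" where
  "borel_on E \<equiv> restrict_space borel E"


subsection \<open>Characteristics and the minimal process\<close>

definition cumulative_rate :: "(real \<Rightarrow> 'a \<Rightarrow> 'a) \<Rightarrow> ('a \<Rightarrow> real) \<Rightarrow> 'a \<Rightarrow> real \<Rightarrow> real" where
  "cumulative_rate \<pi> \<phi> x t = (LINT s:{0..<t}|lborel. \<phi> (\<pi> s x))"

definition cumulative_rate_inv :: "(real \<Rightarrow> 'a \<Rightarrow> 'a) \<Rightarrow> ('a \<Rightarrow> real) \<Rightarrow> 'a \<Rightarrow> real \<Rightarrow> real" where
  "cumulative_rate_inv \<pi> \<phi> x q = Inf {t. 0 \<le> t \<and> q \<le> cumulative_rate \<pi> \<phi> x t}"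

text \<open>Time is real-valued, and the flow is only constrained at nonnegative times and on \<open>E\<close>.
  Measurability into \<open>prob_algebra\<close> says precisely that \<open>J\<close> is a stochastic kernel on \<open>E\<close>.\<close>

locale pdmp_characteristics =
  fixes E :: "'a::polish_space set"
    and \<pi> :: "real \<Rightarrow> 'a \<Rightarrow> 'a"
    and \<phi> :: "'a \<Rightarrow> real"
    and J :: "'a \<Rightarrow> 'a measure"
  assumes E_borel: "E \<in> sets borel"
    and flow_in: "\<And>t x. 0 \<le> t \<Longrightarrow> x \<in> E \<Longrightarrow> \<pi> t x \<in> E"
    and flow_0: "\<And>x. x \<in> E \<Longrightarrow> \<pi> 0 x = x"
    and flow_add: "\<And>s t x. 0 \<le> s \<Longrightarrow> 0 \<le> t \<Longrightarrow> x \<in> E \<Longrightarrow> \<pi> (t + s) x = \<pi> t (\<pi> s x)"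
    and flow_continuous: "continuous_on ({0..} \<times> E) (\<lambda>(t, x). \<pi> t x)"
    and rate_measurable: "\<phi> \<in> borel_measurable (borel_on E)"
    and rate_nonneg: "\<And>x. x \<in> E \<Longrightarrow> 0 \<le> \<phi> x"
    and rate_integrable:
      "\<And>x t. x \<in> E \<Longrightarrow> 0 < t \<Longrightarrow> set_integrable lborel {0..<t} (\<lambda>s. \<phi> (\<pi> s x))"
    and rate_diverges: "\<And>x. x \<in> E \<Longrightarrow> filterlim (cumulative_rate \<pi> \<phi> x) at_top at_top"
    and jump_kernel: "J \<in> borel_on E \<rightarrow>\<^sub>M prob_algebra (borel_on E)"
    and jump_proper: "\<And>x. x \<in> E \<Longrightarrow> emeasure (J x) {x} = 0"

definition represents_kernel ::
    "'a::topological_space set \<Rightarrow> ('a \<Rightarrow> 'a measure) \<Rightarrow> (real \<Rightarrow> 'a \<Rightarrow> 'a) \<Rightarrow> bool" where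
  "represents_kernel E J \<kappa> \<longleftrightarrow>
     (\<lambda>(q, x). \<kappa> q x) \<in> borel_on {0..1} \<Otimes>\<^sub>M borel_on E \<rightarrow>\<^sub>M borel_on E \<and>
     (\<forall>x\<in>E. \<forall>B\<in>sets (borel_on E). emeasure (J x) B = emeasure lborel {q\<in>{0..1}. \<kappa> q x \<in> B})"

text \<open>The sequences are indexed by \<open>n \<ge> 1\<close>; the value at \<open>0\<close> is never used. The variables \<open>\<theta> n\<close>
  take values in \<open>(0,1)\<close> everywhere, not just almost surely, because \<open>\<kappa> q\<close> is meaningful for
  \<open>q \<in> [0,1]\<close> only.\<close>

definition pdmp_noise ::
    "'w measure \<Rightarrow> (nat \<Rightarrow> 'w \<Rightarrow> real) \<Rightarrow> (nat \<Rightarrow> 'w \<Rightarrow> real) \<Rightarrow> bool" where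
  "pdmp_noise M \<epsilon> \<theta> \<longleftrightarrow>
     prob_space M \<and>
     prob_space.indep_vars M (\<lambda>_. borel) (case_sum \<epsilon> \<theta>) ({1..} <+> {1..}) \<and>
     (\<forall>n\<ge>1. distributed M lborel (\<epsilon> n) (exponential_density 1)) \<and>
     (\<forall>n\<ge>1. \<theta> n \<in> space M \<rightarrow> {0<..<1} \<and>
             distr M borel (\<theta> n) = uniform_measure lborel {0<..<1})"

text \<open>\<open>post_jump\<close> is the chain \<open>\<xi>\<close> started from \<open>x\<close>, \<open>sojourn n\<close> is the \<open>n\<close>-th holding time
  (\<open>n \<ge> 1\<close>).\<close>

primrec post_jump ::
    "(real \<Rightarrow> 'a \<Rightarrow> 'a) \<Rightarrow> ('a \<Rightarrow> real) \<Rightarrow> (real \<Rightarrow> 'a \<Rightarrow> 'a) \<Rightarrow>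
     (nat \<Rightarrow> 'w \<Rightarrow> real) \<Rightarrow> (nat \<Rightarrow> 'w \<Rightarrow> real) \<Rightarrow> 'a \<Rightarrow> nat \<Rightarrow> 'w \<Rightarrow> 'a" where
  "post_jump \<pi> \<phi> \<kappa> \<epsilon> \<theta> x 0 \<omega> = x"
| "post_jump \<pi> \<phi> \<kappa> \<epsilon> \<theta> x (Suc n) \<omega> =
     (let y = post_jump \<pi> \<phi> \<kappa> \<epsilon> \<theta> x n \<omega>
      in \<kappa> (\<theta> (Suc n) \<omega>) (\<pi> (cumulative_rate_inv \<pi> \<phi> y (\<epsilon> (Suc n) \<omega>)) y))"

definition sojourn ::
    "(real \<Rightarrow> 'a \<Rightarrow> 'a) \<Rightarrow> ('a \<Rightarrow> real) \<Rightarrow> (real \<Rightarrow> 'a \<Rightarrow> 'a) \<Rightarrow>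
     (nat \<Rightarrow> 'w \<Rightarrow> real) \<Rightarrow> (nat \<Rightarrow> 'w \<Rightarrow> real) \<Rightarrow> 'a \<Rightarrow> nat \<Rightarrow> 'w \<Rightarrow> real" where
  "sojourn \<pi> \<phi> \<kappa> \<epsilon> \<theta> x n \<omega> =
     cumulative_rate_inv \<pi> \<phi> (post_jump \<pi> \<phi> \<kappa> \<epsilon> \<theta> x (n - 1) \<omega>) (\<epsilon> n \<omega>)"

definition jump_time ::
    "(real \<Rightarrow> 'a \<Rightarrow> 'a) \<Rightarrow> ('a \<Rightarrow> real) \<Rightarrow> (real \<Rightarrow> 'a \<Rightarrow> 'a) \<Rightarrow>
     (nat \<Rightarrow> 'w \<Rightarrow> real) \<Rightarrow> (nat \<Rightarrow> 'w \<Rightarrow> real) \<Rightarrow> 'a \<Rightarrow> nat \<Rightarrow> 'w \<Rightarrow> real" where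
  "jump_time \<pi> \<phi> \<kappa> \<epsilon> \<theta> x n \<omega> = (\<Sum>l = 1..n. sojourn \<pi> \<phi> \<kappa> \<epsilon> \<theta> x l \<omega>)"

definition explosion_time ::
    "(real \<Rightarrow> 'a \<Rightarrow> 'a) \<Rightarrow> ('a \<Rightarrow> real) \<Rightarrow> (real \<Rightarrow> 'a \<Rightarrow> 'a) \<Rightarrow>
     (nat \<Rightarrow> 'w \<Rightarrow> real) \<Rightarrow> (nat \<Rightarrow> 'w \<Rightarrow> real) \<Rightarrow> 'a \<Rightarrow> 'w \<Rightarrow> ereal" where
  "explosion_time \<pi> \<phi> \<kappa> \<epsilon> \<theta> x \<omega> = lim (\<lambda>n. ereal (jump_time \<pi> \<phi> \<kappa> \<epsilon> \<theta> x n \<omega>))"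


subsection \<open>Operators and semigroups on \<open>L\<^sup>1\<close>\<close>

text \<open>Elements of \<open>L\<^sup>1(m)\<close> are represented by integrable functions. Operators act on representatives,
  must respect equality almost everywhere, and are only constrained on integrable arguments. All
  (in)equalities between elements of \<open>L\<^sup>1(m)\<close> are accordingly read almost everywhere.\<close>

definition L1_norm :: "'a measure \<Rightarrow> ('a \<Rightarrow> real) \<Rightarrow> real" where
  "L1_norm m u = (LINT x|m. \<bar>u x\<bar>)"

definition L1_pos :: "'a measure \<Rightarrow> ('a \<Rightarrow> real) set" where
  "L1_pos m = {u. integrable m u \<and> (AE x in m. 0 \<le> u x)}"

definition densities :: "'a measure \<Rightarrow> ('a \<Rightarrow> real) set" where
  "densities m = {u \<in> L1_pos m. L1_norm m u = 1}"

definition L1_weighted :: "'a measure \<Rightarrow> ('a \<Rightarrow> real) \<Rightarrow> ('a \<Rightarrow> real) set" where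
  "L1_weighted m \<phi> = {u. integrable m u \<and> (\<integral>\<^sup>+ x. ennreal (\<phi> x * \<bar>u x\<bar>) \<partial>m) < \<infinity>}"

definition L1_linear :: "'a measure \<Rightarrow> (('a \<Rightarrow> real) \<Rightarrow> 'a \<Rightarrow> real) \<Rightarrow> bool" where
  "L1_linear m T \<longleftrightarrow>
     (\<forall>u. integrable m u \<longrightarrow> integrable m (T u)) \<and>
     (\<forall>u v. integrable m u \<longrightarrow> integrable m v \<longrightarrow> (AE x in m. u x = v x) \<longrightarrow>
        (AE x in m. T u x = T v x)) \<and>
     (\<forall>u v. integrable m u \<longrightarrow> integrable m v \<longrightarrow>
        (AE x in m. T (\<lambda>y. u y + v y) x = T u x + T v x)) \<and>
     (\<forall>c u. integrable m u \<longrightarrow> (AE x in m. T (\<lambda>y. c * u y) x = c * T u x))"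

definition stochastic_operator :: "'a measure \<Rightarrow> (('a \<Rightarrow> real) \<Rightarrow> 'a \<Rightarrow> real) \<Rightarrow> bool" where
  "stochastic_operator m T \<longleftrightarrow> L1_linear m T \<and> (\<forall>u\<in>densities m. T u \<in> densities m)"

definition transition_operator ::
    "'a measure \<Rightarrow> ('a \<Rightarrow> 'a measure) \<Rightarrow> (('a \<Rightarrow> real) \<Rightarrow> 'a \<Rightarrow> real) \<Rightarrow> bool" where
  "transition_operator m N T \<longleftrightarrow>
     (\<forall>B\<in>sets m. \<forall>u\<in>densities m. (LINT x|m. measure (N x) B * u x) = (LINT x:B|m. T u x))"

definition substochastic_semigroup ::
    "'a measure \<Rightarrow> (real \<Rightarrow> ('a \<Rightarrow> real) \<Rightarrow> 'a \<Rightarrow> real) \<Rightarrow> bool" where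
  "substochastic_semigroup m S \<longleftrightarrow>
     (\<forall>t\<ge>0. L1_linear m (S t)) \<and>
     (\<forall>t\<ge>0. \<forall>u\<in>L1_pos m. S t u \<in> L1_pos m) \<and>
     (\<forall>t\<ge>0. \<forall>u. integrable m u \<longrightarrow> L1_norm m (S t u) \<le> L1_norm m u) \<and>
     (\<forall>u. integrable m u \<longrightarrow> (AE x in m. S 0 u x = u x)) \<and>
     (\<forall>s\<ge>0. \<forall>t\<ge>0. \<forall>u. integrable m u \<longrightarrow> (AE x in m. S (t + s) u x = S t (S s u) x)) \<and>
     (\<forall>u. integrable m u \<longrightarrow> ((\<lambda>t. L1_norm m (\<lambda>x. S t u x - u x)) \<longlongrightarrow> 0) (at_right 0))"

text \<open>The graph of the generator: \<open>generator m S u v\<close> says that \<open>u\<close> is in the domain and is mapped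
  to \<open>v\<close>.\<close>

definition generator ::
    "'a measure \<Rightarrow> (real \<Rightarrow> ('a \<Rightarrow> real) \<Rightarrow> 'a \<Rightarrow> real) \<Rightarrow> ('a \<Rightarrow> real) \<Rightarrow> ('a \<Rightarrow> real) \<Rightarrow> bool" where
  "generator m S u v \<longleftrightarrow>
     integrable m u \<and> integrable m v \<and>
     ((\<lambda>t. L1_norm m (\<lambda>x. (S t u x - u x) / t - v x)) \<longlongrightarrow> 0) (at_right 0)"

definition generator_dom ::
    "'a measure \<Rightarrow> (real \<Rightarrow> ('a \<Rightarrow> real) \<Rightarrow> 'a \<Rightarrow> real) \<Rightarrow> ('a \<Rightarrow> real) set" where
  "generator_dom m S = {u. \<exists>v. generator m S u v}"

definition strongly_stable ::
    "'a measure \<Rightarrow> (real \<Rightarrow> ('a \<Rightarrow> real) \<Rightarrow> 'a \<Rightarrow> real) \<Rightarrow> bool" where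
  "strongly_stable m S \<longleftrightarrow>
     (\<forall>u. integrable m u \<longrightarrow> ((\<lambda>t. L1_norm m (S t u)) \<longlongrightarrow> 0) at_top)"

text \<open>The standing assumptions on the semigroup \<open>S\<close> with generator \<open>A\<close>.\<close>

definition killed_flow_semigroup ::
    "'a measure \<Rightarrow> (real \<Rightarrow> 'a \<Rightarrow> 'a) \<Rightarrow> ('a \<Rightarrow> real) \<Rightarrow>
     (real \<Rightarrow> ('a \<Rightarrow> real) \<Rightarrow> 'a \<Rightarrow> real) \<Rightarrow> bool" where
  "killed_flow_semigroup m \<pi> \<phi> S \<longleftrightarrow>
     substochastic_semigroup m S \<and>
     generator_dom m S \<subseteq> L1_weighted m \<phi> \<and>
     (\<forall>u v. generator m S u v \<longrightarrow> u \<in> L1_pos m \<longrightarrow> (LINT x|m. v x) = - (LINT x|m. \<phi> x * u x)) \<and>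
     (\<forall>t\<ge>0. \<forall>u\<in>L1_pos m. \<forall>B\<in>sets m.
        (LINT x|m. exp (- cumulative_rate \<pi> \<phi> x t) * indicator B (\<pi> t x) * u x) =
        (LINT x:B|m. S t u x))"

definition extends_perturbed_generator ::
    "'a measure \<Rightarrow> ('a \<Rightarrow> real) \<Rightarrow> (('a \<Rightarrow> real) \<Rightarrow> 'a \<Rightarrow> real) \<Rightarrow>
     (real \<Rightarrow> ('a \<Rightarrow> real) \<Rightarrow> 'a \<Rightarrow> real) \<Rightarrow> (real \<Rightarrow> ('a \<Rightarrow> real) \<Rightarrow> 'a \<Rightarrow> real) \<Rightarrow> bool" where
  "extends_perturbed_generator m \<phi> P S Q \<longleftrightarrow>
     (\<forall>u v. generator m S u v \<longrightarrow> generator m Q u (\<lambda>x. v x + P (\<lambda>y. \<phi> y * u y) x))"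

definition minimal_semigroup ::
    "'a measure \<Rightarrow> ('a \<Rightarrow> real) \<Rightarrow> (('a \<Rightarrow> real) \<Rightarrow> 'a \<Rightarrow> real) \<Rightarrow>
     (real \<Rightarrow> ('a \<Rightarrow> real) \<Rightarrow> 'a \<Rightarrow> real) \<Rightarrow> (real \<Rightarrow> ('a \<Rightarrow> real) \<Rightarrow> 'a \<Rightarrow> real) \<Rightarrow> bool" where
  "minimal_semigroup m \<phi> P S Q \<longleftrightarrow>
     substochastic_semigroup m Q \<and> extends_perturbed_generator m \<phi> P S Q \<and>
     (\<forall>Q'. substochastic_semigroup m Q' \<longrightarrow> extends_perturbed_generator m \<phi> P S Q' \<longrightarrow>
        (\<forall>t\<ge>0. \<forall>u\<in>L1_pos m. AE x in m. Q t u x \<le> Q' t u x))"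

end

theory Submission
  imports Defs "HOL-Real_Asymp.Real_Asymp"
begin

text \<open>
  Write \<open>p(x)\<close> for the probability that the process started from \<open>x\<close> does not explode. The theorem holds because
  the mass of the minimal semigroup at time \<open>t\<close>, started from a density \<open>u\<close>, is the probability that the process with
  initial law \<open>u\<close> has not exploded up to time \<open>t\<close>, and this probability decreases to \<open>\<integral>p u dm\<close>. The minimal semigroup is
  known only through its extremal property, so its mass is estimated from above and from below.

  \<^emph>\<open>From above.\<close> A competitor is constructed from the process. On nonnegative functions, \<open>min_op t f x\<close> is the mean of
  \<open>f\<close> at time \<open>t\<close> on the event that \<open>t\<close> precedes the explosion. It is the minimal solution of the equation obtained by
  conditioning on the first jump, the limit of the sums over the number of jumps (\<open>dyson\<close>). The Chapman-Kolmogorov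
  equation \<open>min_op_add\<close> is proved along these sums. The operators \<open>min_op t\<close> preserve null functions, because the killed
  flow and the jump kernel do, so by the Radon-Nikodym theorem they are adjoints of operators \<open>Q t\<close> on \<open>L\<^sup>1\<close>. These form a
  substochastic semigroup (\<open>Q_substochastic\<close>) whose generator extends \<open>u \<mapsto> A u + P (\<phi> u)\<close> (\<open>Q_extends\<close>). For the latter,
  every element of the domain of \<open>A\<close> is a difference of resolvents \<open>R(1, A) v\<close> with \<open>v \<ge> 0\<close>, and for a resolvent the jump
  mass in a short time interval is controlled by the mass that \<open>v\<close> loses. Minimality places the minimal semigroup below
  \<open>Q\<close>. If \<open>p\<close> vanishes almost everywhere, the mass of \<open>Q t u\<close> tends to \<open>0\<close>, and stability follows
  (\<open>stable_if_survival_null\<close>).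

  \<^emph>\<open>From below.\<close> Let \<open>C\<close> be the generator of the minimal semigroup. As \<open>C\<close> extends \<open>A + P \<phi>\<close>, the resolvents satisfy
  \<open>R(r, C) = R(r, A) + R(r, C) P \<phi> R(r, A)\<close>. Iterating this and taking masses shows that \<open>r\<close> times the mass of
  \<open>R(r, C) v\<close> is at least the integral against \<open>v\<close> of \<open>1\<close> minus the mean of \<open>exp (- r t\<^sub>n)\<close>, for every number \<open>n\<close> of jumps,
  and hence at least \<open>\<integral>p v dm\<close> (\<open>survival_le_mean_mass\<close>). If the semigroup is strongly stable, the left-hand side tends to
  \<open>0\<close> with \<open>r\<close>, so \<open>p\<close> vanishes almost everywhere (\<open>survival_null_if_stable\<close>).

  The two sides meet the process in \<open>jumps_by_eq_prob\<close>: the law of the \<open>n\<close>-th jump time satisfies the same recursion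
  through the first jump as the analytic objects. Hence \<open>p\<close> is the limit of the masses of \<open>min_op t\<close>
  (\<open>survival_eq_prob\<close>).
\<close>

section \<open>Set integrals and the norm of \<open>L\<^sup>1\<close>\<close>

lemma L1_norm_nonneg: "0 \<le> L1_norm m u"
  by (simp add: L1_norm_def)

lemma L1_norm_cong_AE:
  assumes "u \<in> borel_measurable m" "v \<in> borel_measurable m" "AE x in m. u x = v x"
  shows "L1_norm m u = L1_norm m v"
  unfolding L1_norm_def using assms by (intro integral_cong_AE) auto

lemma L1_norm_add_le:
  assumes "integrable m u" "integrable m v"
  shows "L1_norm m (\<lambda>x. u x + v x) \<le> L1_norm m u + L1_norm m v"
proof -
  have "L1_norm m (\<lambda>x. u x + v x) \<le> (LINT x|m. \<bar>u x\<bar> + \<bar>v x\<bar>)"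
    unfolding L1_norm_def using assms by (intro integral_mono) auto
  then show ?thesis unfolding L1_norm_def using assms by (simp add: Bochner_Integration.integral_add)
qed

lemma L1_norm_cmult: "L1_norm m (\<lambda>x. c * u x) = \<bar>c\<bar> * L1_norm m u"
  by (simp add: L1_norm_def abs_mult)

lemma set_integrable_subset_of_integrable:
  fixes u :: "'a \<Rightarrow> real"
  assumes "integrable m u" "B \<in> sets m"
  shows "set_integrable m B u"
  unfolding set_integrable_def using integrable_mult_indicator[OF assms(2,1)] by simp

lemma abs_set_integral_le_L1_norm:
  assumes "integrable m u" "B \<in> sets m"
  shows "\<bar>LINT x:B|m. u x\<bar> \<le> L1_norm m u"
proof -
  have "\<bar>LINT x:B|m. u x\<bar> \<le> (LINT x|m. \<bar>indicator B x *\<^sub>R u x\<bar>)"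
    unfolding set_lebesgue_integral_def using integral_abs_bound by blast
  also have "\<dots> \<le> L1_norm m u"
    unfolding L1_norm_def
    using assms integrable_mult_indicator[OF assms(2,1)]
    by (intro integral_mono) (auto simp: indicator_def)
  finally show ?thesis .
qed

text \<open>
  Test with the sets on which \<open>u\<close> is nonnegative and negative. Estimates in the norm of \<open>L\<^sup>1\<close> can
  therefore be made one set \<open>B\<close> at a time, with a bound that is uniform in \<open>B\<close>. This replaces
  vector-valued integrals of semigroup orbits by integrals of real functions.
\<close>

lemma L1_norm_le_twice_set_integrals:
  assumes u: "integrable m u" and le: "\<And>B. B \<in> sets m \<Longrightarrow> \<bar>LINT x:B|m. u x\<bar> \<le> c"
  shows "L1_norm m u \<le> 2 * c"
proof -
  have [measurable]: "u \<in> borel_measurable m" using u by auto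
  define B where "B = {x \<in> space m. 0 \<le> u x}"
  define B' where "B' = {x \<in> space m. u x < 0}"
  have B: "B \<in> sets m" "B' \<in> sets m" unfolding B_def B'_def by measurable
  have "L1_norm m u = (LINT x|m. indicator B x *\<^sub>R u x - indicator B' x *\<^sub>R u x)"
    unfolding L1_norm_def by (intro Bochner_Integration.integral_cong) (auto simp: B_def B'_def indicator_def)
  also have "\<dots> = (LINT x:B|m. u x) - (LINT x:B'|m. u x)"
    unfolding set_lebesgue_integral_def
    using integrable_mult_indicator[OF B(1) u] integrable_mult_indicator[OF B(2) u]
    by (rule Bochner_Integration.integral_diff)
  also have "\<dots> \<le> 2 * c" using le[OF B(1)] le[OF B(2)] by linarith
  finally show ?thesis .
qed

lemma average_bound:
  fixes g :: "real \<Rightarrow> real"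
  assumes h: "0 \<le> h" and g: "set_integrable lborel {0..h} g"
    and le: "\<And>s. s \<in> {0..h} \<Longrightarrow> \<bar>g s - c\<bar> \<le> e"
  shows "\<bar>(LINT s:{0..h}|lborel. g s) - h * c\<bar> \<le> h * e"
proof -
  have const: "set_integrable lborel {0..h} (\<lambda>s. k)" for k :: real
    by (rule borel_integrable_atLeastAtMost') auto
  have int_c: "(LINT s:{0..h}|lborel. k) = h * k" for k :: real
    using h by (simp add: set_lebesgue_integral_def)
  have "(LINT s:{0..h}|lborel. g s) - h * c = (LINT s:{0..h}|lborel. g s - c)"
    using set_integral_diff(2)[OF g const[of c]] by (simp add: int_c)
  moreover have "\<bar>LINT s:{0..h}|lborel. g s - c\<bar> \<le> (LINT s:{0..h}|lborel. \<bar>g s - c\<bar>)"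
    using set_integral_norm_bound[OF set_integral_diff(1)[OF g const[of c]]] by simp
  moreover have "(LINT s:{0..h}|lborel. \<bar>g s - c\<bar>) \<le> (LINT s:{0..h}|lborel. e)"
    by (intro set_integral_mono set_integrable_abs set_integral_diff(1) g const le)
  ultimately show ?thesis by (simp add: int_c)
qed

lemma L1_linearD:
  assumes "L1_linear m T"
  shows "integrable m u \<Longrightarrow> integrable m (T u)"
    and "integrable m u \<Longrightarrow> integrable m v \<Longrightarrow> AE x in m. u x = v x \<Longrightarrow> AE x in m. T u x = T v x"
    and "integrable m u \<Longrightarrow> integrable m v \<Longrightarrow> AE x in m. T (\<lambda>y. u y + v y) x = T u x + T v x"
    and "integrable m u \<Longrightarrow> AE x in m. T (\<lambda>y. c * u y) x = c * T u x"
  using assms unfolding L1_linear_def by blast+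

lemma L1_linear_lincomb:
  assumes T: "L1_linear m T" and u: "integrable m u" and v: "integrable m v"
  shows "AE x in m. T (\<lambda>y. a * u y + b * v y) x = a * T u x + b * T v x"
proof -
  have "integrable m (\<lambda>x. a * u x)" "integrable m (\<lambda>x. b * v x)" using u v by auto
  from L1_linearD(3)[OF T this] L1_linearD(4)[OF T u, of a] L1_linearD(4)[OF T v, of b]
  show ?thesis by eventually_elim simp
qed

lemma L1_linear_diff:
  assumes T: "L1_linear m T" and u: "integrable m u" and v: "integrable m v"
  shows "AE x in m. T (\<lambda>y. u y - v y) x = T u x - T v x"
  using L1_linear_lincomb[OF T u v, of 1 "-1"] by simp

section \<open>Substochastic semigroups and Laplace transforms of their orbits\<close>

locale L1_semigroup =
  fixes m :: "'a measure" and Q :: "real \<Rightarrow> ('a \<Rightarrow> real) \<Rightarrow> 'a \<Rightarrow> real"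
  assumes substoch: "substochastic_semigroup m Q"
begin

lemma linear: "0 \<le> t \<Longrightarrow> L1_linear m (Q t)"
  using substoch by (simp add: substochastic_semigroup_def)

lemma pos: "0 \<le> t \<Longrightarrow> u \<in> L1_pos m \<Longrightarrow> Q t u \<in> L1_pos m"
  using substoch by (simp add: substochastic_semigroup_def)

lemma contraction: "0 \<le> t \<Longrightarrow> integrable m u \<Longrightarrow> L1_norm m (Q t u) \<le> L1_norm m u"
  using substoch by (simp add: substochastic_semigroup_def)

lemma at_0: "integrable m u \<Longrightarrow> AE x in m. Q 0 u x = u x"
  using substoch by (simp add: substochastic_semigroup_def)

lemma add: "0 \<le> s \<Longrightarrow> 0 \<le> t \<Longrightarrow> integrable m u \<Longrightarrow> AE x in m. Q (t + s) u x = Q t (Q s u) x"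
  using substoch by (simp add: substochastic_semigroup_def)

lemma cont: "integrable m u \<Longrightarrow> ((\<lambda>t. L1_norm m (\<lambda>x. Q t u x - u x)) \<longlongrightarrow> 0) (at_right 0)"
  using substoch by (simp add: substochastic_semigroup_def)

lemma integrable: "0 \<le> t \<Longrightarrow> integrable m u \<Longrightarrow> integrable m (Q t u)"
  using linear L1_linearD(1) by blast

text \<open>
  By the semigroup law the difference is \<open>Q s\<close> applied to \<open>Q (t - s) u - u\<close>, and \<open>Q s\<close> is a contraction.
  Strong continuity at \<open>0\<close> thus gives continuity of orbits in both directions at every time.
\<close>

lemma shift_le:
  assumes st: "0 \<le> s" "s \<le> t" and u: "integrable m u"
  shows "L1_norm m (\<lambda>x. Q t u x - Q s u x) \<le> L1_norm m (\<lambda>x. Q (t - s) u x - u x)"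
proof -
  have i: "integrable m (Q (t - s) u)" "integrable m (Q t u)" "integrable m (Q s u)"
    using integrable[OF _ u] st by auto
  have i2: "integrable m (\<lambda>x. Q (t - s) u x - u x)" using i u by auto
  have "AE x in m. Q t u x = Q s (Q (t - s) u) x" using add[of "t - s" s u] st u by simp
  moreover have "AE x in m. Q s (\<lambda>y. Q (t - s) u y - u y) x = Q s (Q (t - s) u) x - Q s u x"
    by (rule L1_linear_diff[OF linear[OF st(1)] i(1) u])
  ultimately have "AE x in m. Q t u x - Q s u x = Q s (\<lambda>y. Q (t - s) u y - u y) x"
    by eventually_elim simp
  then have "L1_norm m (\<lambda>x. Q t u x - Q s u x) = L1_norm m (Q s (\<lambda>y. Q (t - s) u y - u y))"
    using i integrable[OF st(1) i2] by (intro L1_norm_cong_AE) auto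
  also have "\<dots> \<le> L1_norm m (\<lambda>x. Q (t - s) u x - u x)" by (rule contraction[OF st(1) i2])
  finally show ?thesis .
qed

lemma small_time:
  assumes u: "integrable m u" and e: "0 < e"
  obtains d where "0 < d" "\<And>t. 0 \<le> t \<Longrightarrow> t \<le> d \<Longrightarrow> L1_norm m (\<lambda>x. Q t u x - u x) \<le> e"
proof -
  have "\<forall>\<^sub>F t in at_right 0. L1_norm m (\<lambda>x. Q t u x - u x) < e"
    using cont[OF u] e by (rule order_tendstoD)
  then obtain d where d: "0 < d" "\<And>t. 0 < t \<Longrightarrow> t < d \<Longrightarrow> L1_norm m (\<lambda>x. Q t u x - u x) < e"
    unfolding eventually_at_right_field by auto
  have "L1_norm m (\<lambda>x. Q 0 u x - u x) = L1_norm m (\<lambda>x. 0)"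
    using at_0[OF u] u integrable[OF order_refl u] by (intro L1_norm_cong_AE) auto
  then have 0: "L1_norm m (\<lambda>x. Q 0 u x - u x) = 0" by (simp add: L1_norm_def)
  show ?thesis
    by (rule that[of "d / 2"]) (use d e 0 in \<open>auto simp: less_eq_real_def\<close>)
qed

lemma continuous_set_integral:
  assumes u: "integrable m u" and B: "B \<in> sets m"
  shows "continuous_on {0..} (\<lambda>t. LINT x:B|m. Q t u x)"
proof -
  have *: "\<bar>(LINT x:B|m. Q t u x) - (LINT x:B|m. Q s u x)\<bar> \<le> L1_norm m (\<lambda>x. Q (t - s) u x - u x)"
    if st: "0 \<le> s" "s \<le> t" for s t
  proof -
    have i: "integrable m (Q t u)" "integrable m (Q s u)" using integrable[OF _ u] st by auto
    have "(LINT x:B|m. Q t u x) - (LINT x:B|m. Q s u x) = (LINT x:B|m. Q t u x - Q s u x)"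
      using i B by (intro set_integral_diff(2)[symmetric] set_integrable_subset_of_integrable)
    also have "\<bar>\<dots>\<bar> \<le> L1_norm m (\<lambda>x. Q t u x - Q s u x)"
      using i B by (intro abs_set_integral_le_L1_norm) auto
    also have "\<dots> \<le> L1_norm m (\<lambda>x. Q (t - s) u x - u x)" by (rule shift_le[OF st u])
    finally show ?thesis .
  qed
  show ?thesis
    unfolding continuous_on_iff
  proof (intro ballI allI impI)
    fix s e :: real assume s: "s \<in> {0..}" and e: "0 < e"
    have "0 < e / 2" using e by simp
    from small_time[OF u this] obtain d where d: "0 < d"
      "\<And>t. 0 \<le> t \<Longrightarrow> t \<le> d \<Longrightarrow> L1_norm m (\<lambda>x. Q t u x - u x) \<le> e / 2" by blast
    show "\<exists>d>0. \<forall>x'\<in>{0..}. dist x' s < d \<longrightarrow>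
        dist (LINT x:B|m. Q x' u x) (LINT x:B|m. Q s u x) < e"
    proof (intro exI[of _ d] conjI ballI impI d(1))
      fix t assume t: "t \<in> {0..}" "dist t s < d"
      show "dist (LINT x:B|m. Q t u x) (LINT x:B|m. Q s u x) < e"
      proof (cases "s \<le> t")
        case True
        then show ?thesis using *[of s t] d(2)[of "t - s"] s t e by (auto simp: dist_real_def)
      next
        case False
        then show ?thesis using *[of t s] d(2)[of "s - t"] s t e by (auto simp: dist_real_def)
      qed
    qed
  qed
qed

end

definition laplace :: "real \<Rightarrow> (real \<Rightarrow> real) \<Rightarrow> real" where
  "laplace r F = (LINT t:{0..}|lborel. exp (- r * t) * F t)"

lemma nn_integral_exp_atLeast:
  fixes r :: real assumes "0 < r"
  shows "(\<integral>\<^sup>+t. ennreal (exp (- r * t)) * indicator {0..} t \<partial>lborel) = ennreal (1 / r)"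
proof -
  have "(\<integral>\<^sup>+t. ennreal (exp (- r * t)) * indicator {0..} t \<partial>lborel) = ennreal (0 - (- exp (- r * 0) / r))"
  proof (rule nn_integral_FTC_atLeast)
    show "((\<lambda>t. - exp (- r * t) / r) \<longlongrightarrow> 0) at_top"
      using assms by real_asymp
  qed (use assms in \<open>auto intro!: derivative_eq_intros\<close>)
  then show ?thesis by simp
qed

lemma exp_integral_atLeast:
  fixes r :: real assumes r: "0 < r"
  shows "set_integrable lborel {0..} (\<lambda>t. exp (- r * t))"
    and "(LINT t:{0..}|lborel. exp (- r * t)) = 1 / r"
proof -
  have "has_bochner_integral lborel (\<lambda>t. indicator {0..} t *\<^sub>R exp (- r * t)) (1 / r)"
  proof (rule has_bochner_integral_nn_integral)
    have "(\<integral>\<^sup>+t. ennreal (indicator {0..} t *\<^sub>R exp (- r * t)) \<partial>lborel)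
        = (\<integral>\<^sup>+t. ennreal (exp (- r * t)) * indicator {0..} t \<partial>lborel)"
      by (intro nn_integral_cong) (simp add: indicator_def)
    then show "(\<integral>\<^sup>+t. ennreal (indicator {0..} t *\<^sub>R exp (- r * t)) \<partial>lborel) = ennreal (1 / r)"
      using nn_integral_exp_atLeast[OF r] by simp
  qed (use r in auto)
  then show "set_integrable lborel {0..} (\<lambda>t. exp (- r * t))"
    "(LINT t:{0..}|lborel. exp (- r * t)) = 1 / r"
    unfolding set_integrable_def set_lebesgue_integral_def
    by (auto simp: has_bochner_integral_iff)
qed

lemma continuous_on_set_measurable:
  fixes F :: "real \<Rightarrow> real"
  assumes "continuous_on A F" "A \<in> sets borel"
  shows "(\<lambda>t. indicator A t *\<^sub>R F t) \<in> borel_measurable lborel"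
  using borel_measurable_continuous_on_indicator[OF assms(2,1)] by simp

lemma laplace_integrable:
  fixes c :: real
  assumes F: "continuous_on {0..} F" "\<And>t. 0 \<le> t \<Longrightarrow> \<bar>F t\<bar> \<le> c" and r: "0 < r"
  shows "set_integrable lborel {0..} (\<lambda>t. exp (- r * t) * F t)"
  unfolding set_integrable_def
proof (rule Bochner_Integration.integrable_bound)
  show "integrable lborel (\<lambda>t. c *\<^sub>R (indicator {0..} t *\<^sub>R exp (- r * t)))"
    using exp_integral_atLeast(1)[OF r] unfolding set_integrable_def by simp
  show "(\<lambda>t. indicator {0..} t *\<^sub>R (exp (- r * t) * F t)) \<in> borel_measurable lborel"
    by (rule continuous_on_set_measurable) (auto intro!: continuous_intros F)
  show "AE t in lborel. norm (indicator {0..} t *\<^sub>R (exp (- r * t) * F t))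
      \<le> norm (c *\<^sub>R (indicator {0..} t *\<^sub>R exp (- r * t)))"
    using F(2) by (intro AE_I2) (auto simp: indicator_def abs_mult intro: order_trans[OF _ abs_ge_self])
qed

lemma laplace_bound:
  assumes F: "continuous_on {0..} F" "\<And>t. 0 \<le> t \<Longrightarrow> \<bar>F t\<bar> \<le> c" and r: "0 < r"
  shows "\<bar>laplace r F\<bar> \<le> c / r"
proof -
  have "\<bar>laplace r F\<bar> \<le> (LINT t:{0..}|lborel. \<bar>exp (- r * t) * F t\<bar>)"
    unfolding laplace_def using set_integral_norm_bound[OF laplace_integrable[OF F r]] by simp
  also have "\<dots> \<le> (LINT t:{0..}|lborel. c * exp (- r * t))"
    using F(2) by (intro set_integral_mono set_integrable_abs laplace_integrable[OF F r]
        set_integrable_mult_right exp_integral_atLeast r) (auto simp: abs_mult)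
  finally show ?thesis using exp_integral_atLeast(2)[OF r] by simp
qed

lemma laplace_lincomb:
  assumes F: "continuous_on {0..} F" "\<And>t. 0 \<le> t \<Longrightarrow> \<bar>F t\<bar> \<le> c"
    and G: "continuous_on {0..} G" "\<And>t. 0 \<le> t \<Longrightarrow> \<bar>G t\<bar> \<le> d" and r: "0 < r"
  shows "laplace r (\<lambda>t. a * F t + b * G t) = a * laplace r F + b * laplace r G"
proof -
  have 1: "set_integrable lborel {0..} (\<lambda>t. a * (exp (- r * t) * F t))"
    by (intro set_integrable_mult_right laplace_integrable[OF F r])
  have 2: "set_integrable lborel {0..} (\<lambda>t. b * (exp (- r * t) * G t))"
    by (intro set_integrable_mult_right laplace_integrable[OF G r])
  have "laplace r (\<lambda>t. a * F t + b * G t)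
      = (LINT t:{0..}|lborel. a * (exp (- r * t) * F t) + b * (exp (- r * t) * G t))"
    unfolding laplace_def by (simp add: algebra_simps)
  also have "\<dots> = a * laplace r F + b * laplace r G"
    unfolding set_integral_add(2)[OF 1 2] laplace_def by simp
  finally show ?thesis .
qed

lemma laplace_shift:
  assumes F: "continuous_on {0..} F" "\<And>t. 0 \<le> t \<Longrightarrow> \<bar>F t\<bar> \<le> c" and r: "0 < r" and h: "0 \<le> h"
  shows "laplace r (\<lambda>t. F (t + h))
    = exp (r * h) * (laplace r F - (LINT t:{0..h}|lborel. exp (- r * t) * F t))"
proof -
  define g where "g t = exp (- r * t) * F t" for t
  have gi: "set_integrable lborel {0..} g" unfolding g_def by (rule laplace_integrable[OF F r])
  have "laplace r (\<lambda>t. F (t + h)) = (LINT t|lborel. exp (r * h) * (indicator {h..} (h + 1 * t) * g (h + 1 * t)))"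
    unfolding laplace_def set_lebesgue_integral_def g_def
    by (intro Bochner_Integration.integral_cong refl) (auto simp: indicator_def exp_add[symmetric] algebra_simps)
  also have "\<dots> = exp (r * h) * (LINT t|lborel. indicator {h..} (h + 1 * t) * g (h + 1 * t))"
    by simp
  also have "(LINT t|lborel. indicator {h..} (h + 1 * t) * g (h + 1 * t)) = (LINT t:{h..}|lborel. g t)"
    using lborel_integral_real_affine[of 1 "\<lambda>t. indicator {h..} t * g t" h]
    by (simp add: set_lebesgue_integral_def)
  also have "(LINT t:{h..}|lborel. g t) = (LINT t:{h<..}|lborel. g t)"
  proof (rule set_integral_cong_set)
    have "set_integrable lborel {h..} g" "set_integrable lborel {h<..} g"
      using h by (auto intro!: set_integrable_subset[OF gi])
    then show "set_borel_measurable lborel {h..} g" "set_borel_measurable lborel {h<..} g"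
      unfolding set_integrable_def set_borel_measurable_def by (auto dest!: borel_measurable_integrable)
    show "AE x in lborel. (x \<in> {h<..}) = (x \<in> {h..})"
      using AE_lborel_singleton[of h] by eventually_elim auto
  qed
  also have "\<dots> = (LINT t:{0..}|lborel. g t) - (LINT t:{0..h}|lborel. g t)"
  proof -
    have "{0..} = {0..h} \<union> {h<..}" using h by auto
    moreover have "(LINT t:{0..h} \<union> {h<..}|lborel. g t) = (LINT t:{0..h}|lborel. g t) + (LINT t:{h<..}|lborel. g t)"
      using h by (intro set_integral_Un set_integrable_subset[OF gi]) auto
    ultimately show ?thesis by simp
  qed
  finally show ?thesis unfolding laplace_def g_def .
qed

lemma tendsto_average:
  fixes g :: "real \<Rightarrow> real"
  assumes g: "continuous_on {0..} g"
  shows "((\<lambda>h. (LINT s:{0..h}|lborel. g s) / h) \<longlongrightarrow> g 0) (at_right 0)"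
proof (rule tendstoI)
  fix e :: real assume e: "0 < e"
  have "\<exists>d>0. \<forall>x\<in>{0..}. dist x 0 < d \<longrightarrow> dist (g x) (g 0) < e / 2"
    using g[unfolded continuous_on_iff, rule_format, of 0 "e / 2"] e by auto
  then obtain d where d: "0 < d" "\<And>x. 0 \<le> x \<Longrightarrow> x < d \<Longrightarrow> \<bar>g x - g 0\<bar> < e / 2"
    by (auto simp: dist_real_def)
  have "\<forall>\<^sub>F h in at_right 0. 0 < h \<and> h < d"
    using d(1) eventually_at_right_field by blast
  then show "\<forall>\<^sub>F h in at_right 0. dist ((LINT s:{0..h}|lborel. g s) / h) (g 0) < e"
  proof eventually_elim
    case (elim h)
    have "\<bar>(LINT s:{0..h}|lborel. g s) - h * g 0\<bar> \<le> h * (e / 2)"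
    proof (rule average_bound)
      show "set_integrable lborel {0..h} g"
        by (rule borel_integrable_atLeastAtMost'[OF continuous_on_subset[OF g]]) auto
    qed (use elim d in \<open>auto intro: less_imp_le\<close>)
    also have "\<dots> < h * e" using elim e by simp
    finally have "\<bar>(LINT s:{0..h}|lborel. g s) / h - g 0\<bar> * h < e * h"
      using elim by (simp add: abs_mult[symmetric] field_simps abs_divide flip: abs_mult)
    then show ?case using elim by (simp add: dist_real_def)
  qed
qed

context L1_semigroup
begin

lemma abs_set_integral_orbit_le:
  assumes "0 \<le> t" "integrable m u" "B \<in> sets m"
  shows "\<bar>LINT x:B|m. Q t u x\<bar> \<le> L1_norm m u"
  using abs_set_integral_le_L1_norm[OF integrable[OF assms(1,2)] assms(3)] contraction[OF assms(1,2)]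
  by linarith

lemma set_integral_lincomb:
  assumes t: "0 \<le> t" and u: "integrable m u" and v: "integrable m v" and B: "B \<in> sets m"
  shows "(LINT x:B|m. Q t (\<lambda>x. a * u x + b * v x) x) = a * (LINT x:B|m. Q t u x) + b * (LINT x:B|m. Q t v x)"
proof -
  have i: "integrable m (Q t u)" "integrable m (Q t v)" "integrable m (Q t (\<lambda>x. a * u x + b * v x))"
    using integrable[OF t] u v by auto
  have "(LINT x:B|m. Q t (\<lambda>x. a * u x + b * v x) x) = (LINT x:B|m. a * Q t u x + b * Q t v x)"
    unfolding set_lebesgue_integral_def
    using L1_linear_lincomb[OF linear[OF t] u v, of a b] i B
    by (intro integral_cong_AE) auto
  also have "\<dots> = a * (LINT x:B|m. Q t u x) + b * (LINT x:B|m. Q t v x)"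
    using i B by (subst set_integral_add(2)) (auto intro!: set_integrable_subset_of_integrable)
  finally show ?thesis .
qed

text \<open>
  The weak form of \<open>R(r, A) (r u - A u) = u\<close>, where \<open>R(r, A)\<close> is the Laplace transform of the
  semigroup. No derivative at positive times is taken: the Laplace transform of the
  difference quotient \<open>(Q (t + h) u - Q t u) / h\<close>, tested with \<open>B\<close>, is computed in two ways, by moving the
  quotient onto \<open>u\<close> (where it converges to \<open>A u\<close>), and by shifting the time variable. Applied to \<open>S\<close> this
  gives the uniqueness of resolvents, and applied to the minimal semigroup it is the source of the lower
  bound.
\<close>

lemma laplace_generator:
  assumes gen: "generator m Q u w" and r: "0 < r" and B: "B \<in> sets m"
  shows "laplace r (\<lambda>t. LINT x:B|m. Q t (\<lambda>x. r * u x - w x) x) = (LINT x:B|m. u x)"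
proof -
  have u: "integrable m u" and w: "integrable m w"
    and lim: "((\<lambda>h. L1_norm m (\<lambda>x. (Q h u x - u x) / h - w x)) \<longlongrightarrow> 0) (at_right 0)"
    using gen unfolding generator_def by auto
  define F where "F z t = (LINT x:B|m. Q t z x)" for z t
  have Fc: "continuous_on {0..} (F z)" and Fb: "\<And>t. 0 \<le> t \<Longrightarrow> \<bar>F z t\<bar> \<le> L1_norm m z" if "integrable m z" for z
    unfolding F_def using continuous_set_integral[OF that B] abs_set_integral_orbit_le[OF _ that B] by auto
  \<comment> \<open>moving the difference quotient onto the initial value\<close>
  have diffq: "laplace r (\<lambda>t. F (\<lambda>x. (Q h u x - u x) / h - w x) t)
      = (laplace r (\<lambda>t. F u (t + h)) - laplace r (F u)) / h - laplace r (F w)" if h: "0 < h" for h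
  proof -
    have Qu: "integrable m (Q h u)" using integrable[OF _ u] h by simp
    have i1: "integrable m (\<lambda>x. (Q h u x - u x) / h)" using Qu u by auto
    have "F (\<lambda>x. (Q h u x - u x) / h - w x) t = (1 / h) * (F u (t + h) - F u t) + (- 1) * F w t"
      if t: "0 \<le> t" for t
    proof -
      have "F (\<lambda>x. (Q h u x - u x) / h - w x) t = 1 * F (\<lambda>x. (Q h u x - u x) / h) t + (- 1) * F w t"
        unfolding F_def using set_integral_lincomb[OF t i1 w B, of 1 "- 1"] by simp
      also have "F (\<lambda>x. (Q h u x - u x) / h) t = (1 / h) * F (Q h u) t + (- 1 / h) * F u t"
        unfolding F_def using set_integral_lincomb[OF t Qu u B, of "1 / h" "- 1 / h"]
        by (simp add: diff_divide_distrib)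
      also have "F (Q h u) t = F u (t + h)"
        unfolding F_def set_lebesgue_integral_def
        using add[of h t u] h t u integrable[OF t Qu] integrable[of "t + h" u] B
        by (intro integral_cong_AE) (auto elim!: eventually_mono)
      finally show ?thesis by (simp add: algebra_simps)
    qed
    then have "laplace r (\<lambda>t. F (\<lambda>x. (Q h u x - u x) / h - w x) t)
      = laplace r (\<lambda>t. (1 / h) * (1 * F u (t + h) + (- 1) * F u t) + (- 1) * F w t)"
      unfolding laplace_def set_lebesgue_integral_def
      by (intro Bochner_Integration.integral_cong refl) (auto simp: indicator_def)
    also have "\<dots> = (1 / h) * laplace r (\<lambda>t. 1 * F u (t + h) + (- 1) * F u t) + (- 1) * laplace r (F w)"
    proof (rule laplace_lincomb[OF _ _ Fc[OF w] Fb[OF w] r])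
      show "continuous_on {0..} (\<lambda>t. 1 * F u (t + h) + (- 1) * F u t)"
        using h by (intro continuous_intros Fc[OF u] continuous_on_compose2[OF Fc[OF u]]) auto
      show "\<bar>1 * F u (t + h) + (- 1) * F u t\<bar> \<le> 2 * L1_norm m u" if "0 \<le> t" for t
        using Fb[OF u, of t] Fb[OF u, of "t + h"] that h by auto
    qed
    also have "laplace r (\<lambda>t. 1 * F u (t + h) + (- 1) * F u t) = 1 * laplace r (\<lambda>t. F u (t + h)) + (- 1) * laplace r (F u)"
    proof (rule laplace_lincomb[OF _ _ Fc[OF u] Fb[OF u] r])
      show "continuous_on {0..} (\<lambda>t. F u (t + h))"
        using h by (intro continuous_on_compose2[OF Fc[OF u]] continuous_intros) auto
      show "\<bar>F u (t + h)\<bar> \<le> L1_norm m u" if "0 \<le> t" for t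
        using Fb[OF u, of "t + h"] that h by auto
    qed
    finally show ?thesis by (simp add: diff_divide_distrib)
  qed
  have "((\<lambda>h. (laplace r (\<lambda>t. F u (t + h)) - laplace r (F u)) / h - laplace r (F w)) \<longlongrightarrow> 0) (at_right 0)"
  proof (rule Lim_null_comparison)
    show "((\<lambda>h. L1_norm m (\<lambda>x. (Q h u x - u x) / h - w x) / r) \<longlongrightarrow> 0) (at_right 0)"
      using tendsto_divide[OF lim tendsto_const[of r]] r by simp
    have "\<forall>\<^sub>F h in at_right (0::real). 0 < h" by (simp add: eventually_at_right_less)
    then show "\<forall>\<^sub>F h in at_right 0. norm ((laplace r (\<lambda>t. F u (t + h)) - laplace r (F u)) / h - laplace r (F w))
        \<le> L1_norm m (\<lambda>x. (Q h u x - u x) / h - w x) / r"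
    proof eventually_elim
      case (elim h)
      have i: "integrable m (\<lambda>x. (Q h u x - u x) / h - w x)"
        using integrable[OF _ u, of h] elim u w by auto
      show ?case
        unfolding diffq[OF elim, symmetric] real_norm_def by (rule laplace_bound[OF Fc[OF i] Fb[OF i] r])
    qed
  qed
  then have "((\<lambda>h. (laplace r (\<lambda>t. F u (t + h)) - laplace r (F u)) / h) \<longlongrightarrow> laplace r (F w)) (at_right 0)"
    by (simp add: LIM_zero_iff)
  \<comment> \<open>shifting the time variable\<close>
  moreover have "((\<lambda>h. (laplace r (\<lambda>t. F u (t + h)) - laplace r (F u)) / h)
      \<longlongrightarrow> r * laplace r (F u) - F u 0) (at_right 0)"
  proof -
    have "((\<lambda>h. (exp (r * h) - 1) / h * laplace r (F u)
        - exp (r * h) * ((LINT t:{0..h}|lborel. exp (- r * t) * F u t) / h))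
        \<longlongrightarrow> r * laplace r (F u) - 1 * (exp (- r * 0) * F u 0)) (at_right 0)"
    proof (intro tendsto_diff tendsto_mult tendsto_const)
      show "((\<lambda>h. (exp (r * h) - 1) / h) \<longlongrightarrow> r) (at_right 0)" by real_asymp
      show "((\<lambda>h. exp (r * h)) \<longlongrightarrow> 1) (at_right 0)" by real_asymp
      show "((\<lambda>h. (LINT t:{0..h}|lborel. exp (- r * t) * F u t) / h) \<longlongrightarrow> exp (- r * 0) * F u 0) (at_right 0)"
        by (rule tendsto_average) (intro continuous_intros Fc[OF u])
    qed
    then show ?thesis
    proof (rule Lim_transform_eventually[THEN tendsto_eq_rhs])
      have "\<forall>\<^sub>F h in at_right (0::real). 0 < h" by (simp add: eventually_at_right_less)
      then show "\<forall>\<^sub>F h in at_right 0. (exp (r * h) - 1) / h * laplace r (F u)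
          - exp (r * h) * ((LINT t:{0..h}|lborel. exp (- r * t) * F u t) / h)
          = (laplace r (\<lambda>t. F u (t + h)) - laplace r (F u)) / h"
      proof eventually_elim
        case (elim h)
        have shift: "laplace r (\<lambda>t. F u (t + h))
          = exp (r * h) * (laplace r (F u) - (LINT t:{0..h}|lborel. exp (- r * t) * F u t))"
          using elim by (intro laplace_shift[OF Fc[OF u] Fb[OF u] r]) auto
        show ?case unfolding shift by (simp add: diff_divide_distrib add_divide_distrib algebra_simps)
      qed
    qed simp
  qed
  ultimately have "laplace r (F w) = r * laplace r (F u) - F u 0"
    by (rule tendsto_unique[OF trivial_limit_at_right_real])
  moreover have "laplace r (\<lambda>t. LINT x:B|m. Q t (\<lambda>x. r * u x - w x) x) = r * laplace r (F u) + (- 1) * laplace r (F w)"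
  proof -
    have "laplace r (\<lambda>t. LINT x:B|m. Q t (\<lambda>x. r * u x - w x) x) = laplace r (\<lambda>t. r * F u t + (- 1) * F w t)"
      unfolding laplace_def set_lebesgue_integral_def[of lborel]
      using set_integral_lincomb[OF _ u w B, of _ r "- 1"]
      by (intro Bochner_Integration.integral_cong refl) (auto simp: indicator_def F_def)
    also have "\<dots> = r * laplace r (F u) + (- 1) * laplace r (F w)"
      by (rule laplace_lincomb[OF Fc[OF u] Fb[OF u] Fc[OF w] Fb[OF w] r])
    finally show ?thesis .
  qed
  moreover have "F u 0 = (LINT x:B|m. u x)"
    unfolding F_def set_lebesgue_integral_def
    using at_0[OF u] integrable[OF _ u, of 0] u B
    by (intro integral_cong_AE) (auto elim!: eventually_mono)
  ultimately show ?thesis by simp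
qed

end

section \<open>Positive operators on functions and their preduals on \<open>L\<^sup>1\<close>\<close>

text \<open>
  Transition kernels act on nonnegative functions, semigroups act on \<open>L\<^sup>1\<close>; the pairing relates the two
  sides. Values in \<open>ennreal\<close> make Tonelli's theorem and monotone convergence available without any
  integrability conditions. For \<open>u\<close> in the positive cone the function \<open>ennreal (u x)\<close> loses nothing.
\<close>

abbreviation pairing :: "'a measure \<Rightarrow> ('a \<Rightarrow> ennreal) \<Rightarrow> ('a \<Rightarrow> real) \<Rightarrow> ennreal" where
  "pairing m f u \<equiv> (\<integral>\<^sup>+x. f x * ennreal (u x) \<partial>m)"

lemma L1_posD:
  assumes "u \<in> L1_pos m"
  shows "integrable m u" "AE x in m. 0 \<le> u x" "u \<in> borel_measurable m"
  using assms unfolding L1_pos_def by auto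

lemma L1_pos_set_integral:
  assumes u: "u \<in> L1_pos m" and B: "B \<in> sets m"
  shows "ennreal (LINT x:B|m. u x) = pairing m (indicator B) u" and "0 \<le> (LINT x:B|m. u x)"
proof -
  have 0: "AE x in m. 0 \<le> indicator B x *\<^sub>R u x"
    using L1_posD(2)[OF u] by eventually_elim (auto simp: indicator_def)
  have "pairing m (indicator B) u = (\<integral>\<^sup>+x. ennreal (indicator B x *\<^sub>R u x) \<partial>m)"
    by (intro nn_integral_cong) (auto simp: indicator_def)
  also have "\<dots> = ennreal (LINT x:B|m. u x)"
    unfolding set_lebesgue_integral_def
    by (rule nn_integral_eq_integral[OF integrable_mult_indicator[OF B L1_posD(1)[OF u]] 0])
  finally show "ennreal (LINT x:B|m. u x) = pairing m (indicator B) u" by simp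
  show "0 \<le> (LINT x:B|m. u x)"
    unfolding set_lebesgue_integral_def using 0 by (rule integral_nonneg_AE)
qed

lemma L1_pos_norm:
  assumes u: "u \<in> L1_pos m"
  shows "L1_norm m u = (LINT x|m. u x)" and "ennreal (L1_norm m u) = pairing m (\<lambda>_. 1) u"
proof -
  show *: "L1_norm m u = (LINT x|m. u x)"
    unfolding L1_norm_def using L1_posD[OF u] by (intro integral_cong_AE) auto
  show "ennreal (L1_norm m u) = pairing m (\<lambda>_. 1) u"
    unfolding * using nn_integral_eq_integral[OF L1_posD(1,2)[OF u]] by simp
qed

lemma L1_parts:
  assumes u: "integrable m u"
  obtains p n where "p \<in> L1_pos m" "n \<in> L1_pos m" "u = (\<lambda>x. p x - n x)"
    "L1_norm m u = L1_norm m p + L1_norm m n"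
proof
  let ?p = "\<lambda>x. max 0 (u x)" and ?n = "\<lambda>x. max 0 (- u x)"
  show p: "?p \<in> L1_pos m" and n: "?n \<in> L1_pos m" using u unfolding L1_pos_def by auto
  show "u = (\<lambda>x. ?p x - ?n x)" by (auto simp: max_def)
  have "L1_norm m u = (LINT x|m. ?p x + ?n x)"
    unfolding L1_norm_def by (intro Bochner_Integration.integral_cong) auto
  then show "L1_norm m u = L1_norm m ?p + L1_norm m ?n"
    unfolding L1_pos_norm(1)[OF p] L1_pos_norm(1)[OF n] using u by simp
qed

lemma L1_norm_diff_le:
  assumes "integrable m u" "integrable m v"
  shows "L1_norm m (\<lambda>x. u x - v x) \<le> L1_norm m u + L1_norm m v"
  using L1_norm_add_le[of m u "\<lambda>x. - v x"] L1_norm_cmult[of m "- 1" v] assms by simp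

lemma L1_norm_linear_diff_le:
  assumes T: "L1_linear m T" and p: "integrable m p" and n: "integrable m n"
  shows "L1_norm m (T (\<lambda>x. p x - n x)) \<le> L1_norm m (T p) + L1_norm m (T n)"
proof -
  note i = L1_linearD(1)[OF T p] L1_linearD(1)[OF T n] L1_linearD(1)[OF T, of "\<lambda>x. p x - n x"]
  have "L1_norm m (T (\<lambda>x. p x - n x)) = L1_norm m (\<lambda>x. T p x - T n x)"
    using L1_linear_diff[OF T p n] i p n by (intro L1_norm_cong_AE) auto
  also have "\<dots> \<le> L1_norm m (T p) + L1_norm m (T n)" using i by (intro L1_norm_diff_le)
  finally show ?thesis .
qed

lemma L1_linear_eqI:
  assumes T: "L1_linear m T" "L1_linear m T'"
    and eq: "\<And>u. u \<in> L1_pos m \<Longrightarrow> AE x in m. T u x = T' u x"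
    and u: "integrable m u"
  shows "AE x in m. T u x = T' u x"
proof -
  obtain p n where pn: "p \<in> L1_pos m" "n \<in> L1_pos m" and u_eq: "u = (\<lambda>x. p x - n x)"
    by (rule L1_parts[OF u])
  show ?thesis
    unfolding u_eq
    using L1_linear_diff[OF T(1) pn[THEN L1_posD(1)]] L1_linear_diff[OF T(2) pn[THEN L1_posD(1)]]
      eq[OF pn(1)] eq[OF pn(2)]
    by eventually_elim simp
qed

lemma L1_linear_minus_id:
  assumes T: "L1_linear m T"
  shows "L1_linear m (\<lambda>u x. T u x - u x)"
  unfolding L1_linear_def
proof (intro conjI allI impI)
  fix u v :: "'a \<Rightarrow> real" and c assume u: "integrable m u"
  show "integrable m (\<lambda>x. T u x - u x)" using L1_linearD(1)[OF T u] u by auto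
  show "AE x in m. T (\<lambda>y. c * u y) x - c * u x = c * (T u x - u x)"
    using L1_linearD(4)[OF T u, of c] by eventually_elim (simp add: right_diff_distrib)
  assume v: "integrable m v"
  show "AE x in m. T (\<lambda>y. u y + v y) x - (u x + v x) = T u x - u x + (T v x - v x)"
    using L1_linearD(3)[OF T u v] by eventually_elim simp
  assume eq: "AE x in m. u x = v x"
  show "AE x in m. T u x - u x = T v x - v x"
    using L1_linearD(2)[OF T u v eq] eq by eventually_elim simp
qed

lemma L1_linear_comp:
  assumes T: "L1_linear m T" and T': "L1_linear m T'"
  shows "L1_linear m (\<lambda>u. T (T' u))"
  unfolding L1_linear_def
proof (intro conjI allI impI)
  fix u v :: "'a \<Rightarrow> real" and c assume u: "integrable m u"
  show i: "integrable m (T (T' u))" using L1_linearD(1)[OF T] L1_linearD(1)[OF T'] u by blast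
  note iu = L1_linearD(1)[OF T' u]
  show "AE x in m. T (T' (\<lambda>y. c * u y)) x = c * T (T' u) x"
    using L1_linearD(2)[OF T _ _ L1_linearD(4)[OF T' u, of c]] L1_linearD(4)[OF T iu, of c]
      L1_linearD(1)[OF T', of "\<lambda>y. c * u y"] u iu
    by (auto elim: AE_mp)
  assume v: "integrable m v"
  note iv = L1_linearD(1)[OF T' v]
  show "AE x in m. T (T' (\<lambda>y. u y + v y)) x = T (T' u) x + T (T' v) x"
    using L1_linearD(2)[OF T _ _ L1_linearD(3)[OF T' u v]] L1_linearD(3)[OF T iu iv]
      L1_linearD(1)[OF T', of "\<lambda>y. u y + v y"] u v iu iv
    by (auto elim: AE_mp)
  assume "AE x in m. u x = v x"
  from L1_linearD(2)[OF T iu iv L1_linearD(2)[OF T' u v this]]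
  show "AE x in m. T (T' u) x = T (T' v) x" .
qed

text \<open>
  The properties of \<open>f \<mapsto> (x \<mapsto> \<integral>f(y) N(x, dy))\<close> for a kernel \<open>N\<close>. Working with the operators
  instead of kernels avoids constructing measures for the sums and limits of operators that occur below.
\<close>

locale positive_operator =
  fixes m :: "'a measure" and T :: "('a \<Rightarrow> ennreal) \<Rightarrow> 'a \<Rightarrow> ennreal"
  assumes meas: "\<And>f. f \<in> borel_measurable m \<Longrightarrow> T f \<in> borel_measurable m"
    and op_cong: "\<And>f g x. (\<And>y. y \<in> space m \<Longrightarrow> f y = g y) \<Longrightarrow> x \<in> space m \<Longrightarrow> T f x = T g x"
    and op_add: "\<And>f g x. f \<in> borel_measurable m \<Longrightarrow> g \<in> borel_measurable m \<Longrightarrow> x \<in> space m \<Longrightarrow>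
      T (\<lambda>y. f y + g y) x = T f x + T g x"
    and op_cmult: "\<And>f c x. f \<in> borel_measurable m \<Longrightarrow> x \<in> space m \<Longrightarrow> T (\<lambda>y. c * f y) x = c * T f x"
    and op_SUP: "\<And>F x. (\<And>i::nat. F i \<in> borel_measurable m) \<Longrightarrow>
      (\<And>i y. y \<in> space m \<Longrightarrow> F i y \<le> F (Suc i) y) \<Longrightarrow> x \<in> space m \<Longrightarrow>
      T (\<lambda>y. SUP i. F i y) x = (SUP i. T (F i) x)"
begin

lemma op_0: "x \<in> space m \<Longrightarrow> T (\<lambda>_. 0) x = 0"
  using op_cmult[of "\<lambda>_. 0" x 0] by simp

lemma op_mono:
  assumes f: "f \<in> borel_measurable m" "g \<in> borel_measurable m" "\<And>y. y \<in> space m \<Longrightarrow> f y \<le> g y"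
    and x: "x \<in> space m"
  shows "T f x \<le> T g x"
proof -
  \<comment> \<open>monotonicity is continuity along the two-step sequence \<open>f \<le> max f g\<close>, and \<open>max f g = g\<close> on the space\<close>
  define F where "F i = (if i = 0 then f else (\<lambda>y. max (f y) (g y)))" for i :: nat
  have sup: "(SUP i. F i y) = max (f y) (g y)" for y
    by (rule antisym, rule SUP_least) (auto simp: F_def intro!: SUP_upper2[of "Suc 0"])
  have "T f x \<le> (SUP i. T (F i) x)" by (rule SUP_upper2[of 0]) (auto simp: F_def)
  also have "\<dots> = T (\<lambda>y. SUP i. F i y) x"
    using f by (intro op_SUP[symmetric] x) (auto simp: F_def)
  also have "\<dots> = T g x" unfolding sup using f by (intro op_cong x) (auto simp: max_def)
  finally show ?thesis .
qed

lemma op_sum: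
  assumes "finite I" "\<And>i. i \<in> I \<Longrightarrow> F i \<in> borel_measurable m" "x \<in> space m"
  shows "T (\<lambda>y. \<Sum>i\<in>I. F i y) x = (\<Sum>i\<in>I. T (F i) x)"
  using assms by (induction I) (auto simp: op_0 op_add)

lemma op_suminf:
  assumes F: "\<And>i::nat. F i \<in> borel_measurable m" and x: "x \<in> space m"
  shows "T (\<lambda>y. \<Sum>i. F i y) x = (\<Sum>i. T (F i) x)"
proof -
  have "T (\<lambda>y. \<Sum>i. F i y) x = T (\<lambda>y. SUP n. \<Sum>i<n. F i y) x"
    by (intro op_cong x) (simp add: suminf_eq_SUP)
  also have "\<dots> = (SUP n. T (\<lambda>y. \<Sum>i<n. F i y) x)"
    using F x by (intro op_SUP) auto
  also have "\<dots> = (\<Sum>i. T (F i) x)"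
    using F x by (simp add: op_sum suminf_eq_SUP)
  finally show ?thesis .
qed

text \<open>
  A duality relation needs to be checked on sets only: both sides are additive, homogeneous and continuous
  along increasing sequences in \<open>f\<close>.
\<close>

lemma pairing_extend:
  assumes u: "u \<in> borel_measurable m" and q: "q \<in> borel_measurable m"
    and B: "\<And>B. B \<in> sets m \<Longrightarrow> pairing m (indicator B) q = pairing m (T (indicator B)) u"
    and f: "f \<in> borel_measurable m"
  shows "pairing m f q = pairing m (T f) u"
  using f
proof (induction f rule: borel_measurable_induct)
  case (cong f g)
  have "pairing m f q = pairing m g q" using cong by (intro nn_integral_cong) auto
  also have "\<dots> = pairing m (T f) u"
    unfolding cong(4) using op_cong[of f g] cong(3) by (intro nn_integral_cong) auto
  finally show ?case .
next
  case (set A)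
  then show ?case using B by auto
next
  case (mult f c)
  have [measurable]: "f \<in> borel_measurable m" "T f \<in> borel_measurable m" using mult meas by auto
  note u[measurable] q[measurable]
  have "pairing m (\<lambda>x. c * f x) q = c * pairing m f q"
    by (simp add: mult.assoc nn_integral_cmult)
  also have "\<dots> = c * pairing m (T f) u" using mult by simp
  also have "\<dots> = (\<integral>\<^sup>+x. c * (T f x * ennreal (u x)) \<partial>m)"
    by (simp add: nn_integral_cmult)
  also have "\<dots> = pairing m (T (\<lambda>x. c * f x)) u"
    using mult by (intro nn_integral_cong) (simp add: op_cmult mult.assoc)
  finally show ?case .
next
  case (add f g)
  have [measurable]: "f \<in> borel_measurable m" "T f \<in> borel_measurable m"
    "g \<in> borel_measurable m" "T g \<in> borel_measurable m" using add meas by auto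
  note u[measurable] q[measurable]
  have "pairing m (\<lambda>x. g x + f x) q = pairing m g q + pairing m f q"
    by (simp add: distrib_right nn_integral_add)
  also have "\<dots> = (\<integral>\<^sup>+x. T g x * ennreal (u x) + T f x * ennreal (u x) \<partial>m)"
    using add by (simp add: nn_integral_add)
  also have "\<dots> = pairing m (T (\<lambda>x. g x + f x)) u"
    using add by (intro nn_integral_cong) (simp add: op_add distrib_right)
  finally show ?case .
next
  case (seq U)
  have [measurable]: "U i \<in> borel_measurable m" "T (U i) \<in> borel_measurable m" for i
    using seq meas by auto
  note u[measurable] q[measurable]
  have sup: "(SUP i. U i) = (\<lambda>x. SUP i. U i x)" by (rule ext) (rule SUP_apply)
  have incT: "T (U i) x \<le> T (U j) x" if "i \<le> j" "x \<in> space m" for i j x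
    using seq that by (intro op_mono) (auto simp: incseq_def le_fun_def)
  have "pairing m (SUP i. U i) q = (\<integral>\<^sup>+x. (SUP i. U i x * ennreal (q x)) \<partial>m)"
    unfolding sup by (simp add: SUP_mult_right_ennreal)
  also have "\<dots> = (SUP i. pairing m (U i) q)"
    using seq by (intro nn_integral_monotone_convergence_SUP)
      (auto simp: incseq_def le_fun_def intro!: mult_right_mono)
  also have "\<dots> = (SUP i. pairing m (T (U i)) u)" using seq by simp
  also have "\<dots> = (\<integral>\<^sup>+x. (SUP i. T (U i) x * ennreal (u x)) \<partial>m)"
    by (intro nn_integral_monotone_convergence_SUP_AE[symmetric])
      (auto intro!: AE_I2 mult_right_mono incT)
  also have "\<dots> = pairing m (T (SUP i. U i)) u"
    unfolding sup using seq(1) incseq_SucD[OF seq(3)]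
    by (intro nn_integral_cong) (simp add: op_SUP SUP_mult_right_ennreal le_fun_def)
  finally show ?case .
qed

end

text \<open>
  The operator on \<open>L\<^sup>1\<close> whose adjoint is \<open>T\<close>. It is specified by real integrals over sets rather than by
  the pairing, so that one formula covers arguments of arbitrary sign and linearity follows from uniqueness.
\<close>

definition predual :: "'a measure \<Rightarrow> (('a \<Rightarrow> ennreal) \<Rightarrow> 'a \<Rightarrow> ennreal) \<Rightarrow> ('a \<Rightarrow> real) \<Rightarrow> 'a \<Rightarrow> real" where
  "predual m T u = (SOME q. integrable m q \<and>
     (\<forall>B\<in>sets m. (LINT x:B|m. q x) = (LINT x|m. enn2real (T (indicator B) x) * u x)))"

locale sub_markov_operator = positive_operator + sigma_finite_measure m +
  assumes op_le_1: "\<And>x. x \<in> space m \<Longrightarrow> T (\<lambda>_. 1) x \<le> 1"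
    and op_null: "\<And>N. N \<in> null_sets m \<Longrightarrow> AE x in m. T (indicator N) x = 0"
begin

lemma op_indicator_le_1: "x \<in> space m \<Longrightarrow> B \<in> sets m \<Longrightarrow> T (indicator B) x \<le> 1"
  by (rule order_trans[OF op_mono[of _ "\<lambda>_. 1"] op_le_1]) (auto simp: indicator_def)

text \<open>
  The set function \<open>B \<mapsto> \<integral>T 1\<^sub>B u dm\<close> is a finite measure, and it is absolutely continuous because \<open>T\<close>
  maps null functions to null functions; its Radon-Nikodym density is the predual of \<open>u\<close>.
\<close>

lemma predual_pos_exists:
  assumes u: "u \<in> L1_pos m"
  shows "\<exists>q\<in>L1_pos m. \<forall>f\<in>borel_measurable m. pairing m f q = pairing m (T f) u"
proof -
  note [measurable] = L1_posD(3)[OF u]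
  define \<mu> where "\<mu> B = pairing m (T (indicator B)) u" for B
  have Tm[measurable]: "T (indicator B) \<in> borel_measurable m" if "B \<in> sets m" for B
    using that by (intro meas) auto
  define \<nu> where "\<nu> = measure_of (space m) (sets m) \<mu>"
  have sets_\<nu>: "sets \<nu> = sets m" unfolding \<nu>_def by simp
  have em: "emeasure \<nu> B = \<mu> B" if "B \<in> sets m" for B
  proof (rule emeasure_measure_of[OF \<nu>_def])
    show "sets m \<subseteq> Pow (space m)" by (rule sets.space_closed)
    show "positive (sets \<nu>) \<mu>"
    proof -
      have "\<mu> {} = (\<integral>\<^sup>+x. 0 \<partial>m)"
        unfolding \<mu>_def by (intro nn_integral_cong) (auto simp: op_0 indicator_def[abs_def])
      then show ?thesis by (simp add: positive_def)
    qed
    show "countably_additive (sets \<nu>) \<mu>"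
      unfolding countably_additive_def sets_\<nu>
    proof (intro allI impI)
      fix A :: "nat \<Rightarrow> 'a set" assume A: "range A \<subseteq> sets m" "disjoint_family A" "\<Union> (range A) \<in> sets m"
      have ind: "indicator (\<Union> (range A)) = (\<lambda>y. \<Sum>i. indicator (A i) y :: ennreal)"
        using suminf_indicator[OF A(2)] by auto
      have "(\<Sum>i. \<mu> (A i)) = (\<integral>\<^sup>+x. (\<Sum>i. T (indicator (A i)) x * ennreal (u x)) \<partial>m)"
        unfolding \<mu>_def using A(1) by (intro nn_integral_suminf[symmetric]) auto
      also have "\<dots> = \<mu> (\<Union> (range A))"
        unfolding \<mu>_def ind using A(1)
        by (intro nn_integral_cong) (auto simp: op_suminf image_subset_iff)
      finally show "(\<Sum>i. \<mu> (A i)) = \<mu> (\<Union> (range A))" .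
    qed
    show "B \<in> sets \<nu>" using that by (simp add: sets_\<nu>)
  qed
  have "absolutely_continuous m \<nu>"
    unfolding absolutely_continuous_def
  proof
    fix N assume N: "N \<in> null_sets m"
    have "\<mu> N = (\<integral>\<^sup>+x. 0 \<partial>m)"
      unfolding \<mu>_def using op_null[OF N] by (intro nn_integral_cong_AE) auto
    then show "N \<in> null_sets \<nu>" using N by (intro null_setsI) (auto simp: em sets_\<nu>)
  qed
  then obtain g where g[measurable]: "g \<in> borel_measurable m" and dens: "density m g = \<nu>"
    using Radon_Nikodym sets_\<nu> by blast
  have g_pair: "(\<integral>\<^sup>+x. g x * indicator B x \<partial>m) = \<mu> B" if "B \<in> sets m" for B
    using emeasure_density[OF g that] dens em[OF that] by simp
  have "(\<integral>\<^sup>+x. g x \<partial>m) = \<mu> (space m)"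
    unfolding g_pair[OF sets.top, symmetric] by (intro nn_integral_cong) simp
  also have "\<dots> \<le> pairing m (\<lambda>_. 1) u"
    unfolding \<mu>_def by (intro nn_integral_mono mult_right_mono op_indicator_le_1) auto
  also have "\<dots> < \<infinity>" unfolding L1_pos_norm(2)[OF u, symmetric] by (simp add: ennreal_less_top)
  finally have g_fin: "(\<integral>\<^sup>+x. g x \<partial>m) < \<infinity>" .
  have g_AE: "AE x in m. g x < \<infinity>"
    using nn_integral_PInf_AE[OF g] g_fin by (auto simp: less_top)
  define q where "q x = enn2real (g x)" for x
  have [measurable]: "q \<in> borel_measurable m" unfolding q_def[abs_def] by measurable
  have gq: "AE x in m. ennreal (q x) = g x"
    using g_AE by eventually_elim (simp add: q_def)
  have "integrable m q"
  proof (rule integrableI_nonneg)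
    have "(\<integral>\<^sup>+x. ennreal (q x) \<partial>m) = (\<integral>\<^sup>+x. g x \<partial>m)" using gq by (rule nn_integral_cong_AE)
    then show "(\<integral>\<^sup>+x. ennreal (q x) \<partial>m) < \<infinity>" using g_fin by simp
  qed (auto simp: q_def)
  then have q: "q \<in> L1_pos m" by (auto simp: L1_pos_def q_def)
  have "pairing m f q = pairing m (T f) u" if "f \<in> borel_measurable m" for f
  proof (rule pairing_extend[OF _ _ _ that])
    fix B assume B: "B \<in> sets m"
    have "pairing m (indicator B) q = (\<integral>\<^sup>+x. g x * indicator B x \<partial>m)"
      using gq by (intro nn_integral_cong_AE) (auto simp: mult.commute)
    then show "pairing m (indicator B) q = pairing m (T (indicator B)) u"
      using g_pair[OF B] by (simp add: \<mu>_def)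
  qed auto
  with q show ?thesis by blast
qed

lemma op_real_integrable:
  assumes u: "integrable m u" and B: "B \<in> sets m"
  shows "integrable m (\<lambda>x. enn2real (T (indicator B) x) * u x)"
proof (rule Bochner_Integration.integrable_bound[OF u])
  have [measurable]: "T (indicator B) \<in> borel_measurable m" using B by (intro meas) auto
  show "(\<lambda>x. enn2real (T (indicator B) x) * u x) \<in> borel_measurable m" using u by measurable
  have "enn2real (T (indicator B) x) \<le> 1" if "x \<in> space m" for x
    using enn2real_mono[OF op_indicator_le_1[OF that B]] by simp
  then show "AE x in m. norm (enn2real (T (indicator B) x) * u x) \<le> norm (u x)"
    by (intro AE_I2) (simp add: abs_mult mult_left_le_one_le)
qed

lemma pairing_eq_real_integral:
  assumes u: "u \<in> L1_pos m" and B: "B \<in> sets m"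
  shows "pairing m (T (indicator B)) u = ennreal (LINT x|m. enn2real (T (indicator B) x) * u x)"
    and "0 \<le> (LINT x|m. enn2real (T (indicator B) x) * u x)"
proof -
  have 0: "AE x in m. 0 \<le> enn2real (T (indicator B) x) * u x"
    using L1_posD(2)[OF u] by eventually_elim simp
  then show "0 \<le> (LINT x|m. enn2real (T (indicator B) x) * u x)" by (rule integral_nonneg_AE)
  have "pairing m (T (indicator B)) u = (\<integral>\<^sup>+x. ennreal (enn2real (T (indicator B) x) * u x) \<partial>m)"
  proof (intro nn_integral_cong)
    fix x assume x: "x \<in> space m"
    have "ennreal (enn2real (T (indicator B) x)) = T (indicator B) x"
      using le_less_trans[OF op_indicator_le_1[OF x B] ennreal_one_less_top] by (rule ennreal_enn2real)
    then show "T (indicator B) x * ennreal (u x) = ennreal (enn2real (T (indicator B) x) * u x)"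
      by (simp add: ennreal_mult')
  qed
  then show "pairing m (T (indicator B)) u = ennreal (LINT x|m. enn2real (T (indicator B) x) * u x)"
    using nn_integral_eq_integral[OF op_real_integrable[OF L1_posD(1)[OF u] B] 0] by simp
qed

lemma predual_spec:
  assumes u: "integrable m u"
  shows "integrable m (predual m T u)"
    and "\<And>B. B \<in> sets m \<Longrightarrow>
      (LINT x:B|m. predual m T u x) = (LINT x|m. enn2real (T (indicator B) x) * u x)"
proof -
  obtain p n where pn: "p \<in> L1_pos m" "n \<in> L1_pos m" and u_eq: "u = (\<lambda>x. p x - n x)"
    by (rule L1_parts[OF u])
  have *: "\<exists>q. integrable m q \<and>
     (\<forall>B\<in>sets m. (LINT x:B|m. q x) = (LINT x|m. enn2real (T (indicator B) x) * v x))"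
    if v: "v \<in> L1_pos m" for v
  proof -
    from predual_pos_exists[OF v] obtain q where q: "q \<in> L1_pos m"
      "\<And>f. f \<in> borel_measurable m \<Longrightarrow> pairing m f q = pairing m (T f) v" by blast
    have "(LINT x:B|m. q x) = (LINT x|m. enn2real (T (indicator B) x) * v x)" if B: "B \<in> sets m" for B
    proof -
      have "ennreal (LINT x:B|m. q x) = ennreal (LINT x|m. enn2real (T (indicator B) x) * v x)"
        using q(2)[of "indicator B"] B L1_pos_set_integral(1)[OF q(1) B] pairing_eq_real_integral(1)[OF v B] by simp
      then show ?thesis
        using L1_pos_set_integral(2)[OF q(1) B] pairing_eq_real_integral(2)[OF v B] by simp
    qed
    with L1_posD(1)[OF q(1)] show ?thesis by blast
  qed
  obtain a b where a: "integrable m a" "\<And>B. B\<in>sets m \<Longrightarrow> (LINT x:B|m. a x) = (LINT x|m. enn2real (T (indicator B) x) * p x)"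
    and b: "integrable m b" "\<And>B. B\<in>sets m \<Longrightarrow> (LINT x:B|m. b x) = (LINT x|m. enn2real (T (indicator B) x) * n x)"
    using *[OF pn(1)] *[OF pn(2)] by blast
  have "(LINT x:B|m. a x - b x) = (LINT x|m. enn2real (T (indicator B) x) * u x)" if B: "B \<in> sets m" for B
  proof -
    have "(LINT x:B|m. a x - b x) = (LINT x:B|m. a x) - (LINT x:B|m. b x)"
      using a b B by (intro set_integral_diff set_integrable_subset_of_integrable)
    also have "\<dots> = (LINT x|m. enn2real (T (indicator B) x) * p x - enn2real (T (indicator B) x) * n x)"
      unfolding a(2)[OF B] b(2)[OF B]
      by (intro Bochner_Integration.integral_diff[symmetric] op_real_integrable B pn[THEN L1_posD(1)])
    finally show ?thesis unfolding u_eq by (simp add: right_diff_distrib)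
  qed
  moreover have "integrable m (\<lambda>x. a x - b x)" using a b by auto
  ultimately have ex: "\<exists>q. integrable m q \<and>
     (\<forall>B\<in>sets m. (LINT x:B|m. q x) = (LINT x|m. enn2real (T (indicator B) x) * u x))" by blast
  from someI_ex[OF ex] show "integrable m (predual m T u)"
    and "\<And>B. B \<in> sets m \<Longrightarrow>
      (LINT x:B|m. predual m T u x) = (LINT x|m. enn2real (T (indicator B) x) * u x)"
    unfolding predual_def by auto
qed

lemma predual_unique:
  assumes u: "integrable m u" and q: "integrable m q"
    and eq: "\<And>B. B \<in> sets m \<Longrightarrow> (LINT x:B|m. q x) = (LINT x|m. enn2real (T (indicator B) x) * u x)"
  shows "AE x in m. predual m T u x = q x"
  using predual_spec[OF u] q eq by (intro density_unique_real) auto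

lemma predual_linear: "L1_linear m (predual m T)"
  unfolding L1_linear_def
proof (intro conjI allI impI)
  fix u v :: "'a \<Rightarrow> real" and c assume u: "integrable m u"
  show "integrable m (predual m T u)" by (rule predual_spec(1)[OF u])
  show "AE x in m. predual m T (\<lambda>y. c * u y) x = c * predual m T u x"
    using u predual_spec[OF u] by (intro predual_unique) (auto simp: mult.left_commute)
  assume v: "integrable m v"
  show "AE x in m. predual m T (\<lambda>y. u y + v y) x = predual m T u x + predual m T v x"
  proof (rule predual_unique)
    fix B assume B: "B \<in> sets m"
    have "(LINT x:B|m. predual m T u x + predual m T v x) = (LINT x:B|m. predual m T u x) + (LINT x:B|m. predual m T v x)"
      using predual_spec(1)[OF u] predual_spec(1)[OF v] B
      by (intro set_integral_add set_integrable_subset_of_integrable)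
    also have "\<dots> = (LINT x|m. enn2real (T (indicator B) x) * u x + enn2real (T (indicator B) x) * v x)"
      unfolding predual_spec(2)[OF u B] predual_spec(2)[OF v B]
      by (intro Bochner_Integration.integral_add[symmetric] op_real_integrable B u v)
    finally show "(LINT x:B|m. predual m T u x + predual m T v x)
        = (LINT x|m. enn2real (T (indicator B) x) * (u x + v x))" by (simp add: distrib_left)
  qed (use u v predual_spec(1)[OF u] predual_spec(1)[OF v] in auto)
  assume eq: "AE x in m. u x = v x"
  show "AE x in m. predual m T u x = predual m T v x"
  proof (rule predual_unique[OF u predual_spec(1)[OF v]])
    fix B assume B: "B \<in> sets m"
    show "(LINT x:B|m. predual m T v x) = (LINT x|m. enn2real (T (indicator B) x) * u x)"
      unfolding predual_spec(2)[OF v B]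
      using op_real_integrable[OF u B] op_real_integrable[OF v B] eq
      by (intro integral_cong_AE) (auto elim!: eventually_mono)
  qed
qed

lemma predual_pos:
  assumes u: "u \<in> L1_pos m"
  shows "predual m T u \<in> L1_pos m"
    and "\<And>f. f \<in> borel_measurable m \<Longrightarrow> pairing m f (predual m T u) = pairing m (T f) u"
proof -
  note spec = predual_spec[OF L1_posD(1)[OF u]]
  have "AE x in m. 0 \<le> predual m T u x"
    using spec pairing_eq_real_integral(2)[OF u] by (intro density_nonneg) auto
  then show pos: "predual m T u \<in> L1_pos m" using spec(1) by (simp add: L1_pos_def)
  show "pairing m f (predual m T u) = pairing m (T f) u" if "f \<in> borel_measurable m" for f
  proof (rule pairing_extend[OF L1_posD(3)[OF u] L1_posD(3)[OF pos] _ that])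
    fix B assume B: "B \<in> sets m"
    show "pairing m (indicator B) (predual m T u) = pairing m (T (indicator B)) u"
      unfolding L1_pos_set_integral(1)[OF pos B, symmetric] spec(2)[OF B] pairing_eq_real_integral(1)[OF u B] ..
  qed
qed

lemma predual_contraction:
  assumes u: "integrable m u"
  shows "L1_norm m (predual m T u) \<le> L1_norm m u"
proof -
  obtain p n where pn: "p \<in> L1_pos m" "n \<in> L1_pos m" and u_eq: "u = (\<lambda>x. p x - n x)"
    and norm_u: "L1_norm m u = L1_norm m p + L1_norm m n"
    by (rule L1_parts[OF u])
  have pos: "L1_norm m (predual m T v) \<le> L1_norm m v" if v: "v \<in> L1_pos m" for v
  proof -
    have "ennreal (L1_norm m (predual m T v)) = pairing m (T (\<lambda>_. 1)) v"
      unfolding L1_pos_norm(2)[OF predual_pos(1)[OF v]] by (rule predual_pos(2)[OF v]) simp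
    also have "\<dots> \<le> pairing m (\<lambda>_. 1) v"
      by (intro nn_integral_mono mult_right_mono op_le_1) auto
    also have "\<dots> = ennreal (L1_norm m v)" unfolding L1_pos_norm(2)[OF v] ..
    finally show ?thesis by (simp only: ennreal_le_iff[OF L1_norm_nonneg])
  qed
  have "L1_norm m (predual m T u) \<le> L1_norm m (predual m T p) + L1_norm m (predual m T n)"
    unfolding u_eq by (rule L1_norm_linear_diff_le[OF predual_linear pn[THEN L1_posD(1)]])
  also have "\<dots> \<le> L1_norm m u" unfolding norm_u using pos[OF pn(1)] pos[OF pn(2)] by simp
  finally show ?thesis .
qed

end

lemma L1_pos_eqI:
  assumes a: "a \<in> L1_pos m" and b: "b \<in> L1_pos m"
    and eq: "\<And>B. B \<in> sets m \<Longrightarrow> pairing m (indicator B) a = pairing m (indicator B) b"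
  shows "AE x in m. a x = b x"
proof (rule density_unique_real)
  fix B assume B: "B \<in> sets m"
  have "ennreal (LINT x:B|m. a x) = ennreal (LINT x:B|m. b x)"
    using eq[OF B] L1_pos_set_integral(1)[OF a B] L1_pos_set_integral(1)[OF b B] by simp
  then show "(LINT x:B|m. a x) = (LINT x:B|m. b x)"
    using L1_pos_set_integral(2)[OF a B] L1_pos_set_integral(2)[OF b B] by simp
qed (use L1_posD(1) a b in auto)

section \<open>The flow, its cumulative rate, and the law of a holding time\<close>

context pdmp_characteristics
begin

abbreviation \<Phi> :: "'a \<Rightarrow> real \<Rightarrow> real" where "\<Phi> \<equiv> cumulative_rate \<pi> \<phi>"

abbreviation BE :: "'a measure" where "BE \<equiv> borel_on E"

text \<open>
  The flow, frozen at negative times, which makes it jointly measurable on the whole line.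
\<close>

definition flow :: "real \<Rightarrow> 'a \<Rightarrow> 'a" where "flow t x = \<pi> (max 0 t) x"

lemma space_BE[simp]: "space BE = E"
  by (simp add: space_restrict_space)

lemma flow_in_E[simp]: "x \<in> E \<Longrightarrow> flow t x \<in> E"
  unfolding flow_def by (rule flow_in) auto

lemma flow_nonneg: "0 \<le> t \<Longrightarrow> flow t x = \<pi> t x"
  by (simp add: flow_def)

lemma flow_measurable[measurable (raw)]:
  assumes f: "f \<in> borel_measurable M" and g: "g \<in> M \<rightarrow>\<^sub>M BE"
  shows "(\<lambda>z. flow (f z) (g z)) \<in> M \<rightarrow>\<^sub>M BE"
proof (rule measurable_restrict_space2)
  have gE: "g z \<in> E" if "z \<in> space M" for z using measurable_space[OF g that] by simp
  then show "(\<lambda>z. flow (f z) (g z)) \<in> space M \<rightarrow> E" by auto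
  have g': "g \<in> M \<rightarrow>\<^sub>M borel"
    using measurable_restrict_space3 g by (simp add: measurable_restrict_space2_iff)
  have "(\<lambda>z. (max 0 (f z), g z)) \<in> M \<rightarrow>\<^sub>M restrict_space borel ({0..} \<times> E)"
  proof (rule measurable_restrict_space2)
    show "(\<lambda>z. (max 0 (f z), g z)) \<in> space M \<rightarrow> {0..} \<times> E" using gE by auto
    show "(\<lambda>z. (max 0 (f z), g z)) \<in> M \<rightarrow>\<^sub>M borel"
      unfolding borel_prod[symmetric] using f g' by measurable
  qed
  from measurable_compose[OF this borel_measurable_continuous_on_restrict[OF flow_continuous]]
  show "(\<lambda>z. flow (f z) (g z)) \<in> borel_measurable M" by (simp add: flow_def)
qed

lemma rate_measurable'[measurable (raw)]:
  "g \<in> M \<rightarrow>\<^sub>M BE \<Longrightarrow> (\<lambda>z. \<phi> (g z)) \<in> borel_measurable M"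
  by (rule measurable_compose[OF _ rate_measurable])

lemma Phi_eq: "\<Phi> x t = (LINT s|lborel. indicator {0..<t} s * \<phi> (flow s x))"
  unfolding cumulative_rate_def set_lebesgue_integral_def
  by (intro Bochner_Integration.integral_cong) (auto simp: indicator_def flow_def)

lemma Phi_measurable[measurable (raw)]:
  assumes [measurable]: "f \<in> borel_measurable M" "g \<in> M \<rightarrow>\<^sub>M BE"
  shows "(\<lambda>z. \<Phi> (g z) (f z)) \<in> borel_measurable M"
proof -
  have 1: "{p \<in> space (M \<Otimes>\<^sub>M lborel). 0 \<le> snd p \<and> snd p < f (fst p)} \<in> sets (M \<Otimes>\<^sub>M lborel)"
    by measurable
  have "(\<lambda>(z, s). (if 0 \<le> s \<and> s < f z then 1 else 0) * \<phi> (flow s (g z))) \<in> borel_measurable (M \<Otimes>\<^sub>M lborel)"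
    by measurable
  then have "(\<lambda>z. LINT s|lborel. (if 0 \<le> s \<and> s < f z then 1 else 0) * \<phi> (flow s (g z))) \<in> borel_measurable M"
    by (rule lborel.borel_measurable_lebesgue_integral)
  then show ?thesis
    unfolding Phi_eq by (simp add: indicator_def of_bool_def cong: if_cong)
qed

lemma rate_flow_integrable:
  assumes x: "x \<in> E" shows "set_integrable lborel {0..<t} (\<lambda>s. \<phi> (flow s x))"
proof (cases "0 < t")
  case True
  show ?thesis
    using rate_integrable[OF x True] unfolding set_integrable_def
    by (rule Bochner_Integration.integrable_cong[THEN iffD1, rotated 2]) (auto simp: indicator_def flow_def)
qed (simp add: set_integrable_def)

lemma nn_integral_rate:
  assumes x: "x \<in> E"
  shows "(\<integral>\<^sup>+s. ennreal (\<phi> (flow s x)) * indicator {0..<t} s \<partial>lborel) = ennreal (\<Phi> x t)"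
    and "0 \<le> \<Phi> x t"
proof -
  have 0: "AE s in lborel. 0 \<le> indicator {0..<t} s *\<^sub>R \<phi> (flow s x)"
    using rate_nonneg x by (intro AE_I2) (auto simp: indicator_def)
  show "0 \<le> \<Phi> x t" unfolding Phi_eq using integral_nonneg_AE[OF 0] by simp
  have "(\<integral>\<^sup>+s. ennreal (\<phi> (flow s x)) * indicator {0..<t} s \<partial>lborel)
      = (\<integral>\<^sup>+s. ennreal (indicator {0..<t} s *\<^sub>R \<phi> (flow s x)) \<partial>lborel)"
    by (intro nn_integral_cong) (auto simp: indicator_def)
  also have "\<dots> = ennreal (\<Phi> x t)"
    unfolding Phi_eq using nn_integral_eq_integral[OF rate_flow_integrable[OF x, of t, unfolded set_integrable_def] 0] by simp
  finally show "(\<integral>\<^sup>+s. ennreal (\<phi> (flow s x)) * indicator {0..<t} s \<partial>lborel) = ennreal (\<Phi> x t)" .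
qed

lemma Phi_0: "t \<le> 0 \<Longrightarrow> \<Phi> x t = 0"
  unfolding Phi_eq by simp

lemma flow_add': "x \<in> E \<Longrightarrow> 0 \<le> s \<Longrightarrow> 0 \<le> t \<Longrightarrow> flow (s + t) x = flow t (flow s x)"
  using flow_add[of s t x] by (simp add: flow_def add.commute)

lemma nn_integral_rate_interval:
  assumes x: "x \<in> E" and st: "0 \<le> s" "s \<le> t"
  shows "(\<integral>\<^sup>+r. ennreal (\<phi> (flow r x)) * indicator {s..<t} r \<partial>lborel) = ennreal (\<Phi> x t - \<Phi> x s)"
    and "\<Phi> x s \<le> \<Phi> x t"
proof -
  have xm[measurable]: "(\<lambda>r::real. x) \<in> lborel \<rightarrow>\<^sub>M BE" using x by auto
  have "ennreal (\<Phi> x t) = (\<integral>\<^sup>+r. ennreal (\<phi> (flow r x)) * indicator {0..<s} r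
        + ennreal (\<phi> (flow r x)) * indicator {s..<t} r \<partial>lborel)"
    unfolding nn_integral_rate(1)[OF x, symmetric] using st
    by (intro nn_integral_cong) (auto simp: indicator_def)
  also have "\<dots> = ennreal (\<Phi> x s) + (\<integral>\<^sup>+r. ennreal (\<phi> (flow r x)) * indicator {s..<t} r \<partial>lborel)"
    unfolding nn_integral_rate(1)[OF x, symmetric] by (rule nn_integral_add) measurable
  finally have eq: "ennreal (\<Phi> x t) = ennreal (\<Phi> x s)
      + (\<integral>\<^sup>+r. ennreal (\<phi> (flow r x)) * indicator {s..<t} r \<partial>lborel)" .
  then have "ennreal (\<Phi> x s) \<le> ennreal (\<Phi> x t)" by simp
  then show le: "\<Phi> x s \<le> \<Phi> x t" using nn_integral_rate(2)[OF x, of t] by (simp add: ennreal_le_iff)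
  have "ennreal (\<Phi> x t - \<Phi> x s) = ennreal (\<Phi> x t) - ennreal (\<Phi> x s)"
    using nn_integral_rate(2)[OF x, of s] le by (simp add: ennreal_minus)
  then show "(\<integral>\<^sup>+r. ennreal (\<phi> (flow r x)) * indicator {s..<t} r \<partial>lborel) = ennreal (\<Phi> x t - \<Phi> x s)"
    unfolding eq by simp
qed

lemma Phi_add:
  assumes x: "x \<in> E" and st: "0 \<le> s" "0 \<le> t"
  shows "\<Phi> x (s + t) = \<Phi> x s + \<Phi> (flow s x) t"
proof -
  have xm[measurable]: "(\<lambda>r::real. x) \<in> lborel \<rightarrow>\<^sub>M BE" "(\<lambda>r::real. x) \<in> borel \<rightarrow>\<^sub>M BE" using x by auto
  have "ennreal (\<Phi> x (s + t) - \<Phi> x s) = (\<integral>\<^sup>+r. ennreal (\<phi> (flow r x)) * indicator {s..<s+t} r \<partial>lborel)"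
    using nn_integral_rate_interval(1)[OF x st(1), of "s + t"] st by simp
  also have "\<dots> = (\<integral>\<^sup>+r. ennreal (\<phi> (flow (s + 1 * r) x)) * indicator {s..<s+t} (s + 1 * r) \<partial>lborel)"
    by (subst nn_integral_real_affine[where c=1 and t=s]) auto
  also have "\<dots> = (\<integral>\<^sup>+r. ennreal (\<phi> (flow r (flow s x))) * indicator {0..<t} r \<partial>lborel)"
    using st x by (intro nn_integral_cong) (auto simp: indicator_def flow_add')
  also have "\<dots> = ennreal (\<Phi> (flow s x) t)"
    using x by (intro nn_integral_rate) auto
  finally show ?thesis
    using nn_integral_rate_interval(2)[OF x st(1), of "s + t"] nn_integral_rate(2)[of "flow s x" t] st x
    by simp
qed

lemma Phi_mono: "x \<in> E \<Longrightarrow> s \<le> t \<Longrightarrow> \<Phi> x s \<le> \<Phi> x t"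
  using nn_integral_rate_interval(2)[of x s t] nn_integral_rate(2)[of x t] Phi_0[of s x]
  by (cases "0 \<le> s") auto

lemma Phi_continuous:
  assumes x: "x \<in> E" shows "continuous_on {0..b} (\<Phi> x)"
proof -
  have "set_integrable lborel {0..b} (\<lambda>s. \<phi> (flow s x))"
    by (rule set_integrable_subset[OF rate_flow_integrable[OF x, of "b + 1"]]) auto
  note hk = set_borel_integral_eq_integral[OF this]
  have "continuous_on {0..b} (\<lambda>t. integral {0..t} (\<lambda>s. \<phi> (flow s x)))"
    by (rule indefinite_integral_continuous_1[OF hk(1)])
  moreover have "integral {0..t} (\<lambda>s. \<phi> (flow s x)) = \<Phi> x t" for t
  proof -
    have i: "set_integrable lborel {0..t} (\<lambda>s. \<phi> (flow s x))"
      by (rule set_integrable_subset[OF rate_flow_integrable[OF x, of "t + 1"]]) auto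
    have "integral {0..t} (\<lambda>s. \<phi> (flow s x)) = (LINT s:{0..t}|lborel. \<phi> (flow s x))"
      using set_borel_integral_eq_integral(2)[OF i] by simp
    also have "\<dots> = (LINT s:{0..<t}|lborel. \<phi> (flow s x))"
    proof (rule set_integral_cong_set)
      show "set_borel_measurable lborel {0..t} (\<lambda>s. \<phi> (flow s x))"
        "set_borel_measurable lborel {0..<t} (\<lambda>s. \<phi> (flow s x))"
        using i rate_flow_integrable[OF x, of t]
        unfolding set_integrable_def set_borel_measurable_def by (auto dest!: borel_measurable_integrable)
      show "AE s in lborel. (s \<in> {0..<t}) = (s \<in> {0..t})"
        using AE_lborel_singleton[of t] by eventually_elim auto
    qed
    also have "\<dots> = \<Phi> x t" unfolding Phi_eq set_lebesgue_integral_def by simp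
    finally show ?thesis .
  qed
  ultimately show ?thesis by simp
qed

abbreviation inv_rate :: "'a \<Rightarrow> real \<Rightarrow> real" where "inv_rate \<equiv> cumulative_rate_inv \<pi> \<phi>"

text \<open>
  The cumulative rate is continuous, nondecreasing and unbounded, so the infimum that defines the
  generalised inverse is attained.
\<close>

lemma inv_rate_set:
  assumes x: "x \<in> E"
  shows "{t. 0 \<le> t \<and> q \<le> \<Phi> x t} = {inv_rate x q..}" and "0 \<le> inv_rate x q"
proof -
  let ?S = "{t. 0 \<le> t \<and> q \<le> \<Phi> x t}"
  have bdd: "bdd_below ?S" by (rule bdd_belowI[of _ 0]) auto
  obtain t0 where "\<And>t. t0 \<le> t \<Longrightarrow> q \<le> \<Phi> x t"
    using rate_diverges[OF x] unfolding filterlim_at_top eventually_at_top_linorder by blast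
  then have "0 \<le> max 0 t0" "q \<le> \<Phi> x (max 0 t0)" by auto
  then obtain b where b: "0 \<le> b" "q \<le> \<Phi> x b" by blast
  then have ne: "b \<in> ?S" by simp
  show nonneg: "0 \<le> inv_rate x q"
    unfolding cumulative_rate_inv_def using ne by (intro cInf_greatest) (blast, simp)
  have mem: "inv_rate x q \<in> ?S"
  proof -
    have "?S \<inter> {0..b} = {0..b} \<inter> \<Phi> x -` {q..}" by auto
    then have "closed (?S \<inter> {0..b})"
      using continuous_on_closed_vimage[of "{0..b}" "\<Phi> x"] Phi_continuous[OF x, of b]
      by (simp add: Int_commute)
    moreover have "Inf (?S \<inter> {0..b}) = inv_rate x q"
    proof (rule antisym)
      show "inv_rate x q \<le> Inf (?S \<inter> {0..b})"
        unfolding cumulative_rate_inv_def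
      proof (rule cInf_superset_mono)
        have "b \<in> ?S \<inter> {0..b}" using b by auto
        then show "?S \<inter> {0..b} \<noteq> {}" by blast
      qed (use bdd in auto)
      show "Inf (?S \<inter> {0..b}) \<le> inv_rate x q"
        unfolding cumulative_rate_inv_def
      proof (rule cInf_greatest)
        fix s assume s: "s \<in> ?S"
        show "Inf (?S \<inter> {0..b}) \<le> s"
        proof (cases "s \<le> b")
          case True
          then show ?thesis using s by (intro cInf_lower bdd_belowI[of _ 0]) auto
        next
          case False
          have "Inf (?S \<inter> {0..b}) \<le> b" using b by (intro cInf_lower bdd_belowI[of _ 0]) auto
          then show ?thesis using False by simp
        qed
      qed (use b in blast)
    qed
    moreover have "Inf (?S \<inter> {0..b}) \<in> ?S \<inter> {0..b}"
    proof (rule closed_contains_Inf)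
      have "b \<in> ?S \<inter> {0..b}" using b by auto
      then show "?S \<inter> {0..b} \<noteq> {}" by blast
      show "bdd_below (?S \<inter> {0..b})" by (rule bdd_belowI[of _ 0]) auto
    qed fact
    ultimately show ?thesis by auto
  qed
  show "?S = {inv_rate x q..}"
  proof (intro set_eqI iffI)
    fix t assume "t \<in> ?S"
    then show "t \<in> {inv_rate x q..}" unfolding cumulative_rate_inv_def using bdd by (auto intro: cInf_lower)
  next
    fix t assume "t \<in> {inv_rate x q..}"
    then show "t \<in> ?S" using mem nonneg Phi_mono[OF x, of "inv_rate x q" t] by auto
  qed
qed

lemma inv_rate_le_iff: "x \<in> E \<Longrightarrow> inv_rate x q \<le> a \<longleftrightarrow> 0 \<le> a \<and> q \<le> \<Phi> x a"
  using inv_rate_set(1)[of x q] by auto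

lemma Phi_inv_rate:
  assumes x: "x \<in> E" and q: "0 \<le> q" shows "\<Phi> x (inv_rate x q) = q"
proof (rule antisym)
  let ?i = "inv_rate x q"
  show "q \<le> \<Phi> x ?i" using inv_rate_le_iff[OF x, of q ?i] by simp
  have "\<exists>s\<ge>0. s \<le> ?i \<and> \<Phi> x s = q"
    using Phi_0[of 0 x] q \<open>q \<le> \<Phi> x ?i\<close> inv_rate_set(2)[OF x] Phi_continuous[OF x, of ?i]
    by (intro IVT') auto
  then obtain s where s: "0 \<le> s" "s \<le> ?i" "\<Phi> x s = q" by blast
  then have "?i \<le> s" using inv_rate_le_iff[OF x, of q s] by simp
  then show "\<Phi> x ?i \<le> q" using s by simp
qed

lemma inv_rate_measurable[measurable (raw)]:
  assumes [measurable]: "f \<in> borel_measurable M" and g[measurable]: "g \<in> M \<rightarrow>\<^sub>M BE"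
  shows "(\<lambda>z. inv_rate (g z) (f z)) \<in> borel_measurable M"
proof (rule borel_measurableI_le)
  fix a :: real
  have "{z \<in> space M. inv_rate (g z) (f z) \<le> a} = {z \<in> space M. 0 \<le> a \<and> f z \<le> \<Phi> (g z) a}"
    using measurable_space[OF g] by (auto simp: inv_rate_le_iff)
  also have "\<dots> \<in> sets M" by measurable
  finally show "{z \<in> space M. inv_rate (g z) (f z) \<le> a} \<in> sets M" .
qed

lemma nn_integral_exp_tail:
  "(\<integral>\<^sup>+q. ennreal (exp (- q)) * indicator {a..} q \<partial>lborel) = ennreal (exp (- a))" for a :: real
proof -
  have "(\<integral>\<^sup>+q. ennreal (exp (- q)) * indicator {a..} q \<partial>lborel) = ennreal (0 - (- exp (- a)))"
  proof (rule nn_integral_FTC_atLeast)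
    show "((\<lambda>q::real. - exp (- q)) \<longlongrightarrow> 0) at_top" by real_asymp
  qed (auto intro!: derivative_eq_intros)
  then show ?thesis by simp
qed

text \<open>
  The holding time survives \<open>a\<close> with probability \<open>exp (- \<Phi> x a)\<close>. The rate is merely locally integrable
  along the flow, so \<open>exp (- \<Phi> x s)\<close> is only absolutely continuous in \<open>s\<close> and the fundamental theorem of
  calculus for smooth functions does not apply. Instead, \<open>exp (- \<Phi> x s)\<close> is written as the integral of
  \<open>exp (- q)\<close> over \<open>q > \<Phi> x s\<close>, and the order of integration is exchanged: the times \<open>s \<ge> a\<close> with
  \<open>\<Phi> x s < q\<close> form the interval from \<open>a\<close> to the inverse of \<open>q\<close>, whose mass under the rate is
  \<open>q - \<Phi> x a\<close> by continuity.
\<close>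

lemma rate_tail:
  assumes x: "x \<in> E" and a: "0 \<le> a"
  shows "(\<integral>\<^sup>+s. ennreal (exp (- \<Phi> x s)) * ennreal (\<phi> (flow s x)) * indicator {a..} s \<partial>lborel) = ennreal (exp (- \<Phi> x a))"
proof -
  have xm[measurable]: "(\<lambda>r. x) \<in> M \<rightarrow>\<^sub>M BE" for M :: "'z measure" using x by auto
  have "(\<integral>\<^sup>+s. ennreal (exp (- \<Phi> x s)) * ennreal (\<phi> (flow s x)) * indicator {a..} s \<partial>lborel)
    = (\<integral>\<^sup>+s. (\<integral>\<^sup>+q. ennreal (exp (- q)) * (if \<Phi> x s < q \<and> a \<le> s then 1 else 0) * ennreal (\<phi> (flow s x)) \<partial>lborel) \<partial>lborel)"
  proof (intro nn_integral_cong)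
    fix s :: real
    have "(\<integral>\<^sup>+q. ennreal (exp (- q)) * (if \<Phi> x s < q \<and> a \<le> s then 1 else 0) * ennreal (\<phi> (flow s x)) \<partial>lborel)
      = (\<integral>\<^sup>+q. ennreal (exp (- q)) * indicator {\<Phi> x s..} q * (ennreal (\<phi> (flow s x)) * indicator {a..} s) \<partial>lborel)"
      using AE_lborel_singleton[of "\<Phi> x s"]
      by (intro nn_integral_cong_AE) (auto elim!: eventually_mono simp: indicator_def)
    also have "\<dots> = ennreal (exp (- \<Phi> x s)) * (ennreal (\<phi> (flow s x)) * indicator {a..} s)"
      by (subst nn_integral_multc) (auto simp: nn_integral_exp_tail)
    finally show "ennreal (exp (- \<Phi> x s)) * ennreal (\<phi> (flow s x)) * indicator {a..} s
      = (\<integral>\<^sup>+q. ennreal (exp (- q)) * (if \<Phi> x s < q \<and> a \<le> s then 1 else 0) * ennreal (\<phi> (flow s x)) \<partial>lborel)"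
      by (simp add: mult.assoc)
  qed
  also have "\<dots> = (\<integral>\<^sup>+q. (\<integral>\<^sup>+s. ennreal (exp (- q)) * (if \<Phi> x s < q \<and> a \<le> s then 1 else 0) * ennreal (\<phi> (flow s x)) \<partial>lborel) \<partial>lborel)"
    by (rule lborel_pair.Fubini') measurable
  also have "\<dots> = (\<integral>\<^sup>+q. ennreal (exp (- q) * (q - \<Phi> x a)) * indicator {\<Phi> x a..} q \<partial>lborel)"
  proof (intro nn_integral_cong)
    fix q :: real
    have "(\<integral>\<^sup>+s. ennreal (exp (- q)) * (if \<Phi> x s < q \<and> a \<le> s then 1 else 0) * ennreal (\<phi> (flow s x)) \<partial>lborel)
      = (\<integral>\<^sup>+s. ennreal (exp (- q)) * (ennreal (\<phi> (flow s x)) * indicator {a..<inv_rate x q} s) \<partial>lborel)"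
      using inv_rate_le_iff[OF x, of q] a
      by (intro nn_integral_cong) (auto simp: indicator_def not_le[symmetric])
    also have "\<dots> = ennreal (exp (- q)) * (\<integral>\<^sup>+s. ennreal (\<phi> (flow s x)) * indicator {a..<inv_rate x q} s \<partial>lborel)"
      by (rule nn_integral_cmult) measurable
    also have "\<dots> = ennreal (exp (- q) * (q - \<Phi> x a)) * indicator {\<Phi> x a..} q"
    proof (cases "\<Phi> x a < q")
      case True
      then have "0 \<le> q" using nn_integral_rate(2)[OF x, of a] by simp
      moreover have "a \<le> inv_rate x q" using True inv_rate_le_iff[OF x, of q a] a by auto
      ultimately show ?thesis
        using True nn_integral_rate_interval(1)[OF x a, of "inv_rate x q"] Phi_inv_rate[OF x]
        by (simp add: ennreal_mult')
    next
      case False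
      then have "inv_rate x q \<le> a" using inv_rate_le_iff[OF x, of q a] a by auto
      then show ?thesis using False by (cases "q = \<Phi> x a") auto
    qed
    finally show "(\<integral>\<^sup>+s. ennreal (exp (- q)) * (if \<Phi> x s < q \<and> a \<le> s then 1 else 0) * ennreal (\<phi> (flow s x)) \<partial>lborel)
      = ennreal (exp (- q) * (q - \<Phi> x a)) * indicator {\<Phi> x a..} q" .
  qed
  also have "\<dots> = ennreal (0 - (- (1 + \<Phi> x a - \<Phi> x a) * exp (- \<Phi> x a)))"
  proof (rule nn_integral_FTC_atLeast[where F="\<lambda>q. - (1 + q - \<Phi> x a) * exp (- q)"])
    have "((\<lambda>q. - (1 + q - c) * exp (- q)) \<longlongrightarrow> 0) at_top" for c :: real by real_asymp
    then show "((\<lambda>q. - (1 + q - \<Phi> x a) * exp (- q)) \<longlongrightarrow> 0) at_top" .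
  qed (auto intro!: derivative_eq_intros simp: algebra_simps)
  finally show ?thesis by simp
qed

lemma rate_head:
  assumes x: "x \<in> E" and a: "0 \<le> a"
  shows "ennreal (exp (- \<Phi> x a)) + (\<integral>\<^sup>+s. ennreal (exp (- \<Phi> x s)) * ennreal (\<phi> (flow s x)) * indicator {0..a} s \<partial>lborel) = 1"
proof -
  have xm[measurable]: "(\<lambda>r. x) \<in> M \<rightarrow>\<^sub>M BE" for M :: "'z measure" using x by auto
  let ?f = "\<lambda>s. ennreal (exp (- \<Phi> x s)) * ennreal (\<phi> (flow s x))"
  have "1 = (\<integral>\<^sup>+s. ?f s * indicator {0..} s \<partial>lborel)"
    using rate_tail[OF x, of 0] by (simp add: Phi_0)
  also have "\<dots> = (\<integral>\<^sup>+s. ?f s * indicator {a..} s + ?f s * indicator {0..a} s \<partial>lborel)"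
    using AE_lborel_singleton[of a] a
    by (intro nn_integral_cong_AE) (auto elim!: eventually_mono simp: indicator_def)
  also have "\<dots> = ennreal (exp (- \<Phi> x a)) + (\<integral>\<^sup>+s. ?f s * indicator {0..a} s \<partial>lborel)"
    unfolding rate_tail[OF x a, symmetric] by (rule nn_integral_add) measurable
  finally show ?thesis by simp
qed

text \<open>
  A measure on the line is determined by its tails, and the inverse of the cumulative rate exceeds \<open>a \<ge> 0\<close> exactly
  when the exponential variable exceeds \<open>\<Phi> x a\<close>; the tails on the right are those of \<open>rate_tail\<close>.
\<close>

lemma sojourn_law:
  assumes x: "x \<in> E" and g: "g \<in> borel_measurable borel"
  shows "(\<integral>\<^sup>+q. g (inv_rate x q) \<partial>density lborel (exponential_density 1))
    = (\<integral>\<^sup>+s. ennreal (exp (- \<Phi> x s)) * ennreal (\<phi> (flow s x)) * g s * indicator {0..} s \<partial>lborel)"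
proof -
  have xm[measurable]: "(\<lambda>r. x) \<in> M \<rightarrow>\<^sub>M BE" for M :: "'z measure" using x by auto
  note g[measurable]
  define A where "A = distr (density lborel (exponential_density 1)) borel (inv_rate x)"
  define f where "f s = ennreal (exp (- \<Phi> x s)) * ennreal (\<phi> (flow s x)) * indicator {0..} s" for s
  define B where "B = density (lborel :: real measure) f"
  have f[measurable]: "f \<in> borel_measurable borel" unfolding f_def[abs_def] by measurable
  have "A = B"
  proof (rule measure_eqI_lessThan)
    fix a :: real
    have "emeasure A {a<..} = emeasure (density lborel (exponential_density 1)) {q. a < inv_rate x q}"
      unfolding A_def by (subst emeasure_distr) (auto simp: vimage_def)
    also have "\<dots> = (\<integral>\<^sup>+q. ennreal (exponential_density 1 q) * indicator {q. a < inv_rate x q} q \<partial>lborel)"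
      by (subst emeasure_density) auto
    also have "\<dots> = (\<integral>\<^sup>+q. ennreal (exp (- q)) * indicator {\<Phi> x (max 0 a)..} q \<partial>lborel)"
    proof (intro nn_integral_cong_AE)
      show "AE q in lborel. ennreal (exponential_density 1 q) * indicator {q. a < inv_rate x q} q
        = ennreal (exp (- q)) * indicator {\<Phi> x (max 0 a)..} q"
        using AE_lborel_singleton[of "\<Phi> x (max 0 a)"]
      proof eventually_elim
        case (elim q)
        have "a < inv_rate x q \<longleftrightarrow> a < 0 \<or> \<Phi> x a < q" using inv_rate_le_iff[OF x, of q a] by auto
        then show ?case
          using elim Phi_0[of 0 x] nn_integral_rate(2)[OF x, of "max 0 a"]
          by (auto simp: exponential_density_def indicator_def max_def split: if_splits)
      qed
    qed
    also have "\<dots> = ennreal (exp (- \<Phi> x (max 0 a)))" by (rule nn_integral_exp_tail)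
    finally have Aa: "emeasure A {a<..} = ennreal (exp (- \<Phi> x (max 0 a)))" .
    then show "emeasure A {a<..} < \<infinity>" by simp
    have "emeasure B {a<..} = (\<integral>\<^sup>+s. f s * indicator {a<..} s \<partial>lborel)"
      unfolding B_def by (subst emeasure_density) auto
    also have "\<dots> = (\<integral>\<^sup>+s. ennreal (exp (- \<Phi> x s)) * ennreal (\<phi> (flow s x)) * indicator {max 0 a..} s \<partial>lborel)"
      using AE_lborel_singleton[of a]
      by (intro nn_integral_cong_AE) (auto elim!: eventually_mono simp: f_def indicator_def)
    also have "\<dots> = ennreal (exp (- \<Phi> x (max 0 a)))" by (rule rate_tail[OF x]) simp
    finally show "emeasure A {a<..} = emeasure B {a<..}" using Aa by simp
  qed (auto simp: A_def B_def)
  have "(\<integral>\<^sup>+q. g (inv_rate x q) \<partial>density lborel (exponential_density 1)) = (\<integral>\<^sup>+s. g s \<partial>A)"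
    unfolding A_def by (subst nn_integral_distr) auto
  also have "\<dots> = (\<integral>\<^sup>+s. f s * g s \<partial>lborel)"
    unfolding \<open>A = B\<close> B_def by (subst nn_integral_density) auto
  also have "\<dots> = (\<integral>\<^sup>+s. ennreal (exp (- \<Phi> x s)) * ennreal (\<phi> (flow s x)) * g s * indicator {0..} s \<partial>lborel)"
    by (intro nn_integral_cong) (simp add: f_def mult_ac)
  finally show ?thesis .
qed

end

section \<open>Closure properties of positive operators\<close>

lemma positive_operator_comp:
  assumes "positive_operator m T" "positive_operator m T'"
  shows "positive_operator m (\<lambda>f. T (T' f))"
proof -
  interpret T: positive_operator m T by fact
  interpret T': positive_operator m T' by fact
  show ?thesis
  proof
    fix f g :: "'a \<Rightarrow> ennreal" and x c assume x: "x \<in> space m"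
    assume f: "f \<in> borel_measurable m"
    show "T (T' (\<lambda>y. c * f y)) x = c * T (T' f) x"
      using T'.op_cmult[OF f] T.op_cmult[OF T'.meas[OF f] x] T.op_cong[OF _ x, of "T' (\<lambda>y. c * f y)" "\<lambda>y. c * T' f y"]
      by simp
    assume g: "g \<in> borel_measurable m"
    show "T (T' (\<lambda>y. f y + g y)) x = T (T' f) x + T (T' g) x"
      using T'.op_add[OF f g] T.op_add[OF T'.meas[OF f] T'.meas[OF g] x]
        T.op_cong[OF _ x, of "T' (\<lambda>y. f y + g y)" "\<lambda>y. T' f y + T' g y"]
      by simp
  next
    fix F :: "nat \<Rightarrow> 'a \<Rightarrow> ennreal" and x assume x: "x \<in> space m"
      and F: "\<And>i. F i \<in> borel_measurable m" "\<And>i y. y \<in> space m \<Longrightarrow> F i y \<le> F (Suc i) y"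
    have "T (T' (\<lambda>y. SUP i. F i y)) x = T (\<lambda>y. SUP i. T' (F i) y) x"
      by (intro T.op_cong T'.op_SUP F x)
    also have "\<dots> = (SUP i. T (T' (F i)) x)"
      by (intro T.op_SUP T'.meas T'.op_mono F x)
    finally show "T (T' (\<lambda>y. SUP i. F i y)) x = (SUP i. T (T' (F i)) x)" .
  qed (auto intro: T.meas T'.meas T.op_cong T'.op_cong)
qed

lemma SUP_Suc_add_ennreal:
  fixes f g :: "nat \<Rightarrow> ennreal"
  assumes "\<And>i. f i \<le> f (Suc i)" "\<And>i. g i \<le> g (Suc i)"
  shows "(SUP i. f i + g i) = (SUP i. f i) + (SUP i. g i)"
  using assms by (intro ennreal_SUP_add incseq_SucI)

lemma positive_operator_add:
  assumes "positive_operator m T" "positive_operator m T'"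
  shows "positive_operator m (\<lambda>f x. T f x + T' f x)"
proof -
  interpret T: positive_operator m T by fact
  interpret T': positive_operator m T' by fact
  show ?thesis
  proof
    fix F :: "nat \<Rightarrow> 'a \<Rightarrow> ennreal" and x assume x: "x \<in> space m"
      and F: "\<And>i. F i \<in> borel_measurable m" "\<And>i y. y \<in> space m \<Longrightarrow> F i y \<le> F (Suc i) y"
    have "T (\<lambda>y. SUP i. F i y) x + T' (\<lambda>y. SUP i. F i y) x = (SUP i. T (F i) x) + (SUP i. T' (F i) x)"
      by (intro arg_cong2[where f="(+)"] T.op_SUP T'.op_SUP F x)
    also have "\<dots> = (SUP i. T (F i) x + T' (F i) x)"
      by (intro SUP_Suc_add_ennreal[symmetric] T.op_mono T'.op_mono F x)
    finally show "T (\<lambda>y. SUP i. F i y) x + T' (\<lambda>y. SUP i. F i y) x = (SUP i. T (F i) x + T' (F i) x)" .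
  qed (auto simp: T.op_add T'.op_add T.op_cmult T'.op_cmult distrib_left add_ac
      intro!: borel_measurable_add T.meas T'.meas arg_cong2[where f="(+)"] intro: T.op_cong T'.op_cong)
qed

lemma positive_operator_integral:
  assumes T: "\<And>s. positive_operator m (T s)"
    and meas: "\<And>f. f \<in> borel_measurable m \<Longrightarrow> (\<lambda>(x, s). T s f x) \<in> borel_measurable (m \<Otimes>\<^sub>M lborel)"
    and w[measurable]: "w \<in> borel_measurable borel"
  shows "positive_operator m (\<lambda>f x. \<integral>\<^sup>+s. T s f x * w s \<partial>(lborel :: real measure))"
proof
  fix f g :: "'a \<Rightarrow> ennreal" and x c
  assume f: "f \<in> borel_measurable m"
  note meas[OF f, measurable]
  show "(\<lambda>x. \<integral>\<^sup>+s. T s f x * w s \<partial>lborel) \<in> borel_measurable m"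
    by (rule lborel.borel_measurable_nn_integral) measurable
  assume x: "x \<in> space m"
  have 1[measurable]: "(\<lambda>s. T s f x) \<in> borel_measurable lborel"
    using measurable_compose[OF measurable_Pair1'[OF x] meas[OF f]] by simp
  have "(\<integral>\<^sup>+s. T s (\<lambda>y. c * f y) x * w s \<partial>lborel) = (\<integral>\<^sup>+s. c * (T s f x * w s) \<partial>lborel)"
    by (simp add: positive_operator.op_cmult[OF T f x] mult.assoc)
  then show "(\<integral>\<^sup>+s. T s (\<lambda>y. c * f y) x * w s \<partial>lborel) = c * (\<integral>\<^sup>+s. T s f x * w s \<partial>lborel)"
    by (simp add: nn_integral_cmult)
  assume g: "g \<in> borel_measurable m"
  have 2[measurable]: "(\<lambda>s. T s g x) \<in> borel_measurable lborel"
    using measurable_compose[OF measurable_Pair1'[OF x] meas[OF g]] by simp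
  have "(\<integral>\<^sup>+s. T s (\<lambda>y. f y + g y) x * w s \<partial>lborel) = (\<integral>\<^sup>+s. T s f x * w s + T s g x * w s \<partial>lborel)"
    by (simp add: positive_operator.op_add[OF T f g x] distrib_right)
  then show "(\<integral>\<^sup>+s. T s (\<lambda>y. f y + g y) x * w s \<partial>lborel)
      = (\<integral>\<^sup>+s. T s f x * w s \<partial>lborel) + (\<integral>\<^sup>+s. T s g x * w s \<partial>lborel)"
    by (simp add: nn_integral_add)
next
  fix F :: "nat \<Rightarrow> 'a \<Rightarrow> ennreal" and x assume x: "x \<in> space m"
    and F: "\<And>i. F i \<in> borel_measurable m" "\<And>i y. y \<in> space m \<Longrightarrow> F i y \<le> F (Suc i) y"
  have 1[measurable]: "(\<lambda>s. T s (F i) x) \<in> borel_measurable lborel" for i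
    using measurable_compose[OF measurable_Pair1'[OF x] meas[OF F(1)]] by simp
  have "(\<integral>\<^sup>+s. T s (\<lambda>y. SUP i. F i y) x * w s \<partial>lborel) = (\<integral>\<^sup>+s. (SUP i. T s (F i) x * w s) \<partial>lborel)"
    by (simp add: positive_operator.op_SUP[where F=F, OF T F x] SUP_mult_right_ennreal)
  also have "\<dots> = (SUP i. \<integral>\<^sup>+s. T s (F i) x * w s \<partial>lborel)"
    by (intro nn_integral_monotone_convergence_SUP_AE AE_I2 mult_right_mono
        positive_operator.op_mono[OF T] F x) (use F in auto)
  finally show "(\<integral>\<^sup>+s. T s (\<lambda>y. SUP i. F i y) x * w s \<partial>lborel) = (SUP i. \<integral>\<^sup>+s. T s (F i) x * w s \<partial>lborel)" .
next
  fix f g :: "'a \<Rightarrow> ennreal" and x assume "\<And>y. y \<in> space m \<Longrightarrow> f y = g y" "x \<in> space m"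
  from positive_operator.op_cong[OF T this]
  show "(\<integral>\<^sup>+s. T s f x * w s \<partial>lborel) = (\<integral>\<^sup>+s. T s g x * w s \<partial>lborel)" by simp
qed

lemma positive_operator_SUP:
  fixes T :: "nat \<Rightarrow> ('a \<Rightarrow> ennreal) \<Rightarrow> 'a \<Rightarrow> ennreal"
  assumes T: "\<And>n. positive_operator m (T n)"
    and mono: "\<And>n f x. f \<in> borel_measurable m \<Longrightarrow> x \<in> space m \<Longrightarrow> T n f x \<le> T (Suc n) f x"
  shows "positive_operator m (\<lambda>f x. SUP n. T n f x)"
proof
  fix f g :: "'a \<Rightarrow> ennreal" and x c
  assume f: "f \<in> borel_measurable m"
  show "(\<lambda>x. SUP n. T n f x) \<in> borel_measurable m"
    using positive_operator.meas[OF T f] by measurable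
  assume x: "x \<in> space m"
  show "(SUP n. T n (\<lambda>y. c * f y) x) = c * (SUP n. T n f x)"
    by (simp add: positive_operator.op_cmult[OF T f x] SUP_mult_left_ennreal)
  assume g: "g \<in> borel_measurable m"
  show "(SUP n. T n (\<lambda>y. f y + g y) x) = (SUP n. T n f x) + (SUP n. T n g x)"
    unfolding positive_operator.op_add[OF T f g x] by (intro SUP_Suc_add_ennreal mono f g x)
next
  fix F :: "nat \<Rightarrow> 'a \<Rightarrow> ennreal" and x assume x: "x \<in> space m"
    and F: "\<And>i. F i \<in> borel_measurable m" "\<And>i y. y \<in> space m \<Longrightarrow> F i y \<le> F (Suc i) y"
  show "(SUP n. T n (\<lambda>y. SUP i. F i y) x) = (SUP i. SUP n. T n (F i) x)"
  proof -
    have "(SUP n. T n (\<lambda>y. SUP i. F i y) x) = (SUP n. SUP i. T n (F i) x)"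
      by (intro SUP_cong refl positive_operator.op_SUP[OF T] F x)
    also have "\<dots> = (SUP i. SUP n. T n (F i) x)" by (rule SUP_commute)
    finally show ?thesis .
  qed
next
  fix f g :: "'a \<Rightarrow> ennreal" and x assume "\<And>y. y \<in> space m \<Longrightarrow> f y = g y" "x \<in> space m"
  from positive_operator.op_cong[OF T this]
  show "(SUP n. T n f x) = (SUP n. T n g x)" by simp
qed

lemma positive_operator_cong_sets:
  assumes "sets m = sets N" and "positive_operator N T"
  shows "positive_operator m T"
proof -
  interpret positive_operator N T by fact
  have [simp]: "space m = space N" "borel_measurable m = (borel_measurable N :: ('a \<Rightarrow> ennreal) set)"
    using sets_eq_imp_space_eq[OF assms(1)] measurable_cong_sets[OF assms(1) refl, of borel] by auto
  show ?thesis
    by unfold_locales (auto intro: meas op_cong op_add op_cmult op_SUP)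
qed

section \<open>Killing and jumping as positive operators\<close>

context pdmp_characteristics
begin

text \<open>
  In probabilistic terms \<open>killed t f x\<close> is the mean of \<open>f\<close> at time \<open>t\<close> on the event that no jump has
  occurred, and \<open>killed s (rate_jump f) x\<close> is the density, at time \<open>s\<close>, of the first jump, weighted with \<open>f\<close> at
  the state after that jump.
\<close>

definition killed :: "real \<Rightarrow> ('a \<Rightarrow> ennreal) \<Rightarrow> 'a \<Rightarrow> ennreal" where
  "killed t f x = ennreal (exp (- \<Phi> x t)) * f (flow t x)"

definition rate_jump :: "('a \<Rightarrow> ennreal) \<Rightarrow> 'a \<Rightarrow> ennreal" where
  "rate_jump f x = ennreal (\<phi> x) * (\<integral>\<^sup>+y. f y \<partial>J x)"

lemma J_prob: "x \<in> E \<Longrightarrow> prob_space (J x)" and sets_J: "x \<in> E \<Longrightarrow> sets (J x) = sets BE"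
  and space_J: "x \<in> E \<Longrightarrow> space (J x) = E"
  using measurable_space[OF jump_kernel, of x] sets_eq_imp_space_eq[of "J x" BE]
  by (auto simp: space_prob_algebra)

lemma jump_integral_measurable[measurable (raw)]:
  assumes "case_prod h \<in> borel_measurable (M \<Otimes>\<^sub>M BE)" "g \<in> M \<rightarrow>\<^sub>M BE"
  shows "(\<lambda>z. \<integral>\<^sup>+y. h z y \<partial>J (g z)) \<in> borel_measurable M"
  by (rule nn_integral_measurable_subprob_algebra2[OF assms(1)
        measurable_compose[OF assms(2) measurable_prob_algebraD[OF jump_kernel]]])

lemma rate_jump_measurable[measurable (raw)]:
  assumes [measurable]: "case_prod h \<in> borel_measurable (M \<Otimes>\<^sub>M BE)" "g \<in> M \<rightarrow>\<^sub>M BE"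
  shows "(\<lambda>z. rate_jump (h z) (g z)) \<in> borel_measurable M"
  unfolding rate_jump_def by measurable

lemma killed_measurable[measurable (raw)]:
  assumes [measurable]: "f \<in> borel_measurable M" "g \<in> M \<rightarrow>\<^sub>M BE"
    and h: "case_prod h \<in> borel_measurable (M \<Otimes>\<^sub>M BE)"
  shows "(\<lambda>z. killed (f z) (h z) (g z)) \<in> borel_measurable M"
proof -
  have "(\<lambda>z. (z, flow (f z) (g z))) \<in> M \<rightarrow>\<^sub>M M \<Otimes>\<^sub>M BE" by measurable
  from measurable_compose[OF this h]
  have [measurable]: "(\<lambda>z. h z (flow (f z) (g z))) \<in> borel_measurable M" by simp
  show ?thesis unfolding killed_def by measurable
qed

lemma AE_J: "x \<in> E \<Longrightarrow> (\<And>y. y \<in> E \<Longrightarrow> Q y) \<Longrightarrow> AE y in J x. Q y"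
  by (intro AE_I2) (simp add: space_J)

lemma J_measurable: "x \<in> E \<Longrightarrow> f \<in> borel_measurable BE \<Longrightarrow> f \<in> borel_measurable (J x)"
  using measurable_cong_sets[OF sets_J refl] by blast

lemma jump_integral_cong: "x \<in> E \<Longrightarrow> (\<And>y. y \<in> E \<Longrightarrow> f y = g y) \<Longrightarrow> (\<integral>\<^sup>+y. f y \<partial>J x) = (\<integral>\<^sup>+y. g y \<partial>J x)"
  by (intro nn_integral_cong) (simp add: space_J)

lemma rate_jump_const: "x \<in> E \<Longrightarrow> rate_jump (\<lambda>_. c) x = ennreal (\<phi> x) * c"
  using prob_space.emeasure_space_1[OF J_prob] by (simp add: rate_jump_def)

lemma positive_operator_killed: "positive_operator BE (killed t)"
proof
  fix f g :: "'a \<Rightarrow> ennreal" and x c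
  assume f[measurable]: "f \<in> borel_measurable BE"
  show "killed t f \<in> borel_measurable BE" by measurable
qed (auto simp: killed_def distrib_left mult_ac SUP_mult_left_ennreal)

lemma positive_operator_jump: "positive_operator BE (\<lambda>f x. \<integral>\<^sup>+y. f y \<partial>J x)"
proof
  fix f g :: "'a \<Rightarrow> ennreal" and x c
  assume f[measurable]: "f \<in> borel_measurable BE"
  show "(\<lambda>x. \<integral>\<^sup>+y. f y \<partial>J x) \<in> borel_measurable BE" by measurable
  assume x: "x \<in> space BE"
  then have x: "x \<in> E" by simp
  note fJ = J_measurable[OF x f]
  show "(\<integral>\<^sup>+y. c * f y \<partial>J x) = c * (\<integral>\<^sup>+y. f y \<partial>J x)" by (rule nn_integral_cmult[OF fJ])
  assume g[measurable]: "g \<in> borel_measurable BE"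
  show "(\<integral>\<^sup>+y. f y + g y \<partial>J x) = (\<integral>\<^sup>+y. f y \<partial>J x) + (\<integral>\<^sup>+y. g y \<partial>J x)"
    by (rule nn_integral_add[OF fJ J_measurable[OF x g]])
next
  fix F :: "nat \<Rightarrow> 'a \<Rightarrow> ennreal" and x assume x: "x \<in> space BE"
    and F: "\<And>i. F i \<in> borel_measurable BE" "\<And>i y. y \<in> space BE \<Longrightarrow> F i y \<le> F (Suc i) y"
  show "(\<integral>\<^sup>+y. (SUP i. F i y) \<partial>J x) = (SUP i. \<integral>\<^sup>+y. F i y \<partial>J x)"
    using x F(2) by (intro nn_integral_monotone_convergence_SUP_AE AE_J J_measurable F(1)) auto
qed (auto intro: jump_integral_cong)

lemma positive_operator_rate: "positive_operator BE (\<lambda>f x. ennreal (\<phi> x) * f x)"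
  by unfold_locales (auto simp: distrib_left mult_ac SUP_mult_left_ennreal)

lemma positive_operator_rate_jump: "positive_operator BE rate_jump"
  using positive_operator_comp[OF positive_operator_rate positive_operator_jump]
  unfolding rate_jump_def[abs_def] .

lemma killed_0: "x \<in> E \<Longrightarrow> killed 0 f x = f x"
  by (simp add: killed_def Phi_0 flow_def flow_0)

lemma killed_add:
  assumes "x \<in> E" "0 \<le> s" "0 \<le> t"
  shows "killed (s + t) f x = killed s (killed t f) x"
proof -
  have "exp (- \<Phi> x (s + t)) = exp (- \<Phi> x s) * exp (- \<Phi> (flow s x) t)"
    using assms by (simp add: Phi_add exp_add[symmetric])
  then show ?thesis
    using assms by (simp add: killed_def flow_add' ennreal_mult' mult.assoc)
qed

text \<open>
  The mean of \<open>F (t - \<sigma>) \<xi>\<close> on the event \<open>\<sigma> \<le> t\<close>, where \<open>\<sigma>\<close> is the first jump time and \<open>\<xi>\<close> the state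
  after the jump.
\<close>

definition first_jump :: "(real \<Rightarrow> 'a \<Rightarrow> ennreal) \<Rightarrow> real \<Rightarrow> 'a \<Rightarrow> ennreal" where
  "first_jump F t x = (\<integral>\<^sup>+s. killed s (rate_jump (F (t - s))) x * indicator {0..t} s \<partial>lborel)"

lemma first_jump_integrand_measurable[measurable]:
  assumes F: "case_prod F \<in> borel_measurable (borel \<Otimes>\<^sub>M BE)"
    and [measurable]: "f \<in> borel_measurable M" "g \<in> borel_measurable M" "h \<in> M \<rightarrow>\<^sub>M BE"
  shows "(\<lambda>z. killed (g z) (rate_jump (F (f z))) (h z)) \<in> borel_measurable M"
proof -
  have [measurable]: "(\<lambda>p. F (f (fst (fst p))) (snd p)) \<in> borel_measurable ((M \<Otimes>\<^sub>M BE) \<Otimes>\<^sub>M BE)"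
    using measurable_compose[OF _ F, of "\<lambda>p. (f (fst (fst p)), snd p)" "(M \<Otimes>\<^sub>M BE) \<Otimes>\<^sub>M BE"]
    by simp
  show ?thesis by measurable
qed

lemma first_jump_measurable[measurable (raw)]:
  assumes F: "case_prod F \<in> borel_measurable (borel \<Otimes>\<^sub>M BE)"
    and [measurable]: "f \<in> borel_measurable M" "g \<in> M \<rightarrow>\<^sub>M BE"
  shows "(\<lambda>z. first_jump F (f z) (g z)) \<in> borel_measurable M"
proof -
  have [measurable]: "(\<lambda>p. killed (snd p) (rate_jump (F (f (fst p) - snd p))) (g (fst p))) \<in> borel_measurable (M \<Otimes>\<^sub>M lborel)"
    by (rule first_jump_integrand_measurable[OF F]) measurable
  have "(\<lambda>(z, s). killed s (rate_jump (F (f z - s))) (g z) * (if 0 \<le> s \<and> s \<le> f z then 1 else 0))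
      \<in> borel_measurable (M \<Otimes>\<^sub>M lborel)"
    by measurable
  from lborel.borel_measurable_nn_integral[OF this]
  show ?thesis unfolding first_jump_def by (simp add: indicator_def of_bool_def cong: if_cong)
qed

section \<open>The first-jump equation and its minimal solution\<close>

lemma first_jump_cong:
  assumes "x \<in> E" "\<And>r y. 0 \<le> r \<Longrightarrow> r \<le> t \<Longrightarrow> y \<in> E \<Longrightarrow> F r y = G r y"
  shows "first_jump F t x = first_jump G t x"
  unfolding first_jump_def
proof (intro nn_integral_cong)
  fix s
  have "rate_jump (F (t - s)) (flow s x) = rate_jump (G (t - s)) (flow s x)" if "s \<in> {0..t}"
    unfolding rate_jump_def using assms that
    by (intro arg_cong2[where f="(*)"] jump_integral_cong refl) auto
  then show "killed s (rate_jump (F (t - s))) x * indicator {0..t} s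
      = killed s (rate_jump (G (t - s))) x * indicator {0..t} s"
    by (auto simp: killed_def indicator_def)
qed

lemma rate_jump_mono:
  assumes "x \<in> E" "\<And>y. y \<in> E \<Longrightarrow> f y \<le> g y"
  shows "rate_jump f x \<le> rate_jump g x"
  unfolding rate_jump_def using assms by (intro mult_left_mono nn_integral_mono) (auto simp: space_J)

lemma first_jump_mono:
  assumes "x \<in> E" "\<And>r y. 0 \<le> r \<Longrightarrow> r \<le> t \<Longrightarrow> y \<in> E \<Longrightarrow> F r y \<le> G r y"
  shows "first_jump F t x \<le> first_jump G t x"
  unfolding first_jump_def
proof (intro nn_integral_mono)
  fix s
  have "rate_jump (F (t - s)) (flow s x) \<le> rate_jump (G (t - s)) (flow s x)" if "s \<in> {0..t}"
    using assms that by (intro rate_jump_mono) auto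
  then show "killed s (rate_jump (F (t - s))) x * indicator {0..t} s
      \<le> killed s (rate_jump (G (t - s))) x * indicator {0..t} s"
    by (auto simp: killed_def indicator_def intro: mult_left_mono)
qed

lemma section_measurable:
  assumes "case_prod F \<in> borel_measurable (borel \<Otimes>\<^sub>M BE)"
  shows "F t \<in> borel_measurable BE"
  using measurable_compose[OF _ assms, of "\<lambda>y. (t, y)" BE] by simp

lemma first_jump_integrand_measurable':
  assumes F: "case_prod F \<in> borel_measurable (borel \<Otimes>\<^sub>M BE)" and x: "x \<in> E"
  shows "(\<lambda>s. killed s (rate_jump (F (t - s))) x) \<in> borel_measurable borel"
  by (rule first_jump_integrand_measurable[OF F]) (use x in auto)

lemma rate_jump_add:
  "f \<in> borel_measurable BE \<Longrightarrow> g \<in> borel_measurable BE \<Longrightarrow> x \<in> E \<Longrightarrow>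
    rate_jump (\<lambda>y. f y + g y) x = rate_jump f x + rate_jump g x"
  using positive_operator.op_add[OF positive_operator_rate_jump] by simp

lemma first_jump_add:
  assumes F: "case_prod F \<in> borel_measurable (borel \<Otimes>\<^sub>M BE)"
    and G: "case_prod G \<in> borel_measurable (borel \<Otimes>\<^sub>M BE)" and x: "x \<in> E"
  shows "first_jump (\<lambda>t y. F t y + G t y) t x = first_jump F t x + first_jump G t x"
proof -
  note [measurable] = first_jump_integrand_measurable'[OF F x] first_jump_integrand_measurable'[OF G x]
  have "first_jump (\<lambda>t y. F t y + G t y) t x
    = (\<integral>\<^sup>+s. killed s (rate_jump (F (t - s))) x * indicator {0..t} s
        + killed s (rate_jump (G (t - s))) x * indicator {0..t} s \<partial>lborel)"
    unfolding first_jump_def using x section_measurable[OF F] section_measurable[OF G]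
    by (intro nn_integral_cong) (simp add: killed_def rate_jump_add distrib_left distrib_right)
  also have "\<dots> = first_jump F t x + first_jump G t x"
    unfolding first_jump_def by (rule nn_integral_add) auto
  finally show ?thesis .
qed

lemma first_jump_SUP:
  fixes F :: "nat \<Rightarrow> real \<Rightarrow> 'a \<Rightarrow> ennreal"
  assumes F: "\<And>n. case_prod (F n) \<in> borel_measurable (borel \<Otimes>\<^sub>M BE)"
    and mono: "\<And>n r y. 0 \<le> r \<Longrightarrow> y \<in> E \<Longrightarrow> F n r y \<le> F (Suc n) r y" and x: "x \<in> E"
  shows "first_jump (\<lambda>t y. SUP n. F n t y) t x = (SUP n. first_jump (F n) t x)"
proof -
  note [measurable] = first_jump_integrand_measurable'[OF F x]
  have sup: "rate_jump (\<lambda>y. SUP n. F n r y) z = (SUP n. rate_jump (F n r) z)" if "0 \<le> r" "z \<in> E" for r z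
    using positive_operator.op_SUP[OF positive_operator_rate_jump, of "\<lambda>n. F n r" z]
      section_measurable[OF F] mono that by simp
  have "first_jump (\<lambda>t y. SUP n. F n t y) t x
    = (\<integral>\<^sup>+s. (SUP n. killed s (rate_jump (F n (t - s))) x * indicator {0..t} s) \<partial>lborel)"
    unfolding first_jump_def using x
    by (intro nn_integral_cong) (auto simp: killed_def sup indicator_def SUP_mult_left_ennreal)
  also have "\<dots> = (SUP n. first_jump (F n) t x)"
    unfolding first_jump_def
  proof (intro nn_integral_monotone_convergence_SUP_AE AE_I2)
    fix n s
    have "rate_jump (F n (t - s)) (flow s x) \<le> rate_jump (F (Suc n) (t - s)) (flow s x)" if "s \<in> {0..t}"
      using x that mono by (intro rate_jump_mono) auto
    then show "killed s (rate_jump (F n (t - s))) x * indicator {0..t} s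
        \<le> killed s (rate_jump (F (Suc n) (t - s))) x * indicator {0..t} s"
      by (auto simp: killed_def indicator_def intro: mult_left_mono)
  qed auto
  finally show ?thesis .
qed

text \<open>
  A first jump after time \<open>s\<close> is a first jump of the process restarted at time \<open>s\<close> from the state reached by the flow,
  since killing is multiplicative along the flow.
\<close>

lemma first_jump_split:
  assumes F: "case_prod F \<in> borel_measurable (borel \<Otimes>\<^sub>M BE)" and x: "x \<in> E" and st: "0 \<le> s" "0 \<le> t"
  shows "first_jump F (s + t) x = first_jump (\<lambda>r. F (r + t)) s x + killed s (first_jump F t) x"
proof -
  note [measurable] = first_jump_integrand_measurable'[OF F x]
  note m2[measurable] = first_jump_integrand_measurable'[OF F, of "flow s x"]
  let ?h = "\<lambda>r. killed r (rate_jump (F (s + t - r))) x"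
  have "first_jump F (s + t) x = (\<integral>\<^sup>+r. ?h r * indicator {0..s} r + ?h r * indicator {s..s+t} r \<partial>lborel)"
    unfolding first_jump_def using AE_lborel_singleton[of s] st
    by (intro nn_integral_cong_AE) (auto elim!: eventually_mono simp: indicator_def)
  also have "\<dots> = (\<integral>\<^sup>+r. ?h r * indicator {0..s} r \<partial>lborel) + (\<integral>\<^sup>+r. ?h r * indicator {s..s+t} r \<partial>lborel)"
    by (rule nn_integral_add) auto
  also have "(\<integral>\<^sup>+r. ?h r * indicator {0..s} r \<partial>lborel) = first_jump (\<lambda>r. F (r + t)) s x"
    unfolding first_jump_def by (simp add: algebra_simps)
  also have "(\<integral>\<^sup>+r. ?h r * indicator {s..s+t} r \<partial>lborel)
      = (\<integral>\<^sup>+r. ?h (s + 1 * r) * indicator {s..s+t} (s + 1 * r) \<partial>lborel)"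
    by (subst nn_integral_real_affine[where c=1 and t=s]) auto
  also have "\<dots> = (\<integral>\<^sup>+r. ennreal (exp (- \<Phi> x s)) *
      (killed r (rate_jump (F (t - r))) (flow s x) * indicator {0..t} r) \<partial>lborel)"
  proof (intro nn_integral_cong)
    fix r :: real
    have "killed (s + r) G x = ennreal (exp (- \<Phi> x s)) * killed r G (flow s x)" if "0 \<le> r" for G
      using killed_add[OF x st(1) that, of G] by (simp add: killed_def[of s])
    then show "?h (s + 1 * r) * indicator {s..s+t} (s + 1 * r) = ennreal (exp (- \<Phi> x s)) *
        (killed r (rate_jump (F (t - r))) (flow s x) * indicator {0..t} r)"
      by (auto simp: indicator_def)
  qed
  also have "\<dots> = killed s (first_jump F t) x"
    unfolding first_jump_def killed_def[of s] using x m2 by (intro nn_integral_cmult) auto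
  finally show ?thesis .
qed

text \<open>
  \<open>dyson n t f x\<close> is the mean of \<open>f\<close> at time \<open>t\<close> on the event that fewer than \<open>n\<close> jumps have occurred; its
  limit \<open>min_op t f x\<close> is the mean on the event that \<open>t\<close> precedes the explosion.
\<close>

primrec dyson :: "nat \<Rightarrow> real \<Rightarrow> ('a \<Rightarrow> ennreal) \<Rightarrow> 'a \<Rightarrow> ennreal" where
  "dyson 0 t f = (\<lambda>x. 0)"
| "dyson (Suc n) t f = (\<lambda>x. killed t f x + first_jump (\<lambda>s. dyson n s f) t x)"

definition min_op :: "real \<Rightarrow> ('a \<Rightarrow> ennreal) \<Rightarrow> 'a \<Rightarrow> ennreal" where
  "min_op t f x = (SUP n. dyson n t f x)"

lemma killed_joint_measurable:
  assumes [measurable]: "f \<in> borel_measurable BE"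
  shows "(\<lambda>(t, x). killed t f x) \<in> borel_measurable (borel \<Otimes>\<^sub>M BE)"
  by measurable

lemma dyson_joint_measurable:
  assumes f[measurable]: "f \<in> borel_measurable BE"
  shows "(\<lambda>(t, x). dyson n t f x) \<in> borel_measurable (borel \<Otimes>\<^sub>M BE)"
proof (induction n)
  case (Suc n)
  note killed_joint_measurable[OF f, measurable]
  have [measurable]: "(\<lambda>z. first_jump (\<lambda>s. dyson n s f) (fst z) (snd z)) \<in> borel_measurable (borel \<Otimes>\<^sub>M BE)"
    using Suc by (intro first_jump_measurable) auto
  show ?case by (simp add: split_beta') measurable
qed simp

lemma min_op_joint_measurable:
  assumes "f \<in> borel_measurable BE"
  shows "(\<lambda>(t, x). min_op t f x) \<in> borel_measurable (borel \<Otimes>\<^sub>M BE)"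
  using dyson_joint_measurable[OF assms] unfolding min_op_def by (simp add: split_beta')

lemma min_op_measurable: "f \<in> borel_measurable BE \<Longrightarrow> min_op t f \<in> borel_measurable BE"
  using section_measurable[OF min_op_joint_measurable] .

lemma dyson_mono_Suc:
  assumes "f \<in> borel_measurable BE" "x \<in> E"
  shows "dyson n t f x \<le> dyson (Suc n) t f x"
  using assms(2)
proof (induction n arbitrary: t x)
  case (Suc n)
  show ?case
    using Suc.prems Suc.IH by (auto intro!: add_left_mono first_jump_mono simp del: dyson.simps(2) simp: dyson.simps(2)[of "Suc n"] dyson.simps(2)[of n])
qed simp

lemma dyson_le_min_op: "dyson n t f x \<le> min_op t f x"
  unfolding min_op_def by (rule SUP_upper) simp

lemma min_op_eq:
  assumes f: "f \<in> borel_measurable BE" and x: "x \<in> E"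
  shows "min_op t f x = killed t f x + first_jump (\<lambda>s. min_op s f) t x"
proof -
  have "min_op t f x = (SUP n. dyson (Suc n) t f x)"
    unfolding min_op_def
  proof (rule antisym)
    show "(SUP n. dyson n t f x) \<le> (SUP n. dyson (Suc n) t f x)"
      using dyson_mono_Suc[OF f x] by (intro SUP_mono) blast
    show "(SUP n. dyson (Suc n) t f x) \<le> (SUP n. dyson n t f x)"
      by (intro SUP_mono) blast
  qed
  also have "\<dots> = killed t f x + (SUP n. first_jump (\<lambda>s. dyson n s f) t x)"
    by (simp add: ennreal_SUP_add_right)
  also have "(SUP n. first_jump (\<lambda>s. dyson n s f) t x) = first_jump (\<lambda>s. min_op s f) t x"
    unfolding min_op_def[abs_def] using dyson_mono_Suc[OF f]
    by (intro first_jump_SUP[symmetric] dyson_joint_measurable f x) auto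
  finally show ?thesis .
qed

lemma min_op_0: "f \<in> borel_measurable BE \<Longrightarrow> x \<in> E \<Longrightarrow> min_op 0 f x = f x"
proof -
  assume f: "f \<in> borel_measurable BE" and x: "x \<in> E"
  have "first_jump (\<lambda>s. min_op s f) 0 x = (\<integral>\<^sup>+s. 0 \<partial>(lborel :: real measure))"
    unfolding first_jump_def using AE_lborel_singleton[of "0::real"]
    by (intro nn_integral_cong_AE) (auto elim!: eventually_mono)
  then show ?thesis using min_op_eq[OF f x, of 0] by (simp add: killed_0 x)
qed

lemma killed_plus:
  "killed t (\<lambda>y. f y + g y) x = killed t f x + killed t g x"
  by (simp add: killed_def distrib_left)

lemma dyson_add_time_le:
  assumes f: "f \<in> borel_measurable BE" and x: "x \<in> E" and st: "0 \<le> s" "0 \<le> t"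
  shows "dyson n (s + t) f x \<le> dyson n s (min_op t f) x"
  using x st(1)
proof (induction n arbitrary: s x)
  case (Suc n)
  have "dyson (Suc n) (s + t) f x = killed s (killed t f) x
     + (first_jump (\<lambda>r. dyson n (r + t) f) s x + killed s (first_jump (\<lambda>r. dyson n r f) t) x)"
    using Suc.prems st(2)
    by (simp add: killed_add first_jump_split[OF dyson_joint_measurable[OF f]])
  also have "\<dots> = killed s (dyson (Suc n) t f) x + first_jump (\<lambda>r. dyson n (r + t) f) s x"
    by (simp add: killed_plus ac_simps)
  also have "\<dots> \<le> killed s (min_op t f) x + first_jump (\<lambda>r. dyson n r (min_op t f)) s x"
    using Suc.prems dyson_le_min_op[of "Suc n" t f "flow s x"]
    by (intro add_mono first_jump_mono Suc.IH) (auto simp: killed_def simp del: dyson.simps intro!: mult_left_mono)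
  finally show ?case by simp
qed simp

lemma dyson_min_op_le:
  assumes f: "f \<in> borel_measurable BE" and x: "x \<in> E" and st: "0 \<le> s" "0 \<le> t"
  shows "dyson n s (min_op t f) x \<le> min_op (s + t) f x"
  using x st(1)
proof (induction n arbitrary: s x)
  case (Suc n)
  have mt: "min_op t f y = killed t f y + first_jump (\<lambda>s. min_op s f) t y" if "y \<in> E" for y
    by (rule min_op_eq[OF f that])
  have "dyson (Suc n) s (min_op t f) x = killed s (min_op t f) x + first_jump (\<lambda>r. dyson n r (min_op t f)) s x"
    by simp
  also have "\<dots> \<le> killed s (min_op t f) x + first_jump (\<lambda>r. min_op (r + t) f) s x"
    using Suc.prems by (intro add_left_mono first_jump_mono Suc.IH) auto
  also have "killed s (min_op t f) x = killed s (killed t f) x + killed s (first_jump (\<lambda>s. min_op s f) t) x"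
    using mt[of "flow s x"] Suc.prems by (simp add: killed_def[of s] distrib_left)
  also have "\<dots> + first_jump (\<lambda>r. min_op (r + t) f) s x = min_op (s + t) f x"
    using Suc.prems st(2)
    by (simp add: min_op_eq[OF f, of x "s + t"] killed_add first_jump_split[OF min_op_joint_measurable[OF f]] ac_simps)
  finally show ?case .
qed simp

text \<open>
  The Chapman-Kolmogorov equation. A Cauchy product over the numbers of jumps before and after time \<open>s\<close> is
  avoided: the two inequalities are proved by induction along the partial sums, with the limit on the other
  side.
\<close>

lemma min_op_add:
  assumes f: "f \<in> borel_measurable BE" and x: "x \<in> E" and st: "0 \<le> s" "0 \<le> t"
  shows "min_op (s + t) f x = min_op s (min_op t f) x"
proof (rule antisym)
  show "min_op (s + t) f x \<le> min_op s (min_op t f) x"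
    unfolding min_op_def[of "s + t"] using dyson_add_time_le[OF f x st] dyson_le_min_op
    by (intro SUP_least) (rule order_trans)
  show "min_op s (min_op t f) x \<le> min_op (s + t) f x"
    unfolding min_op_def[of s] using dyson_min_op_le[OF f x st] by (intro SUP_least)
qed

text \<open>
  \<open>jumps_by n t x\<close> is the probability of at least \<open>n\<close> jumps up to time \<open>t\<close>, written through the first-jump
  equation. It complements the mass of the partial sums, because at every step either there is no jump or
  there is a first one.
\<close>

primrec jumps_by :: "nat \<Rightarrow> real \<Rightarrow> 'a \<Rightarrow> ennreal" where
  "jumps_by 0 t = (\<lambda>x. 1)"
| "jumps_by (Suc n) t = first_jump (jumps_by n) t"

lemma jumps_by_joint_measurable: "case_prod (jumps_by n) \<in> borel_measurable (borel \<Otimes>\<^sub>M BE)"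
proof (induction n)
  case (Suc n)
  have "(\<lambda>z. first_jump (jumps_by n) (fst z) (snd z)) \<in> borel_measurable (borel \<Otimes>\<^sub>M BE)"
    using Suc by (intro first_jump_measurable) auto
  then show ?case by (simp add: split_beta')
qed (simp add: split_beta')

lemma killed_first_jump_1:
  assumes x: "x \<in> E" and t: "0 \<le> t"
  shows "killed t (\<lambda>_. 1) x + first_jump (\<lambda>_ _. 1) t x = 1"
proof -
  have "first_jump (\<lambda>_ _. 1) t x = (\<integral>\<^sup>+s. ennreal (exp (- \<Phi> x s)) * ennreal (\<phi> (flow s x)) * indicator {0..t} s \<partial>lborel)"
    unfolding first_jump_def using x by (intro nn_integral_cong) (simp add: killed_def rate_jump_const)
  then show ?thesis using rate_head[OF x t] by (simp add: killed_def)
qed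

lemma dyson_1_plus_jumps_by:
  assumes x: "x \<in> E" and t: "0 \<le> t"
  shows "dyson n t (\<lambda>_. 1) x + jumps_by n t x = 1"
  using x t
proof (induction n arbitrary: x t)
  case (Suc n)
  have "first_jump (\<lambda>s. dyson n s (\<lambda>_. 1)) t x + first_jump (jumps_by n) t x
      = first_jump (\<lambda>s y. dyson n s (\<lambda>_. 1) y + jumps_by n s y) t x"
    by (rule first_jump_add[symmetric]) (auto intro: dyson_joint_measurable jumps_by_joint_measurable Suc.prems)
  also have "\<dots> = first_jump (\<lambda>_ _. 1) t x"
    using Suc by (intro first_jump_cong) auto
  finally show ?case using killed_first_jump_1[OF Suc.prems] by (simp add: add.assoc)
qed simp

lemma min_op_1_le:
  assumes x: "x \<in> E" and t: "0 \<le> t"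
  shows "min_op t (\<lambda>_. 1) x \<le> 1"
  unfolding min_op_def
proof (rule SUP_least)
  fix n show "dyson n t (\<lambda>_. 1) x \<le> 1"
  proof -
    have "dyson n t (\<lambda>_. 1) x \<le> dyson n t (\<lambda>_. 1) x + jumps_by n t x" by simp
    then show ?thesis by (simp only: dyson_1_plus_jumps_by[OF x t])
  qed
qed

lemma positive_operator_dyson: "positive_operator BE (dyson n t)"
proof (induction n arbitrary: t)
  case 0
  show ?case by unfold_locales auto
next
  case (Suc n)
  have "positive_operator BE (\<lambda>f x. \<integral>\<^sup>+s. killed s (rate_jump (dyson n (t - s) f)) x * indicator {0..t} s \<partial>lborel)"
  proof (rule positive_operator_integral)
    show "positive_operator BE (\<lambda>f. killed s (rate_jump (dyson n (t - s) f)))" for s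
      by (intro positive_operator_comp[OF positive_operator_killed]
          positive_operator_comp[OF positive_operator_rate_jump Suc])
    fix f :: "'a \<Rightarrow> ennreal" assume f: "f \<in> borel_measurable BE"
    have "(\<lambda>z. killed (snd z) (rate_jump (dyson n (t - snd z) f)) (fst z)) \<in> borel_measurable (BE \<Otimes>\<^sub>M lborel)"
      using first_jump_integrand_measurable[OF dyson_joint_measurable[OF f], of "\<lambda>z. t - snd z" _ snd fst]
      by simp
    then show "(\<lambda>(x, s). killed s (rate_jump (dyson n (t - s) f)) x) \<in> borel_measurable (BE \<Otimes>\<^sub>M lborel)"
      by (simp add: split_beta')
  qed auto
  from positive_operator_add[OF positive_operator_killed this]
  show ?case unfolding dyson.simps(2) first_jump_def .
qed

lemma positive_operator_min_op: "positive_operator BE (min_op t)"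
  unfolding min_op_def[abs_def]
  by (intro positive_operator_SUP positive_operator_dyson dyson_mono_Suc) auto

end

section \<open>Pairings over a sigma-finite measure\<close>

lemma (in sigma_finite_measure) pairing_integral:
  assumes T: "(\<lambda>(x, s). T s x) \<in> borel_measurable (M \<Otimes>\<^sub>M lborel)" and u[measurable]: "u \<in> borel_measurable M"
    and w[measurable]: "w \<in> borel_measurable borel"
  shows "pairing M (\<lambda>x. \<integral>\<^sup>+s. T s x * w s \<partial>(lborel :: real measure)) u = (\<integral>\<^sup>+s. pairing M (T s) u * w s \<partial>lborel)"
proof -
  interpret pair_sigma_finite M "lborel :: real measure" by unfold_locales
  note T[measurable]
  have 1[measurable]: "T s \<in> borel_measurable M" for s
    using measurable_compose[OF measurable_Pair2'[of s lborel] T] by simp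
  have 2[measurable]: "(\<lambda>s. T s x) \<in> borel_measurable lborel" if "x \<in> space M" for x
    using measurable_compose[OF measurable_Pair1'[OF that] T] by simp
  have "pairing M (\<lambda>x. \<integral>\<^sup>+s. T s x * w s \<partial>lborel) u
      = (\<integral>\<^sup>+x. (\<integral>\<^sup>+s. T s x * w s * ennreal (u x) \<partial>lborel) \<partial>M)"
    by (intro nn_integral_cong nn_integral_multc[symmetric]) auto
  also have "\<dots> = (\<integral>\<^sup>+s. (\<integral>\<^sup>+x. T s x * w s * ennreal (u x) \<partial>M) \<partial>lborel)"
    by (rule Fubini'[symmetric]) (use T in measurable)
  also have "\<dots> = (\<integral>\<^sup>+s. pairing M (T s) u * w s \<partial>lborel)"
    by (intro nn_integral_cong) (subst nn_integral_multc[symmetric], auto simp: mult_ac)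
  finally show ?thesis .
qed

lemma (in sigma_finite_measure) strictly_positive_L1:
  obtains u where "u \<in> L1_pos M" "\<And>x. x \<in> space M \<Longrightarrow> 0 < u x"
proof -
  obtain h where h[measurable]: "h \<in> borel_measurable M" and fin: "integral\<^sup>N M h \<noteq> \<infinity>"
    and pos: "\<And>x. x \<in> space M \<Longrightarrow> 0 < h x \<and> h x < \<infinity>"
    using Ex_finite_integrable_function by blast
  define u where "u x = enn2real (h x)" for x
  have hu: "h x = ennreal (u x)" if "x \<in> space M" for x using pos[OF that] by (simp add: u_def)
  have "integrable M u"
  proof (rule integrableI_nonneg)
    have "(\<integral>\<^sup>+x. ennreal (u x) \<partial>M) = integral\<^sup>N M h" by (intro nn_integral_cong) (simp add: hu)
    then show "(\<integral>\<^sup>+x. ennreal (u x) \<partial>M) < \<infinity>" using fin by (simp add: less_top)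
  qed (auto simp: u_def[abs_def])
  then have "u \<in> L1_pos M" by (auto simp: L1_pos_def u_def)
  moreover have "0 < u x" if "x \<in> space M" for x
    using pos[OF that] by (simp add: u_def enn2real_positive_iff)
  ultimately show thesis by (rule that)
qed

lemma AE_zero_of_pairing_zero:
  assumes f[measurable]: "f \<in> borel_measurable M" and u: "u \<in> L1_pos M" "\<And>x. x \<in> space M \<Longrightarrow> 0 < u x"
    and 0: "pairing M f u = 0"
  shows "AE x in M. f x = 0"
proof -
  note [measurable] = L1_posD(3)[OF u(1)]
  have "AE x in M. f x * ennreal (u x) = 0" using 0 by (subst (asm) nn_integral_0_iff_AE) auto
  moreover have "AE x in M. 0 < u x" using u(2) by (rule AE_I2)
  ultimately show ?thesis by eventually_elim auto
qed

lemma pairing_zero_of_AE_zero: "AE x in M. f x = 0 \<Longrightarrow> pairing M f u = 0"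
  by (subst nn_integral_cong_AE[of _ "\<lambda>_. 0"]) auto

lemma pairing_mono: "(\<And>x. x \<in> space M \<Longrightarrow> f x \<le> g x) \<Longrightarrow> pairing M f u \<le> pairing M g u"
  by (intro nn_integral_mono mult_right_mono) auto

lemma pairing_add:
  assumes [measurable]: "f \<in> borel_measurable M" "g \<in> borel_measurable M" "u \<in> borel_measurable M"
  shows "pairing M (\<lambda>x. f x + g x) u = pairing M f u + pairing M g u"
  by (simp add: distrib_right nn_integral_add)

lemma (in sigma_finite_measure) L1_pos_leI:
  assumes a: "a \<in> L1_pos M" and b: "b \<in> L1_pos M"
    and le: "\<And>B. B \<in> sets M \<Longrightarrow> pairing M (indicator B) a \<le> pairing M (indicator B) b"
  shows "AE x in M. a x \<le> b x"
proof -
  have "AE x in M. 0 \<le> b x - a x"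
  proof (rule density_nonneg)
    fix B assume B: "B \<in> sets M"
    have "(LINT x:B|M. b x - a x) = (LINT x:B|M. b x) - (LINT x:B|M. a x)"
      using L1_posD(1)[OF a] L1_posD(1)[OF b] B by (intro set_integral_diff set_integrable_subset_of_integrable)
    moreover have "ennreal (LINT x:B|M. a x) \<le> ennreal (LINT x:B|M. b x)"
      using le[OF B] L1_pos_set_integral(1)[OF a B] L1_pos_set_integral(1)[OF b B] by simp
    ultimately show "0 \<le> (LINT x:B|M. b x - a x)"
      using L1_pos_set_integral(2)[OF b B] by (simp add: ennreal_le_iff)
  qed (use L1_posD(1)[OF a] L1_posD(1)[OF b] in auto)
  then show ?thesis by eventually_elim simp
qed

text \<open>
  For \<open>0 \<le> s \<le> q\<close> the norm of \<open>q - s\<close> is a difference of masses, so any mass that \<open>q\<close> has in excess of \<open>s\<close>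
  was lost on the way from \<open>u\<close> to \<open>s\<close>. Strong continuity passes in this way from the killed semigroup to every
  substochastic semigroup above it.
\<close>

lemma L1_norm_diff_le_of_dominated:
  assumes s: "s \<in> L1_pos m" and q: "q \<in> L1_pos m" and u: "u \<in> L1_pos m"
    and le: "AE x in m. s x \<le> q x" and norm: "L1_norm m q \<le> L1_norm m u"
  shows "L1_norm m (\<lambda>x. q x - s x) \<le> L1_norm m (\<lambda>x. s x - u x)"
proof -
  note i = L1_posD(1)[OF s] L1_posD(1)[OF q] L1_posD(1)[OF u]
  have "L1_norm m (\<lambda>x. q x - s x) = (LINT x|m. q x - s x)"
    unfolding L1_norm_def using le i by (intro integral_cong_AE) auto
  also have "\<dots> = L1_norm m q - L1_norm m s" using i by (simp add: L1_pos_norm(1) s q)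
  also have "\<dots> \<le> L1_norm m u - L1_norm m s" using norm by simp
  also have "\<dots> = (LINT x|m. u x - s x)" using i by (simp add: L1_pos_norm(1) s u)
  also have "\<dots> \<le> (LINT x|m. \<bar>s x - u x\<bar>)" using i by (intro integral_mono) auto
  finally show ?thesis by (simp add: L1_norm_def)
qed

section \<open>The semigroup on \<open>L\<^sup>1\<close> of the process killed at explosion\<close>

locale pdmp_L1 = pdmp_characteristics E \<pi> \<phi> J + sigma_finite_measure m
  for E :: "'a::polish_space set" and \<pi> \<phi> J and m :: "'a measure" +
  fixes P :: "('a \<Rightarrow> real) \<Rightarrow> 'a \<Rightarrow> real" and S :: "real \<Rightarrow> ('a \<Rightarrow> real) \<Rightarrow> 'a \<Rightarrow> real"
  assumes sets_m: "sets m = sets BE"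
    and P_stochastic: "stochastic_operator m P"
    and P_transition: "transition_operator m J P"
    and S_killed: "killed_flow_semigroup m \<pi> \<phi> S"
begin

sublocale S: L1_semigroup m S
  using S_killed by unfold_locales (simp add: killed_flow_semigroup_def)

lemma space_m[simp]: "space m = E"
  using sets_eq_imp_space_eq[OF sets_m] by simp

lemma measurable_m: "f \<in> borel_measurable m \<longleftrightarrow> f \<in> borel_measurable BE"
  using measurable_cong_sets[OF sets_m refl] by blast

lemma measurable_m_pair: "f \<in> borel_measurable (m \<Otimes>\<^sub>M N) \<longleftrightarrow> f \<in> borel_measurable (BE \<Otimes>\<^sub>M N)"
  using measurable_cong_sets[OF sets_pair_measure_cong[OF sets_m refl] refl] by blast

lemma indicator_measurable:
  assumes "B \<in> sets m"
  shows "(indicator B :: 'a \<Rightarrow> ennreal) \<in> borel_measurable m" "(indicator B :: 'a \<Rightarrow> ennreal) \<in> borel_measurable BE"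
  using assms by (simp_all flip: measurable_m)

lemma operator_on_m: "positive_operator BE T \<Longrightarrow> positive_operator m T"
  by (rule positive_operator_cong_sets[OF sets_m])

lemma pairing_S:
  assumes t: "0 \<le> t" and u: "u \<in> L1_pos m" and f: "f \<in> borel_measurable m"
  shows "pairing m f (S t u) = pairing m (killed t f) u"
proof (rule positive_operator.pairing_extend[OF operator_on_m[OF positive_operator_killed]])
  fix B assume B: "B \<in> sets m"
  have "indicator B \<in> borel_measurable m" using B by simp
  then have [measurable]: "killed t (indicator B) \<in> borel_measurable m"
    using positive_operator.meas[OF operator_on_m[OF positive_operator_killed]] by blast
  have *: "indicator B (\<pi> t x) = (indicator B (flow t x) :: real)" for x using t by (simp add: flow_nonneg)
  have km: "(\<lambda>x. enn2real (killed t (indicator B) x)) \<in> borel_measurable m" by measurable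
  have enn: "enn2real (killed t (indicator B) x) = exp (- \<Phi> x t) * indicator B (\<pi> t x)" for x
    unfolding * killed_def by (simp add: indicator_def)
  have le1: "exp (- \<Phi> x t) \<le> 1" if "x \<in> E" for x using nn_integral_rate(2)[OF that] by simp
  have int: "integrable m (\<lambda>x. exp (- \<Phi> x t) * indicator B (\<pi> t x) * u x)"
    using L1_posD[OF u] km le1
    by (intro Bochner_Integration.integrable_bound[OF L1_posD(1)[OF u]])
       (auto simp: enn indicator_def abs_mult mult_left_le_one_le intro!: AE_I2)
  have "pairing m (killed t (indicator B)) u = (\<integral>\<^sup>+x. ennreal (exp (- \<Phi> x t) * indicator B (\<pi> t x) * u x) \<partial>m)"
    unfolding * by (intro nn_integral_cong) (auto simp: killed_def indicator_def ennreal_mult')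
  also have "\<dots> = ennreal (LINT x|m. exp (- \<Phi> x t) * indicator B (\<pi> t x) * u x)"
    using L1_posD(2)[OF u] by (intro nn_integral_eq_integral int) (auto elim!: eventually_mono)
  also have "(LINT x|m. exp (- \<Phi> x t) * indicator B (\<pi> t x) * u x) = (LINT x:B|m. S t u x)"
    using S_killed t u B unfolding killed_flow_semigroup_def by blast
  finally show "pairing m (indicator B) (S t u) = pairing m (killed t (indicator B)) u"
    using L1_pos_set_integral(1)[OF S.pos[OF t u] B] by simp
qed (use L1_posD(3)[OF u] L1_posD(3)[OF S.pos[OF t u]] f in auto)

abbreviation jump :: "('a \<Rightarrow> ennreal) \<Rightarrow> 'a \<Rightarrow> ennreal" where
  "jump f x \<equiv> (\<integral>\<^sup>+y. f y \<partial>J x)"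

lemma P_linear: "L1_linear m P"
  using P_stochastic by (simp add: stochastic_operator_def)

text \<open>
  The defining relation of a transition operator concerns densities only; it extends to the positive cone by
  scaling, where an element of norm \<open>0\<close> has to be treated separately.
\<close>

lemma P_pos_pairing:
  assumes u: "u \<in> L1_pos m"
  shows "P u \<in> L1_pos m \<and> (\<forall>B\<in>sets m. pairing m (indicator B) (P u) = pairing m (jump (indicator B)) u)"
proof (cases "L1_norm m u = 0")
  case True
  then have "AE x in m. u x = 0"
    unfolding L1_norm_def using L1_posD[OF u] by (subst (asm) integral_nonneg_eq_0_iff_AE) auto
  note u0 = this
  have "AE x in m. P u x = P (\<lambda>_. 0) x"
    using L1_linearD(2)[OF P_linear _ _ u0] L1_posD(1)[OF u] by auto
  moreover have "AE x in m. P (\<lambda>_. 0) x = 0"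
    using L1_linearD(4)[OF P_linear, of "\<lambda>_. 0" 0] by simp
  ultimately have Pu0: "AE x in m. P u x = 0" by eventually_elim simp
  have "P u \<in> L1_pos m"
    using L1_linearD(1)[OF P_linear L1_posD(1)[OF u]] Pu0 by (auto simp: L1_pos_def elim!: eventually_mono)
  moreover have "pairing m f v = 0" if "AE x in m. v x = 0" for f v
  proof -
    have "pairing m f v = (\<integral>\<^sup>+x. 0 \<partial>m)" using that by (intro nn_integral_cong_AE) (auto elim!: eventually_mono)
    then show ?thesis by simp
  qed
  ultimately show ?thesis using u0 Pu0 by simp
next
  case False
  define c where "c = L1_norm m u"
  have c: "0 < c" using False L1_norm_nonneg[of m u] by (simp add: c_def)
  define d where "d x = (1 / c) * u x" for x
  have dd: "d \<in> densities m"
    using L1_posD(1,2)[OF u] c L1_norm_cmult[of m "1 / c" u]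
    by (auto simp: densities_def L1_pos_def d_def[abs_def] c_def[symmetric])
  then have Pd: "P d \<in> densities m" using P_stochastic by (simp add: stochastic_operator_def)
  then have Pd1: "P d \<in> L1_pos m" by (simp add: densities_def)
  have u_d: "u = (\<lambda>x. c * d x)" using c by (simp add: d_def)
  have di: "integrable m d" using dd by (simp add: densities_def L1_pos_def)
  have Pu: "AE x in m. P u x = c * P d x" unfolding u_d by (rule L1_linearD(4)[OF P_linear di])
  have Pu1: "P u \<in> L1_pos m"
    using L1_linearD(1)[OF P_linear L1_posD(1)[OF u]] Pu L1_posD(2)[OF Pd1] c
    by (auto simp: L1_pos_def elim: AE_mp)
  have "pairing m (indicator B) (P u) = pairing m (jump (indicator B)) u" if B: "B \<in> sets m" for B
  proof -
    have jB: "jump (indicator B) x = ennreal (measure (J x) B)" if "x \<in> E" for x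
    proof -
      interpret J: prob_space "J x" by (rule J_prob[OF that])
      show ?thesis using B sets_J[OF that] sets_m by (simp add: J.emeasure_eq_measure)
    qed
    have "indicator B \<in> borel_measurable m" using B by simp
    then have jm: "jump (indicator B) \<in> borel_measurable m"
      using positive_operator.meas[OF operator_on_m[OF positive_operator_jump]] by blast
    have mm: "(\<lambda>x. measure (J x) B) \<in> borel_measurable m"
      using borel_measurable_enn2real[OF jm]
      by (rule measurable_cong[THEN iffD1, rotated]) (simp add: jB)
    have int: "integrable m (\<lambda>x. measure (J x) B * u x)"
      using L1_posD[OF u] mm prob_space.prob_le_1[OF J_prob]
      by (intro Bochner_Integration.integrable_bound[OF L1_posD(1)[OF u]])
         (auto simp: abs_mult mult_left_le_one_le intro!: AE_I2)
    have "pairing m (jump (indicator B)) u = (\<integral>\<^sup>+x. ennreal (measure (J x) B * u x) \<partial>m)"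
      by (intro nn_integral_cong) (simp add: jB ennreal_mult')
    also have "\<dots> = ennreal (LINT x|m. measure (J x) B * u x)"
      using L1_posD(2)[OF u] by (intro nn_integral_eq_integral int) (auto elim!: eventually_mono)
    also have "(LINT x|m. measure (J x) B * u x) = c * (LINT x|m. measure (J x) B * d x)"
      unfolding u_d by (simp add: mult.left_commute)
    also have "(LINT x|m. measure (J x) B * d x) = (LINT x:B|m. P d x)"
      using P_transition dd B by (simp add: transition_operator_def)
    also have "c * (LINT x:B|m. P d x) = (LINT x:B|m. c * P d x)" by simp
    also have "\<dots> = (LINT x:B|m. P u x)"
      unfolding set_lebesgue_integral_def using Pu L1_posD(3)[OF Pu1] L1_posD(3)[OF Pd1] B
      by (intro integral_cong_AE) (auto elim!: eventually_mono)
    finally show ?thesis using L1_pos_set_integral(1)[OF Pu1 B] by simp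
  qed
  then show ?thesis using Pu1 by blast
qed

lemma pairing_P:
  assumes u: "u \<in> L1_pos m" and f: "f \<in> borel_measurable m"
  shows "pairing m f (P u) = pairing m (jump f) u"
proof -
  note Pu = conjunct1[OF P_pos_pairing[OF u]] and pair = conjunct2[OF P_pos_pairing[OF u], rule_format]
  show ?thesis
    by (rule positive_operator.pairing_extend[OF operator_on_m[OF positive_operator_jump]
          L1_posD(3)[OF u] L1_posD(3)[OF Pu] pair f])
qed

text \<open>
  The condition for having a predual. For killing and jumping it holds because \<open>S\<close> and \<open>P\<close> are given as
  preduals; it is inherited by compositions, time integrals and limits, hence by the transition operators of
  the process.
\<close>

definition null_preserving :: "(('a \<Rightarrow> ennreal) \<Rightarrow> 'a \<Rightarrow> ennreal) \<Rightarrow> bool" where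
  "null_preserving T \<longleftrightarrow> (\<forall>f\<in>borel_measurable m. (AE x in m. f x = 0) \<longrightarrow> (AE x in m. T f x = 0))"

lemma null_preserving_of_predual:
  assumes T: "positive_operator m T"
    and dual: "\<And>f u. f \<in> borel_measurable m \<Longrightarrow> u \<in> L1_pos m \<Longrightarrow> pairing m (T f) u = pairing m f (T' u)"
  shows "null_preserving T"
  unfolding null_preserving_def
proof (intro ballI impI)
  fix f :: "'a \<Rightarrow> ennreal" assume f: "f \<in> borel_measurable m" "AE x in m. f x = 0"
  \<comment> \<open>testing with a strictly positive \<open>u\<close> detects every set of positive measure\<close>
  obtain u where u: "u \<in> L1_pos m" "\<And>x. x \<in> space m \<Longrightarrow> 0 < u x" by (rule strictly_positive_L1) auto
  show "AE x in m. T f x = 0"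
    using dual[OF f(1) u(1)] pairing_zero_of_AE_zero[OF f(2)]
    by (intro AE_zero_of_pairing_zero[OF positive_operator.meas[OF T f(1)] u]) auto
qed

lemma null_preserving_killed: "0 \<le> t \<Longrightarrow> null_preserving (killed t)"
  by (rule null_preserving_of_predual[OF operator_on_m[OF positive_operator_killed], of _ "S t"])
     (simp add: pairing_S)

lemma null_preserving_rate_jump: "null_preserving rate_jump"
proof -
  have "null_preserving jump"
    by (rule null_preserving_of_predual[OF operator_on_m[OF positive_operator_jump], of P])
       (simp add: pairing_P)
  then show ?thesis
    unfolding null_preserving_def rate_jump_def
  proof (intro ballI impI)
    fix f :: "'a \<Rightarrow> ennreal"
    assume "\<forall>f\<in>borel_measurable m. (AE x in m. f x = 0) \<longrightarrow> (AE x in m. jump f x = 0)"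
      and "f \<in> borel_measurable m" "AE x in m. f x = 0"
    then have "AE x in m. jump f x = 0" by blast
    then show "AE x in m. ennreal (\<phi> x) * jump f x = 0" by eventually_elim simp
  qed
qed

lemma null_preserving_integral:
  assumes T: "\<And>s. s \<in> A \<Longrightarrow> null_preserving (T s)"
    and meas: "\<And>f. f \<in> borel_measurable m \<Longrightarrow> (\<lambda>(x, s). T s f x) \<in> borel_measurable (m \<Otimes>\<^sub>M lborel)"
    and w: "w \<in> borel_measurable borel" "\<And>s. s \<notin> A \<Longrightarrow> w s = 0"
  shows "null_preserving (\<lambda>f x. \<integral>\<^sup>+s. T s f x * w s \<partial>(lborel :: real measure))"
  unfolding null_preserving_def
proof (intro ballI impI)
  fix f :: "'a \<Rightarrow> ennreal" assume f: "f \<in> borel_measurable m" "AE x in m. f x = 0"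
  obtain u where u: "u \<in> L1_pos m" "\<And>x. x \<in> space m \<Longrightarrow> 0 < u x" by (rule strictly_positive_L1) auto
  have 0: "pairing m (T s f) u * w s = 0" for s
  proof (cases "s \<in> A")
    case True
    then have "AE x in m. T s f x = 0" using T f unfolding null_preserving_def by blast
    then show ?thesis by (simp add: pairing_zero_of_AE_zero)
  qed (simp add: w)
  have "pairing m (\<lambda>x. \<integral>\<^sup>+s. T s f x * w s \<partial>lborel) u = (\<integral>\<^sup>+s. pairing m (T s f) u * w s \<partial>lborel)"
    by (rule pairing_integral[OF meas[OF f(1)] L1_posD(3)[OF u(1)] w(1)])
  also have "\<dots> = 0" unfolding 0 by simp
  finally have pair0: "pairing m (\<lambda>x. \<integral>\<^sup>+s. T s f x * w s \<partial>lborel) u = 0" .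
  show "AE x in m. (\<integral>\<^sup>+s. T s f x * w s \<partial>lborel) = 0"
  proof (rule AE_zero_of_pairing_zero[OF _ u pair0])
    note [measurable] = meas[OF f(1)] w(1)
    show "(\<lambda>x. \<integral>\<^sup>+s. T s f x * w s \<partial>lborel) \<in> borel_measurable m"
      by (rule lborel.borel_measurable_nn_integral) measurable
  qed
qed

lemma dyson_integrand_measurable:
  assumes "f \<in> borel_measurable m"
  shows "(\<lambda>(x, s). killed s (rate_jump (dyson n (t - s) f)) x) \<in> borel_measurable (m \<Otimes>\<^sub>M lborel)"
proof -
  have f: "f \<in> borel_measurable BE" using assms by (simp add: measurable_m)
  show ?thesis
    using first_jump_integrand_measurable[OF dyson_joint_measurable[OF f], of "\<lambda>z. t - snd z" "BE \<Otimes>\<^sub>M lborel" snd fst]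
    by (simp add: split_beta' measurable_m_pair)
qed

lemma null_preserving_dyson: "0 \<le> t \<Longrightarrow> null_preserving (dyson n t)"
proof (induction n arbitrary: t)
  case (Suc n)
  have "null_preserving (\<lambda>f x. \<integral>\<^sup>+s. killed s (rate_jump (dyson n (t - s) f)) x * indicator {0..t} s \<partial>lborel)"
  proof (rule null_preserving_integral[OF _ dyson_integrand_measurable])
    fix s assume s: "s \<in> {0..t}"
    have "null_preserving (dyson n (t - s))" using s by (intro Suc.IH) auto
    moreover have "null_preserving (killed s)" using s by (intro null_preserving_killed) auto
    ultimately show "null_preserving (\<lambda>f. killed s (rate_jump (dyson n (t - s) f)))"
      using null_preserving_rate_jump positive_operator.meas[OF operator_on_m[OF positive_operator_dyson]]
        positive_operator.meas[OF operator_on_m[OF positive_operator_rate_jump]]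
      unfolding null_preserving_def by blast
  qed auto
  then show ?case
    using null_preserving_killed[OF Suc.prems]
    unfolding null_preserving_def dyson.simps(2) first_jump_def by (auto elim: AE_mp)
qed (simp add: null_preserving_def)

lemma null_preserving_min_op: "0 \<le> t \<Longrightarrow> null_preserving (min_op t)"
proof -
  assume t: "0 \<le> t"
  show ?thesis
    unfolding null_preserving_def min_op_def[abs_def]
  proof (intro ballI impI)
    fix f :: "'a \<Rightarrow> ennreal" assume f: "f \<in> borel_measurable m" "AE x in m. f x = 0"
    then have "AE x in m. \<forall>n. dyson n t f x = 0"
      using null_preserving_dyson[OF t] unfolding null_preserving_def AE_all_countable by blast
    then show "AE x in m. (SUP n. dyson n t f x) = 0" by eventually_elim simp
  qed
qed

lemma sub_markov_of_null_preserving: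
  assumes "positive_operator m T" "\<And>x. x \<in> E \<Longrightarrow> T (\<lambda>_. 1) x \<le> 1" "null_preserving T"
  shows "sub_markov_operator m T"
proof -
  interpret positive_operator m T by fact
  show ?thesis
  proof unfold_locales
    fix N assume N: "N \<in> null_sets m"
    then have "AE x in m. indicator N x = (0::ennreal)" using AE_not_in[OF N] by (auto elim!: eventually_mono)
    moreover have "indicator N \<in> borel_measurable m" using N by auto
    ultimately show "AE x in m. T (indicator N) x = 0"
      using assms(3) unfolding null_preserving_def by blast
  qed (use assms(2) in simp)
qed

lemma sub_markov_min_op: "0 \<le> t \<Longrightarrow> sub_markov_operator m (min_op t)"
  by (intro sub_markov_of_null_preserving operator_on_m positive_operator_min_op null_preserving_min_op min_op_1_le)

text \<open>
  The competitor for the minimal semigroup: the densities at time \<open>t\<close> of the process killed at explosion.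
\<close>

definition Q :: "real \<Rightarrow> ('a \<Rightarrow> real) \<Rightarrow> 'a \<Rightarrow> real" where
  "Q t = predual m (min_op t)"

lemma Q_pos: "0 \<le> t \<Longrightarrow> u \<in> L1_pos m \<Longrightarrow> Q t u \<in> L1_pos m"
  unfolding Q_def by (rule sub_markov_operator.predual_pos(1)[OF sub_markov_min_op])

lemma pairing_Q: "0 \<le> t \<Longrightarrow> u \<in> L1_pos m \<Longrightarrow> f \<in> borel_measurable m \<Longrightarrow>
    pairing m f (Q t u) = pairing m (min_op t f) u"
  unfolding Q_def by (rule sub_markov_operator.predual_pos(2)[OF sub_markov_min_op])

lemma Q_linear: "0 \<le> t \<Longrightarrow> L1_linear m (Q t)"
  unfolding Q_def by (rule sub_markov_operator.predual_linear[OF sub_markov_min_op])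

lemma Q_contraction: "0 \<le> t \<Longrightarrow> integrable m u \<Longrightarrow> L1_norm m (Q t u) \<le> L1_norm m u"
  unfolding Q_def by (rule sub_markov_operator.predual_contraction[OF sub_markov_min_op])

lemma L1_linear_id: "L1_linear m (\<lambda>u. u)"
  unfolding L1_linear_def by auto

lemma S_le_Q:
  assumes t: "0 \<le> t" and u: "u \<in> L1_pos m"
  shows "AE x in m. S t u x \<le> Q t u x"
proof (rule L1_pos_leI[OF S.pos[OF t u] Q_pos[OF t u]])
  fix B assume B: "B \<in> sets m"
  note f = indicator_measurable[OF B]
  have "killed t (indicator B) x \<le> min_op t (indicator B) x" if "x \<in> E" for x
    unfolding min_op_eq[OF f(2) that] by simp
  then show "pairing m (indicator B) (S t u) \<le> pairing m (indicator B) (Q t u)"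
    unfolding pairing_S[OF t u f(1)] pairing_Q[OF t u f(1)] by (intro pairing_mono) simp
qed

text \<open>
  \<open>Q t u\<close> lies above \<open>S t u\<close> and has at most the mass of \<open>u\<close>.
\<close>

lemma Q_strongly_continuous_pos:
  assumes t: "0 \<le> t" and u: "u \<in> L1_pos m"
  shows "L1_norm m (\<lambda>x. Q t u x - u x) \<le> 2 * L1_norm m (\<lambda>x. S t u x - u x)"
proof -
  note i = L1_posD(1)[OF Q_pos[OF t u]] L1_posD(1)[OF S.pos[OF t u]] L1_posD(1)[OF u]
  have "L1_norm m (\<lambda>x. Q t u x - u x) = L1_norm m (\<lambda>x. (Q t u x - S t u x) + (S t u x - u x))" by simp
  also have "\<dots> \<le> L1_norm m (\<lambda>x. Q t u x - S t u x) + L1_norm m (\<lambda>x. S t u x - u x)"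
    using i by (intro L1_norm_add_le) auto
  also have "L1_norm m (\<lambda>x. Q t u x - S t u x) \<le> L1_norm m (\<lambda>x. S t u x - u x)"
    by (rule L1_norm_diff_le_of_dominated[OF S.pos[OF t u] Q_pos[OF t u] u S_le_Q[OF t u] Q_contraction[OF t i(3)]])
  finally show ?thesis by simp
qed

lemma Q_substochastic: "substochastic_semigroup m Q"
  unfolding substochastic_semigroup_def
proof (intro conjI allI impI ballI)
  fix u :: "'a \<Rightarrow> real" assume u: "integrable m u"
  show "AE x in m. Q 0 u x = u x"
  proof (rule L1_linear_eqI[OF Q_linear L1_linear_id _ u])
    fix u :: "'a \<Rightarrow> real" assume u: "u \<in> L1_pos m"
    show "AE x in m. Q 0 u x = u x"
    proof (rule L1_pos_eqI[OF Q_pos[OF order_refl u] u])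
      fix B assume B: "B \<in> sets m"
      note f = indicator_measurable[OF B]
      show "pairing m (indicator B) (Q 0 u) = pairing m (indicator B) u"
        unfolding pairing_Q[OF order_refl u f(1)] using min_op_0[OF f(2)] by (intro nn_integral_cong) simp
    qed
  qed simp
  show "((\<lambda>t. L1_norm m (\<lambda>x. Q t u x - u x)) \<longlongrightarrow> 0) (at_right 0)"
  proof -
    obtain p n where pn: "p \<in> L1_pos m" "n \<in> L1_pos m" and u_eq: "u = (\<lambda>x. p x - n x)"
      by (rule L1_parts[OF u])
    have lim: "((\<lambda>t. 2 * L1_norm m (\<lambda>x. S t p x - p x) + 2 * L1_norm m (\<lambda>x. S t n x - n x)) \<longlongrightarrow> 0) (at_right 0)"
      by (intro tendsto_add_zero tendsto_mult_right_zero S.cont pn[THEN L1_posD(1)])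
    have "\<forall>\<^sub>F t in at_right (0::real). 0 < t" by (simp add: eventually_at_right_less)
    then have "\<forall>\<^sub>F t in at_right 0. norm (L1_norm m (\<lambda>x. Q t u x - u x))
      \<le> 2 * L1_norm m (\<lambda>x. S t p x - p x) + 2 * L1_norm m (\<lambda>x. S t n x - n x)"
    proof eventually_elim
      case (elim t)
      then have t: "0 \<le> t" by simp
      show ?case
        using L1_norm_linear_diff_le[OF L1_linear_minus_id[OF Q_linear[OF t]] pn[THEN L1_posD(1)]]
          Q_strongly_continuous_pos[OF t pn(1)] Q_strongly_continuous_pos[OF t pn(2)]
        unfolding u_eq by (simp add: L1_norm_nonneg)
    qed
    then show ?thesis by (rule Lim_null_comparison[OF _ lim])
  qed
  fix s t :: real assume st: "0 \<le> s" "0 \<le> t"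
  then have ts: "0 \<le> t + s" by simp
  show "AE x in m. Q (t + s) u x = Q t (Q s u) x"
  proof (rule L1_linear_eqI[OF Q_linear[OF ts] L1_linear_comp[OF Q_linear[OF st(2)] Q_linear[OF st(1)]] _ u])
    fix u :: "'a \<Rightarrow> real" assume u: "u \<in> L1_pos m"
    show "AE x in m. Q (t + s) u x = Q t (Q s u) x"
    proof (rule L1_pos_eqI[OF Q_pos[OF ts u] Q_pos[OF st(2) Q_pos[OF st(1) u]]])
      fix B assume B: "B \<in> sets m"
      note f = indicator_measurable[OF B]
      have f': "min_op t (indicator B) \<in> borel_measurable m" using min_op_measurable[OF f(2)] by (simp add: measurable_m)
      show "pairing m (indicator B) (Q (t + s) u) = pairing m (indicator B) (Q t (Q s u))"
        unfolding pairing_Q[OF ts u f(1)] pairing_Q[OF st(2) Q_pos[OF st(1) u] f(1)] pairing_Q[OF st(1) u f']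
        using min_op_add[OF f(2) _ st] by (intro nn_integral_cong) (simp add: add.commute)
    qed
  qed
qed (auto intro: Q_linear Q_pos Q_contraction)

sublocale Q: L1_semigroup m Q
  by unfold_locales (rule Q_substochastic)

end

section \<open>The resolvent of the killed flow\<close>

lemma nn_average_bounds:
  assumes h: "0 \<le> h" and I: "\<And>s. s \<in> {0..h} \<Longrightarrow> ennreal a \<le> I s" "\<And>s. s \<in> {0..h} \<Longrightarrow> I s \<le> ennreal b"
  shows "ennreal (h * a) \<le> (\<integral>\<^sup>+s. I s * indicator {0..h} s \<partial>lborel)"
    and "(\<integral>\<^sup>+s. I s * indicator {0..h} s \<partial>lborel) \<le> ennreal (h * b)"
proof -
  have c: "(\<integral>\<^sup>+s. ennreal k * indicator {0..h} s \<partial>lborel) = ennreal (h * k)" for k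
    using h by (subst nn_integral_cmult_indicator) (auto simp: ennreal_mult' mult.commute)
  show "ennreal (h * a) \<le> (\<integral>\<^sup>+s. I s * indicator {0..h} s \<partial>lborel)"
    unfolding c[symmetric] using I(1) by (intro nn_integral_mono) (auto simp: indicator_def)
  show "(\<integral>\<^sup>+s. I s * indicator {0..h} s \<partial>lborel) \<le> ennreal (h * b)"
    unfolding c[symmetric] using I(2) by (intro nn_integral_mono) (auto simp: indicator_def)
qed

lemma (in sigma_finite_measure) L1_pos_difference:
  assumes a: "a \<in> L1_pos M" and b: "b \<in> L1_pos M"
    and c: "\<And>B. B \<in> sets M \<Longrightarrow> pairing M (indicator B) a = pairing M (indicator B) b + c B"
  shows "(\<lambda>x. a x - b x) \<in> L1_pos M"
    and "\<And>B. B \<in> sets M \<Longrightarrow> pairing M (indicator B) (\<lambda>x. a x - b x) = c B"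
proof -
  note i = L1_posD(1)[OF a] L1_posD(1)[OF b]
  have "AE x in M. b x \<le> a x" by (rule L1_pos_leI[OF b a]) (simp add: c)
  then show ab: "(\<lambda>x. a x - b x) \<in> L1_pos M" using i by (simp add: L1_pos_def)
  fix B assume B: "B \<in> sets M"
  have "(LINT x:B|M. a x - b x) = (LINT x:B|M. a x) - (LINT x:B|M. b x)"
    using i B by (intro set_integral_diff set_integrable_subset_of_integrable)
  then have "pairing M (indicator B) (\<lambda>x. a x - b x) = pairing M (indicator B) a - pairing M (indicator B) b"
    using L1_pos_set_integral(2)[OF b B] unfolding L1_pos_set_integral(1)[OF ab B, symmetric]
      L1_pos_set_integral(1)[OF a B, symmetric] L1_pos_set_integral(1)[OF b B, symmetric]
    by (simp add: ennreal_minus)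
  also have "\<dots> = c B"
    unfolding c[OF B] L1_pos_set_integral(1)[OF b B, symmetric] by simp
  finally show "pairing M (indicator B) (\<lambda>x. a x - b x) = c B" .
qed

text \<open>
  An average over a short interval is close to \<open>w\<close> when the averaged functions are. Closeness is asked for the set
  integrals only, uniformly in the set, which controls the norm by \<open>L1_norm_le_twice_set_integrals\<close>. Both generators
  below are computed from this principle.
\<close>

lemma L1_average_tendsto:
  assumes y: "\<And>h. 0 < h \<Longrightarrow> y h \<in> L1_pos m" and w: "w \<in> L1_pos m"
    and avg: "\<And>h B. 0 < h \<Longrightarrow> B \<in> sets m \<Longrightarrow>
      pairing m (indicator B) (y h) = (\<integral>\<^sup>+s. I h B s * indicator {0..h} s \<partial>lborel)"
    and near: "\<And>e. 0 < e \<Longrightarrow> \<forall>\<^sub>F h in at_right 0. \<forall>B\<in>sets m. \<forall>s\<in>{0..h}.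
      ennreal ((LINT x:B|m. w x) - e) \<le> I h B s \<and> I h B s \<le> ennreal ((LINT x:B|m. w x) + e)"
  shows "((\<lambda>h. L1_norm m (\<lambda>x. y h x / h - w x)) \<longlongrightarrow> 0) (at_right (0::real))"
proof (rule tendstoI)
  fix e0 :: real assume e0: "0 < e0"
  define e where "e = e0 / 4"
  have e: "0 < e" using e0 by (simp add: e_def)
  have "\<forall>\<^sub>F h in at_right (0::real). 0 < h" by (simp add: eventually_at_right_less)
  with near[OF e] show "\<forall>\<^sub>F h in at_right 0. dist (L1_norm m (\<lambda>x. y h x / h - w x)) 0 < e0"
  proof eventually_elim
    case (elim h)
    note iy = L1_posD(1)[OF y[OF elim(2)]] and iw = L1_posD(1)[OF w]
    have "L1_norm m (\<lambda>x. y h x / h - w x) \<le> 2 * e"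
    proof (rule L1_norm_le_twice_set_integrals)
      show "integrable m (\<lambda>x. y h x / h - w x)" using iy iw by auto
      fix B assume B: "B \<in> sets m"
      define b where "b = (LINT x:B|m. w x)"
      define z where "z = (LINT x:B|m. y h x)"
      have b: "0 \<le> b" and z: "0 \<le> z"
        unfolding b_def z_def using L1_pos_set_integral(2) w y[OF elim(2)] B by auto
      have I: "ennreal z = (\<integral>\<^sup>+s. I h B s * indicator {0..h} s \<partial>lborel)"
        unfolding z_def L1_pos_set_integral(1)[OF y[OF elim(2)] B] by (rule avg[OF elim(2) B])
      have "ennreal (b - e) \<le> I h B s" "I h B s \<le> ennreal (b + e)" if "s \<in> {0..h}" for s
        using elim(1) B that unfolding b_def by blast+
      note bounds = this
      have "h * (b - e) \<le> z" "z \<le> h * (b + e)"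
        using nn_average_bounds[of h "b - e" "I h B" "b + e", folded I] bounds elim(2) b z e
        by (auto simp: ennreal_le_iff2)
      then have "\<bar>z / h - b\<bar> \<le> e" using elim(2) by (auto simp: abs_le_iff field_simps)
      moreover have "(LINT x:B|m. y h x / h - w x) = z / h - b"
      proof -
        have "(LINT x:B|m. y h x / h - w x) = (LINT x:B|m. y h x / h) - b"
          unfolding b_def using iy iw B by (intro set_integral_diff set_integrable_subset_of_integrable) auto
        then show ?thesis by (simp add: z_def)
      qed
      ultimately show "\<bar>LINT x:B|m. y h x / h - w x\<bar> \<le> e" by simp
    qed
    then show ?case using e0 L1_norm_nonneg[of m "\<lambda>x. y h x / h - w x"] by (simp add: e_def)
  qed
qed

lemma (in L1_semigroup) generator_diff_AE:
  assumes g1: "generator m Q u1 w1" and g2: "generator m Q u2 w2"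
    and u: "integrable m u" "AE x in m. u x = u1 x - u2 x"
    and w: "integrable m w" "AE x in m. w x = w1 x - w2 x"
  shows "generator m Q u w"
  unfolding generator_def
proof (intro conjI u(1) w(1))
  have i: "integrable m u1" "integrable m u2" "integrable m w1" "integrable m w2"
    and l1: "((\<lambda>t. L1_norm m (\<lambda>x. (Q t u1 x - u1 x) / t - w1 x)) \<longlongrightarrow> 0) (at_right 0)"
    and l2: "((\<lambda>t. L1_norm m (\<lambda>x. (Q t u2 x - u2 x) / t - w2 x)) \<longlongrightarrow> 0) (at_right 0)"
    using g1 g2 unfolding generator_def by auto
  show "((\<lambda>t. L1_norm m (\<lambda>x. (Q t u x - u x) / t - w x)) \<longlongrightarrow> 0) (at_right 0)"
  proof (rule Lim_null_comparison[OF _ tendsto_add_zero[OF l1 l2]])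
    have "\<forall>\<^sub>F t in at_right (0::real). 0 < t" by (simp add: eventually_at_right_less)
    then show "\<forall>\<^sub>F t in at_right 0. norm (L1_norm m (\<lambda>x. (Q t u x - u x) / t - w x))
        \<le> L1_norm m (\<lambda>x. (Q t u1 x - u1 x) / t - w1 x) + L1_norm m (\<lambda>x. (Q t u2 x - u2 x) / t - w2 x)"
    proof eventually_elim
      case (elim t)
      then have t: "0 \<le> t" by simp
      note Qi = integrable[OF t i(1)] integrable[OF t i(2)] integrable[OF t u(1)]
      have "integrable m (\<lambda>x. u1 x - u2 x)" using i by auto
      from L1_linearD(2)[OF linear[OF t] u(1) this u(2)] L1_linear_diff[OF linear[OF t] i(1,2)]
      have "AE x in m. Q t u x = Q t u1 x - Q t u2 x" by eventually_elim simp
      then have "AE x in m. (Q t u x - u x) / t - w x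
          = ((Q t u1 x - u1 x) / t - w1 x) + (- 1) * ((Q t u2 x - u2 x) / t - w2 x)"
        using u(2) w(2) by eventually_elim (simp add: diff_divide_distrib)
      then have "L1_norm m (\<lambda>x. (Q t u x - u x) / t - w x)
          = L1_norm m (\<lambda>x. ((Q t u1 x - u1 x) / t - w1 x) + (- 1) * ((Q t u2 x - u2 x) / t - w2 x))"
        using Qi i u w by (intro L1_norm_cong_AE) auto
      also have "\<dots> \<le> L1_norm m (\<lambda>x. (Q t u1 x - u1 x) / t - w1 x)
          + L1_norm m (\<lambda>x. (- 1) * ((Q t u2 x - u2 x) / t - w2 x))"
        using Qi i by (intro L1_norm_add_le) auto
      finally show ?case unfolding L1_norm_cmult by (simp add: L1_norm_nonneg)
    qed
  qed
qed

context pdmp_L1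
begin

text \<open>
  The Laplace transform of the killed flow; on \<open>L\<^sup>1\<close> it is the resolvent of the generator of \<open>S\<close>.
\<close>

definition resolvent_op :: "real \<Rightarrow> ('a \<Rightarrow> ennreal) \<Rightarrow> 'a \<Rightarrow> ennreal" where
  "resolvent_op r f x = (\<integral>\<^sup>+s. killed s f x * (ennreal (exp (- r * s)) * indicator {0..} s) \<partial>lborel)"

lemma killed_kernel_measurable:
  assumes "f \<in> borel_measurable m"
  shows "(\<lambda>(x, s). killed s f x) \<in> borel_measurable (m \<Otimes>\<^sub>M lborel)"
proof -
  have [measurable]: "f \<in> borel_measurable BE" using assms by (simp add: measurable_m)
  have "(\<lambda>(x, s). killed s f x) \<in> borel_measurable (BE \<Otimes>\<^sub>M lborel)" by measurable
  then show ?thesis by (simp add: measurable_m_pair)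
qed

lemma pairing_kernel_measurable:
  assumes T: "(\<lambda>(x, s). T s x) \<in> borel_measurable (m \<Otimes>\<^sub>M (lborel :: real measure))" and u[measurable]: "u \<in> borel_measurable m"
  shows "(\<lambda>s. pairing m (T s) u) \<in> borel_measurable borel"
proof -
  have "(\<lambda>(s, x). T s x) \<in> borel_measurable (lborel \<Otimes>\<^sub>M m)"
    using measurable_compose[OF measurable_pair_swap' T] by (simp add: split_beta')
  then have [measurable]: "(\<lambda>p. T (fst p) (snd p)) \<in> borel_measurable (lborel \<Otimes>\<^sub>M m)" by (simp add: split_beta')
  have "(\<lambda>(s, x). T s x * ennreal (u x)) \<in> borel_measurable (lborel \<Otimes>\<^sub>M m)"
    by (simp add: split_beta')
  from borel_measurable_nn_integral[OF this] show ?thesis by simp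
qed

lemma positive_operator_resolvent_op: "positive_operator m (resolvent_op r)"
  unfolding resolvent_op_def[abs_def]
  by (intro positive_operator_integral operator_on_m positive_operator_killed killed_kernel_measurable) auto

lemma null_preserving_resolvent_op: "null_preserving (resolvent_op r)"
  unfolding resolvent_op_def[abs_def]
  by (rule null_preserving_integral[where A="{0..}"])
     (auto intro: null_preserving_killed killed_kernel_measurable)

lemma killed_mono: "f (flow t x) \<le> g (flow t x) \<Longrightarrow> killed t f x \<le> killed t g x"
  unfolding killed_def by (rule mult_left_mono) auto

lemma killed_1_le: "x \<in> E \<Longrightarrow> killed t (\<lambda>_. 1) x \<le> 1"
  using nn_integral_rate(2)[of x t] by (simp add: killed_def)

lemma resolvent_op_1_le:
  assumes r: "0 < r" and x: "x \<in> E"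
  shows "resolvent_op r (\<lambda>_. 1) x \<le> ennreal (1 / r)"
proof -
  have "resolvent_op r (\<lambda>_. 1) x \<le> (\<integral>\<^sup>+s. 1 * (ennreal (exp (- r * s)) * indicator {0..} s) \<partial>lborel)"
    unfolding resolvent_op_def using killed_1_le[OF x] by (intro nn_integral_mono mult_right_mono) auto
  then show ?thesis using nn_integral_exp_atLeast[OF r] by simp
qed

text \<open>
  \<open>u = R(r, A) v\<close> for \<open>v\<close> in the positive cone, in dual form. A relation is used in place of an operator
  because only the pairings of \<open>u\<close> with functions enter the arguments.
\<close>

definition resolvent_pair :: "real \<Rightarrow> ('a \<Rightarrow> real) \<Rightarrow> ('a \<Rightarrow> real) \<Rightarrow> bool" where
  "resolvent_pair r v u \<longleftrightarrow> 0 < r \<and> v \<in> L1_pos m \<and> u \<in> L1_pos m \<and>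
     (\<forall>f\<in>borel_measurable m. pairing m f u = pairing m (resolvent_op r f) v)"

text \<open>
  \<open>resolvent_op r\<close> has total mass at most \<open>1 / r\<close>, so \<open>r\<close> times it is sub-Markov and has a predual.
\<close>

lemma resolvent_exists:
  assumes r: "0 < r" and v: "v \<in> L1_pos m"
  shows "\<exists>u. resolvent_pair r v u"
proof -
  have r': "ennreal r * ennreal (1 / r) = 1" using r by (simp flip: ennreal_mult')
  have "sub_markov_operator m (\<lambda>f x. ennreal r * resolvent_op r f x)"
  proof (rule sub_markov_of_null_preserving)
    have "positive_operator m (\<lambda>f x. ennreal r * f x)"
      by unfold_locales (auto simp: distrib_left mult_ac SUP_mult_left_ennreal)
    from positive_operator_comp[OF this positive_operator_resolvent_op]
    show "positive_operator m (\<lambda>f x. ennreal r * resolvent_op r f x)" .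
    show "ennreal r * resolvent_op r (\<lambda>_. 1) x \<le> 1" if "x \<in> E" for x
      using mult_left_mono[OF resolvent_op_1_le[OF r that], of "ennreal r"] r' by simp
    show "null_preserving (\<lambda>f x. ennreal r * resolvent_op r f x)"
      using null_preserving_resolvent_op unfolding null_preserving_def by auto
  qed
  from sub_markov_operator.predual_pos_exists[OF this v] obtain q where q: "q \<in> L1_pos m"
    and pair: "\<And>f. f \<in> borel_measurable m \<Longrightarrow> pairing m f q = pairing m (\<lambda>x. ennreal r * resolvent_op r f x) v"
    by blast
  define u where "u x = (1 / r) * q x" for x
  have u: "u \<in> L1_pos m" using q r by (auto simp: L1_pos_def u_def[abs_def])
  have "pairing m f u = pairing m (resolvent_op r f) v" if f: "f \<in> borel_measurable m" for f
  proof -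
    note [measurable] = f positive_operator.meas[OF positive_operator_resolvent_op f] L1_posD(3)[OF v] L1_posD(3)[OF q]
    have "pairing m f u = (\<integral>\<^sup>+x. ennreal (1 / r) * (f x * ennreal (q x)) \<partial>m)"
    proof (intro nn_integral_cong)
      fix x
      have "ennreal (u x) = ennreal (1 / r) * ennreal (q x)" unfolding u_def using r by (intro ennreal_mult') auto
      then show "f x * ennreal (u x) = ennreal (1 / r) * (f x * ennreal (q x))" by (simp add: mult_ac)
    qed
    also have "\<dots> = ennreal (1 / r) * (\<integral>\<^sup>+x. ennreal r * (resolvent_op r f x * ennreal (v x)) \<partial>m)"
      using pair[OF f] by (simp add: nn_integral_cmult mult.assoc)
    also have "\<dots> = (ennreal r * ennreal (1 / r)) * pairing m (resolvent_op r f) v"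
      by (simp add: nn_integral_cmult mult_ac)
    finally show ?thesis by (simp add: r')
  qed
  then show ?thesis using u v r unfolding resolvent_pair_def by blast
qed

lemma resolvent_pairD:
  assumes "resolvent_pair r v u"
  shows "0 < r" "v \<in> L1_pos m" "u \<in> L1_pos m"
    "f \<in> borel_measurable m \<Longrightarrow> pairing m f u = pairing m (resolvent_op r f) v"
  using assms unfolding resolvent_pair_def by auto

lemma pairing_resolvent_op:
  assumes f: "f \<in> borel_measurable m" and v: "v \<in> L1_pos m"
  shows "pairing m (resolvent_op r f) v
    = (\<integral>\<^sup>+s. pairing m (killed s f) v * (ennreal (exp (- r * s)) * indicator {0..} s) \<partial>lborel)"
  unfolding resolvent_op_def[abs_def]
  by (rule pairing_integral[OF killed_kernel_measurable[OF f] L1_posD(3)[OF v]]) auto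

text \<open>
  Split the Laplace integral at time \<open>h\<close> and use the semigroup law of the killed flow in the second part. This
  identity carries both the computation of the generator of \<open>S\<close> and the control of the jump rate along
  \<open>S s u\<close> for small \<open>s\<close>.
\<close>

lemma resolvent_split:
  assumes uv: "resolvent_pair r v u" and h: "0 \<le> h" and f: "f \<in> borel_measurable m"
  shows "pairing m f u
    = (\<integral>\<^sup>+s. pairing m (killed s f) v * ennreal (exp (- r * s)) * indicator {0..h} s \<partial>lborel)
      + ennreal (exp (- r * h)) * pairing m f (S h u)"
proof -
  note r = resolvent_pairD(1)[OF uv] and v = resolvent_pairD(2)[OF uv] and u = resolvent_pairD(3)[OF uv]
  have fh: "killed h f \<in> borel_measurable m"
    by (rule positive_operator.meas[OF operator_on_m[OF positive_operator_killed] f])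
  define g where "g s = pairing m (killed s f) v" for s
  have g[measurable]: "g \<in> borel_measurable borel"
    unfolding g_def by (rule pairing_kernel_measurable[OF killed_kernel_measurable[OF f] L1_posD(3)[OF v]])
  have "pairing m f u = (\<integral>\<^sup>+s. g s * (ennreal (exp (- r * s)) * indicator {0..} s) \<partial>lborel)"
    unfolding resolvent_pairD(4)[OF uv f] pairing_resolvent_op[OF f v] g_def ..
  also have "\<dots> = (\<integral>\<^sup>+s. g s * ennreal (exp (- r * s)) * indicator {0..h} s
      + g s * ennreal (exp (- r * s)) * indicator {h..} s \<partial>lborel)"
    using AE_lborel_singleton[of h] h
    by (intro nn_integral_cong_AE) (auto elim!: eventually_mono simp: indicator_def)
  also have "\<dots> = (\<integral>\<^sup>+s. g s * ennreal (exp (- r * s)) * indicator {0..h} s \<partial>lborel)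
      + (\<integral>\<^sup>+s. g s * ennreal (exp (- r * s)) * indicator {h..} s \<partial>lborel)"
    by (rule nn_integral_add) auto
  also have "(\<integral>\<^sup>+s. g s * ennreal (exp (- r * s)) * indicator {h..} s \<partial>lborel)
      = (\<integral>\<^sup>+s. g (h + 1 * s) * ennreal (exp (- r * (h + 1 * s))) * indicator {h..} (h + 1 * s) \<partial>lborel)"
    by (subst nn_integral_real_affine[where c=1 and t=h]) auto
  also have "\<dots> = (\<integral>\<^sup>+s. ennreal (exp (- r * h)) *
      (pairing m (killed s (killed h f)) v * (ennreal (exp (- r * s)) * indicator {0..} s)) \<partial>lborel)"
  proof (intro nn_integral_cong)
    fix s :: real
    have "g (h + s) = pairing m (killed s (killed h f)) v" if "0 \<le> s"
      unfolding g_def using killed_add[of _ s h f] that h by (intro nn_integral_cong) (simp add: add.commute)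
    moreover have "ennreal (exp (- r * (h + s))) = ennreal (exp (- r * h)) * ennreal (exp (- r * s))"
      by (simp add: ennreal_mult'[symmetric] exp_add[symmetric] algebra_simps)
    ultimately show "g (h + 1 * s) * ennreal (exp (- r * (h + 1 * s))) * indicator {h..} (h + 1 * s)
      = ennreal (exp (- r * h)) *
      (pairing m (killed s (killed h f)) v * (ennreal (exp (- r * s)) * indicator {0..} s))"
      by (auto simp: indicator_def mult_ac)
  qed
  also have "\<dots> = ennreal (exp (- r * h)) * pairing m (resolvent_op r (killed h f)) v"
    unfolding pairing_resolvent_op[OF fh v]
    using pairing_kernel_measurable[OF killed_kernel_measurable[OF fh] L1_posD(3)[OF v]]
    by (intro nn_integral_cmult) auto
  also have "pairing m (resolvent_op r (killed h f)) v = pairing m f (S h u)"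
    unfolding pairing_S[OF h u f] resolvent_pairD(4)[OF uv fh] ..
  finally show ?thesis unfolding g_def .
qed

lemma abs_set_integral_diff_le:
  assumes e: "L1_norm m (\<lambda>x. a x - b x) \<le> e" and a: "integrable m a" and b: "integrable m b" and B: "B \<in> sets m"
  shows "\<bar>(LINT x:B|m. a x) - (LINT x:B|m. b x)\<bar> \<le> e"
proof -
  have "(LINT x:B|m. a x) - (LINT x:B|m. b x) = (LINT x:B|m. a x - b x)"
    using a b B by (intro set_integral_diff(2)[symmetric] set_integrable_subset_of_integrable)
  then show ?thesis using abs_set_integral_le_L1_norm[of m "\<lambda>x. a x - b x" B] a b B e by auto
qed

lemma pairing_killed_indicator:
  assumes s: "0 \<le> s" and v: "v \<in> L1_pos m" and B: "B \<in> sets m"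
  shows "pairing m (killed s (indicator B)) v = ennreal (LINT x:B|m. S s v x)"
  unfolding pairing_S[OF s v indicator_measurable(1)[OF B], symmetric]
  by (rule L1_pos_set_integral(1)[OF S.pos[OF s v] B, symmetric])

text \<open>
  Splitting the resolvent integral at \<open>h\<close> shows that \<open>u - exp (- r h) S h u\<close> is the integral over \<open>[0, h]\<close> of the
  discounted orbit of \<open>v\<close>; divided by \<open>h\<close> it tends to \<open>v\<close>. The difference quotient of \<open>S\<close> at \<open>u\<close> differs from
  this only by scalar factors.
\<close>

lemma generator_resolvent:
  assumes uv: "resolvent_pair r v u"
  shows "generator m S u (\<lambda>x. r * u x - v x)"
proof -
  note r = resolvent_pairD(1)[OF uv] and v = resolvent_pairD(2)[OF uv] and u = resolvent_pairD(3)[OF uv]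
  note iu = L1_posD(1)[OF u] and iv = L1_posD(1)[OF v]
  define y where "y h x = u x - exp (- r * h) * S h u x" for h x
  have y: "y h \<in> L1_pos m" and pair_y: "\<And>B. B \<in> sets m \<Longrightarrow> pairing m (indicator B) (y h)
      = (\<integral>\<^sup>+s. pairing m (killed s (indicator B)) v * ennreal (exp (- r * s)) * indicator {0..h} s \<partial>lborel)"
    if h: "0 < h" for h
  proof -
    have h0: "0 \<le> h" using h by simp
    note Su = S.pos[OF h0 u]
    note [measurable] = L1_posD(3)[OF Su]
    have e: "(\<lambda>x. exp (- r * h) * S h u x) \<in> L1_pos m" using Su by (auto simp: L1_pos_def)
    have "pairing m (indicator B) (\<lambda>x. exp (- r * h) * S h u x) = ennreal (exp (- r * h)) * pairing m (indicator B) (S h u)"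
      if "B \<in> sets m" for B
      using that by (subst nn_integral_cmult[symmetric]) (auto simp: ennreal_mult' intro!: nn_integral_cong mult.left_commute)
    then have "pairing m (indicator B) u = pairing m (indicator B) (\<lambda>x. exp (- r * h) * S h u x)
        + (\<integral>\<^sup>+s. pairing m (killed s (indicator B)) v * ennreal (exp (- r * s)) * indicator {0..h} s \<partial>lborel)"
      if "B \<in> sets m" for B
      using resolvent_split[OF uv h0 indicator_measurable(1)[OF that]] that by (simp add: add.commute)
    from L1_pos_difference[OF u e this] show "y h \<in> L1_pos m"
      "\<And>B. B \<in> sets m \<Longrightarrow> pairing m (indicator B) (y h)
      = (\<integral>\<^sup>+s. pairing m (killed s (indicator B)) v * ennreal (exp (- r * s)) * indicator {0..h} s \<partial>lborel)"
      unfolding y_def[abs_def] by auto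
  qed
  have lim: "((\<lambda>h. L1_norm m (\<lambda>x. y h x / h - v x)) \<longlongrightarrow> 0) (at_right 0)"
  proof (rule L1_average_tendsto[OF y v pair_y])
    fix e :: real assume e: "0 < e"
    then have e2: "0 < e / 2" by simp
    from S.small_time[OF iv e2] obtain d where d: "0 < d"
      "\<And>s. 0 \<le> s \<Longrightarrow> s \<le> d \<Longrightarrow> L1_norm m (\<lambda>x. S s v x - v x) \<le> e / 2" by blast
    have "((\<lambda>h. (1 - exp (- r * h)) * L1_norm m v) \<longlongrightarrow> 0 * L1_norm m v) (at_right 0)"
      by (intro tendsto_mult tendsto_const) real_asymp
    then have "\<forall>\<^sub>F h in at_right 0. (1 - exp (- r * h)) * L1_norm m v < e / 2"
      using e2 by (intro order_tendstoD) auto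
    moreover have "\<forall>\<^sub>F h in at_right 0. 0 < h \<and> h < d" using d(1) eventually_at_right_field by blast
    ultimately show "\<forall>\<^sub>F h in at_right 0. \<forall>B\<in>sets m. \<forall>s\<in>{0..h}.
        ennreal ((LINT x:B|m. v x) - e) \<le> pairing m (killed s (indicator B)) v * ennreal (exp (- r * s)) \<and>
        pairing m (killed s (indicator B)) v * ennreal (exp (- r * s)) \<le> ennreal ((LINT x:B|m. v x) + e)"
    proof eventually_elim
      case (elim h)
      have "ennreal ((LINT x:B|m. v x) - e) \<le> pairing m (killed s (indicator B)) v * ennreal (exp (- r * s))
          \<and> pairing m (killed s (indicator B)) v * ennreal (exp (- r * s)) \<le> ennreal ((LINT x:B|m. v x) + e)"
        if B: "B \<in> sets m" and s: "s \<in> {0..h}" for B s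
      proof -
        have s0: "0 \<le> s" using s by simp
        define q where "q = (LINT x:B|m. S s v x)"
        have q: "0 \<le> q" "q \<le> L1_norm m v"
          using L1_pos_set_integral(2)[OF S.pos[OF s0 v] B] S.abs_set_integral_orbit_le[OF s0 iv B]
          by (auto simp: q_def)
        have "\<bar>q - (LINT x:B|m. v x)\<bar> \<le> e / 2"
          unfolding q_def using s elim d(2)[of s] iv S.integrable[OF s0 iv] B
          by (intro abs_set_integral_diff_le) auto
        moreover have "q * exp (- r * s) \<le> q" using q r s0 by (intro mult_left_le) auto
        moreover have "q - e / 2 \<le> q * exp (- r * s)"
        proof -
          have "(1 - exp (- r * s)) * q \<le> (1 - exp (- r * h)) * L1_norm m v"
            using q r s by (intro mult_mono) auto
          then show ?thesis using elim by (simp add: algebra_simps)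
        qed
        ultimately have "(LINT x:B|m. v x) - e \<le> q * exp (- r * s)" "q * exp (- r * s) \<le> (LINT x:B|m. v x) + e"
          using e by linarith+
        then show ?thesis
          unfolding pairing_killed_indicator[OF s0 v B] q_def[symmetric] ennreal_mult'[OF q(1), symmetric]
          by (auto intro: ennreal_leI)
      qed
      then show ?case by blast
    qed
  qed
  define c where "c h = \<bar>(exp (r * h) - 1) / h - r\<bar> * L1_norm m u
      + (exp (r * h) * L1_norm m (\<lambda>x. y h x / h - v x) + (exp (r * h) - 1) * L1_norm m v)" for h
  have "((\<lambda>h. L1_norm m (\<lambda>x. (S h u x - u x) / h - (r * u x - v x))) \<longlongrightarrow> 0) (at_right 0)"
  proof (rule Lim_null_comparison)
    have "(c \<longlongrightarrow> \<bar>r - r\<bar> * L1_norm m u + (1 * 0 + 0 * L1_norm m v)) (at_right 0)"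
      unfolding c_def
    proof (intro tendsto_add tendsto_mult tendsto_rabs tendsto_diff tendsto_const lim)
      show "((\<lambda>h. (exp (r * h) - 1) / h) \<longlongrightarrow> r) (at_right 0)" by real_asymp
      show "((\<lambda>h. exp (r * h) - 1) \<longlongrightarrow> 0) (at_right 0)" by real_asymp
      show "((\<lambda>h. exp (r * h)) \<longlongrightarrow> 1) (at_right 0)" by real_asymp
    qed
    then show "(c \<longlongrightarrow> 0) (at_right 0)" by simp
    have "\<forall>\<^sub>F h in at_right (0::real). 0 < h" by (simp add: eventually_at_right_less)
    then show "\<forall>\<^sub>F h in at_right 0. norm (L1_norm m (\<lambda>x. (S h u x - u x) / h - (r * u x - v x))) \<le> c h"
    proof eventually_elim
      case (elim h)
      let ?w = "\<lambda>x. exp (r * h) * (y h x / h - v x) + (exp (r * h) - 1) * v x"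
      note iy = L1_posD(1)[OF y[OF elim]]
      have "(S h u x - u x) / h - (r * u x - v x) = ((exp (r * h) - 1) / h - r) * u x - ?w x" for x
      proof -
        have "exp (r * h) * y h x = exp (r * h) * u x - S h u x"
          by (simp add: y_def right_diff_distrib mult.assoc[symmetric] flip: exp_add)
        then have "exp (r * h) * (y h x / h) = (exp (r * h) * u x - S h u x) / h" by simp
        then show ?thesis by (simp add: right_diff_distrib left_diff_distrib diff_divide_distrib)
      qed
      then have "L1_norm m (\<lambda>x. (S h u x - u x) / h - (r * u x - v x))
          = L1_norm m (\<lambda>x. ((exp (r * h) - 1) / h - r) * u x - ?w x)" by simp
      also have "\<dots> \<le> L1_norm m (\<lambda>x. ((exp (r * h) - 1) / h - r) * u x) + L1_norm m ?w"
        using iu iv iy by (intro L1_norm_diff_le) auto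
      also have "L1_norm m ?w \<le> L1_norm m (\<lambda>x. exp (r * h) * (y h x / h - v x)) + L1_norm m (\<lambda>x. (exp (r * h) - 1) * v x)"
        using iv iy by (intro L1_norm_add_le) auto
      finally show ?case
        using r elim unfolding L1_norm_cmult c_def by (simp add: L1_norm_nonneg)
    qed
  qed
  then show ?thesis unfolding generator_def using iu iv by auto
qed

section \<open>The generator of the semigroup killed at explosion\<close>

lemma rate_integrable_of_generator:
  assumes "generator m S u w"
  shows "integrable m (\<lambda>x. \<phi> x * u x)"
proof (rule integrableI_bounded)
  have w: "u \<in> L1_weighted m \<phi>"
    using S_killed assms unfolding killed_flow_semigroup_def generator_dom_def by blast
  have [measurable]: "\<phi> \<in> borel_measurable m"
    using rate_measurable by (simp add: measurable_cong_sets[OF sets_m refl])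
  show "(\<lambda>x. \<phi> x * u x) \<in> borel_measurable m" using w by (auto simp: L1_weighted_def)
  have "(\<integral>\<^sup>+x. ennreal (norm (\<phi> x * u x)) \<partial>m) = (\<integral>\<^sup>+x. ennreal (\<phi> x * \<bar>u x\<bar>) \<partial>m)"
    using rate_nonneg by (intro nn_integral_cong) (simp add: abs_mult)
  then show "(\<integral>\<^sup>+x. ennreal (norm (\<phi> x * u x)) \<partial>m) < \<infinity>" using w by (simp add: L1_weighted_def)
qed

text \<open>
  For \<open>u = R(r, A) v\<close> the function \<open>P (\<phi> u)\<close> is the flux of mass brought back by jumps. The last equation is the
  mass balance: the mass of \<open>v\<close> is either killed at rate \<open>r\<close> or jumps, by the assumption on the integral of \<open>A u\<close>.
\<close>

lemma inflow_pos:
  assumes uv: "resolvent_pair r v u"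
  shows "(\<lambda>x. \<phi> x * u x) \<in> L1_pos m" "P (\<lambda>x. \<phi> x * u x) \<in> L1_pos m"
    and "\<And>f. f \<in> borel_measurable m \<Longrightarrow> pairing m (rate_jump f) u = pairing m f (P (\<lambda>x. \<phi> x * u x))"
    and "L1_norm m v = r * L1_norm m u + L1_norm m (P (\<lambda>x. \<phi> x * u x))"
proof -
  note r = resolvent_pairD(1)[OF uv] and v = resolvent_pairD(2)[OF uv] and u = resolvent_pairD(3)[OF uv]
  note gen = generator_resolvent[OF uv]
  have "AE x in m. 0 \<le> \<phi> x * u x"
    using L1_posD(2)[OF u] AE_space by eventually_elim (simp add: rate_nonneg)
  then show fu: "(\<lambda>x. \<phi> x * u x) \<in> L1_pos m"
    using rate_integrable_of_generator[OF gen] by (simp add: L1_pos_def)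
  then show p: "P (\<lambda>x. \<phi> x * u x) \<in> L1_pos m" using P_pos_pairing by blast
  show pair: "pairing m (rate_jump f) u = pairing m f (P (\<lambda>x. \<phi> x * u x))" if f: "f \<in> borel_measurable m" for f
  proof -
    have "pairing m (rate_jump f) u = pairing m (jump f) (\<lambda>x. \<phi> x * u x)"
      using rate_nonneg by (intro nn_integral_cong) (simp add: rate_jump_def ennreal_mult' mult_ac)
    then show ?thesis unfolding pairing_P[OF fu f] .
  qed
  have one: "(\<lambda>_. 1 :: ennreal) \<in> borel_measurable m" by simp
  have "ennreal (L1_norm m (P (\<lambda>x. \<phi> x * u x))) = ennreal (L1_norm m (\<lambda>x. \<phi> x * u x))"
    unfolding L1_pos_norm(2)[OF p] L1_pos_norm(2)[OF fu] pairing_P[OF fu one]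
    by (intro nn_integral_cong) (simp add: prob_space.emeasure_space_1[OF J_prob])
  then have "L1_norm m (P (\<lambda>x. \<phi> x * u x)) = (LINT x|m. \<phi> x * u x)"
    unfolding L1_pos_norm(1)[OF fu, symmetric] by (subst (asm) ennreal_inj) (auto intro: L1_norm_nonneg)
  moreover have "(LINT x|m. r * u x - v x) = - (LINT x|m. \<phi> x * u x)"
    using S_killed gen u unfolding killed_flow_semigroup_def by blast
  moreover have "(LINT x|m. r * u x - v x) = r * L1_norm m u - L1_norm m v"
    using L1_posD(1)[OF u] L1_posD(1)[OF v] by (simp add: L1_pos_norm(1)[OF u] L1_pos_norm(1)[OF v])
  ultimately show "L1_norm m v = r * L1_norm m u + L1_norm m (P (\<lambda>x. \<phi> x * u x))" by simp
qed

text \<open>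
  The mass that jumps up to time \<open>s\<close> is the mass that \<open>S s\<close> has lost, and this is at most the distance of
  \<open>S s v\<close> from \<open>v\<close>. It bounds the jump rate along the flow although \<open>\<phi>\<close> itself may be unbounded.
\<close>

lemma killed_rate_mass:
  assumes v: "v \<in> L1_pos m" and s: "0 \<le> s" and r: "0 < r" and e: "L1_norm m (\<lambda>x. S s v x - v x) \<le> e"
    and f: "f \<in> borel_measurable m" "\<And>x. x \<in> E \<Longrightarrow> f x \<le> ennreal (\<phi> x)"
  shows "(\<integral>\<^sup>+t. pairing m (killed t f) v * ennreal (exp (- r * t)) * indicator {0..s} t \<partial>lborel) \<le> ennreal e"
proof -
  have \<phi>m: "(\<lambda>x. ennreal (\<phi> x)) \<in> borel_measurable m"
    using rate_measurable by (simp add: measurable_cong_sets[OF sets_m refl])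
  have 1: "(\<lambda>_. 1::ennreal) \<in> borel_measurable m" by simp
  have "(\<integral>\<^sup>+t. pairing m (killed t f) v * ennreal (exp (- r * t)) * indicator {0..s} t \<partial>lborel)
      \<le> (\<integral>\<^sup>+t. pairing m (killed t (\<lambda>x. ennreal (\<phi> x))) v * indicator {0..s} t \<partial>lborel)"
  proof (intro nn_integral_mono)
    fix t :: real
    have "pairing m (killed t f) v * ennreal (exp (- r * t)) \<le> pairing m (killed t (\<lambda>x. ennreal (\<phi> x))) v * 1" if "0 \<le> t"
      using f(2) r that by (intro mult_mono pairing_mono killed_mono) auto
    then show "pairing m (killed t f) v * ennreal (exp (- r * t)) * indicator {0..s} t
        \<le> pairing m (killed t (\<lambda>x. ennreal (\<phi> x))) v * indicator {0..s} t"
      by (auto simp: indicator_def)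
  qed
  also have "\<dots> = pairing m (\<lambda>x. \<integral>\<^sup>+t. killed t (\<lambda>x. ennreal (\<phi> x)) x * indicator {0..s} t \<partial>lborel) v"
    by (rule pairing_integral[symmetric, OF killed_kernel_measurable[OF \<phi>m] L1_posD(3)[OF v]]) auto
  finally have le: "(\<integral>\<^sup>+t. pairing m (killed t f) v * ennreal (exp (- r * t)) * indicator {0..s} t \<partial>lborel)
      \<le> pairing m (\<lambda>x. \<integral>\<^sup>+t. killed t (\<lambda>x. ennreal (\<phi> x)) x * indicator {0..s} t \<partial>lborel) v" (is "?I \<le> ?M") .
  have k1: "killed s (\<lambda>_. 1) \<in> borel_measurable m"
    by (rule positive_operator.meas[OF operator_on_m[OF positive_operator_killed]]) simp
  have "ennreal (L1_norm m (S s v)) + ?M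
      = pairing m (\<lambda>x. killed s (\<lambda>_. 1) x + (\<integral>\<^sup>+t. killed t (\<lambda>x. ennreal (\<phi> x)) x * indicator {0..s} t \<partial>lborel)) v"
    unfolding L1_pos_norm(2)[OF S.pos[OF s v]] pairing_S[OF s v 1]
  proof (rule pairing_add[symmetric, OF k1 _ L1_posD(3)[OF v]])
    note [measurable] = killed_kernel_measurable[OF \<phi>m]
    show "(\<lambda>x. \<integral>\<^sup>+t. killed t (\<lambda>x. ennreal (\<phi> x)) x * indicator {0..s} t \<partial>lborel) \<in> borel_measurable m"
      by (rule lborel.borel_measurable_nn_integral) measurable
  qed
  also have "\<dots> = pairing m (\<lambda>_. 1) v"
    using rate_head[OF _ s] by (intro nn_integral_cong) (simp add: killed_def)
  finally have sum: "ennreal (L1_norm m (S s v)) + ?M = ennreal (L1_norm m v)"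
    unfolding L1_pos_norm(2)[OF v] .
  have "?M \<le> ennreal (L1_norm m v)" unfolding sum[symmetric] by simp
  then have "?M < \<infinity>" by (rule le_less_trans) simp
  then obtain M where M: "?M = ennreal M" "0 \<le> M" by (cases ?M) auto
  have "L1_norm m (S s v) + M = L1_norm m v"
    using sum unfolding M(1) using M(2) L1_norm_nonneg[of m]
    by (simp add: ennreal_plus[symmetric] del: ennreal_plus)
  moreover have "L1_norm m v - L1_norm m (S s v) \<le> e"
  proof -
    note i = L1_posD(1)[OF v] L1_posD(1)[OF S.pos[OF s v]]
    have "L1_norm m v - L1_norm m (S s v) = (LINT x|m. v x - S s v x)"
      using i by (simp add: L1_pos_norm(1) v S.pos[OF s v])
    also have "\<dots> \<le> L1_norm m (\<lambda>x. S s v x - v x)"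
      unfolding L1_norm_def using i by (intro integral_mono) auto
    finally show ?thesis using e by simp
  qed
  ultimately have "ennreal M \<le> ennreal e" by (intro ennreal_leI) linarith
  with le show ?thesis unfolding M(1) by (rule order_trans)
qed

lemma Q_minus_S:
  assumes h: "0 \<le> h" and u: "u \<in> L1_pos m" and B: "B \<in> sets m"
  shows "pairing m (indicator B) (Q h u) = pairing m (indicator B) (S h u)
    + (\<integral>\<^sup>+s. pairing m (rate_jump (min_op (h - s) (indicator B))) (S s u) * indicator {0..h} s \<partial>lborel)"
proof -
  note f = indicator_measurable[OF B]
  have kf: "killed h (indicator B) \<in> borel_measurable m"
    by (rule positive_operator.meas[OF operator_on_m[OF positive_operator_killed] f(1)])
  have km: "(\<lambda>(x, s). killed s (rate_jump (min_op (h - s) (indicator B))) x) \<in> borel_measurable (m \<Otimes>\<^sub>M lborel)"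
    using first_jump_integrand_measurable[OF min_op_joint_measurable[OF f(2)], of "\<lambda>z. h - snd z" "BE \<Otimes>\<^sub>M lborel" snd fst]
    by (simp add: split_beta' measurable_m_pair)
  have fj: "first_jump (\<lambda>s. min_op s (indicator B)) h \<in> borel_measurable m"
    unfolding measurable_m by (rule first_jump_measurable[OF min_op_joint_measurable[OF f(2)]]) auto
  have "pairing m (indicator B) (Q h u)
      = pairing m (\<lambda>x. killed h (indicator B) x + first_jump (\<lambda>s. min_op s (indicator B)) h x) u"
    unfolding pairing_Q[OF h u f(1)] using min_op_eq[OF f(2)] by (intro nn_integral_cong) simp
  also have "\<dots> = pairing m (killed h (indicator B)) u + pairing m (first_jump (\<lambda>s. min_op s (indicator B)) h) u"
    by (rule pairing_add[OF kf fj L1_posD(3)[OF u]])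
  also have "pairing m (first_jump (\<lambda>s. min_op s (indicator B)) h) u
      = (\<integral>\<^sup>+s. pairing m (killed s (rate_jump (min_op (h - s) (indicator B)))) u * indicator {0..h} s \<partial>lborel)"
    unfolding first_jump_def[abs_def] by (rule pairing_integral[OF km L1_posD(3)[OF u]]) auto
  also have "\<dots> = (\<integral>\<^sup>+s. pairing m (rate_jump (min_op (h - s) (indicator B))) (S s u) * indicator {0..h} s \<partial>lborel)"
  proof (intro nn_integral_cong)
    fix s :: real
    have "rate_jump (min_op (h - s) (indicator B)) \<in> borel_measurable m"
      by (intro positive_operator.meas[OF operator_on_m[OF positive_operator_rate_jump]]
          positive_operator.meas[OF operator_on_m[OF positive_operator_min_op]] f(1))
    then show "pairing m (killed s (rate_jump (min_op (h - s) (indicator B)))) u * indicator {0..h} s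
        = pairing m (rate_jump (min_op (h - s) (indicator B))) (S s u) * indicator {0..h} s"
      using pairing_S[OF _ u] by (auto simp: indicator_def)
  qed
  finally show ?thesis unfolding pairing_S[OF h u f(1)] .
qed

text \<open>
  \<open>Q h u - S h u\<close> is the integral over \<open>s\<close> in \<open>[0, h]\<close> of the mass that jumps for the first time at \<open>s\<close> and then
  evolves up to \<open>h\<close>. The point is that the integrand tends to \<open>P (\<phi> u)\<close> in the mean although \<open>u \<mapsto> \<phi> u\<close> is
  unbounded. This needs \<open>u\<close> to be a resolvent: replacing \<open>S s u\<close> by \<open>u\<close> then costs, up to
  a discount factor close to \<open>1\<close>, at most the jump mass of \<open>v\<close> up to time \<open>s\<close>, which is small.
\<close>

lemma generator_Q_resolvent:
  assumes uv: "resolvent_pair r v u"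
  shows "generator m Q u (\<lambda>x. (r * u x - v x) + P (\<lambda>y. \<phi> y * u y) x)"
proof -
  note r = resolvent_pairD(1)[OF uv] and v = resolvent_pairD(2)[OF uv] and u = resolvent_pairD(3)[OF uv]
  note iu = L1_posD(1)[OF u] and iv = L1_posD(1)[OF v]
  define p where "p = P (\<lambda>y. \<phi> y * u y)"
  note p = inflow_pos(2)[OF uv, folded p_def] and pair_p = inflow_pos(3)[OF uv, folded p_def]
  note ip = L1_posD(1)[OF p]
  let ?f = "\<lambda>h B s. rate_jump (min_op (h - s) (indicator B))"
  have D: "(\<lambda>x. Q h u x - S h u x) \<in> L1_pos m" and pair_D: "\<And>B. B \<in> sets m \<Longrightarrow>
      pairing m (indicator B) (\<lambda>x. Q h u x - S h u x)
      = (\<integral>\<^sup>+s. pairing m (?f h B s) (S s u) * indicator {0..h} s \<partial>lborel)" if h: "0 < h" for h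
  proof -
    have h0: "0 \<le> h" using h by simp
    show "(\<lambda>x. Q h u x - S h u x) \<in> L1_pos m" "\<And>B. B \<in> sets m \<Longrightarrow>
      pairing m (indicator B) (\<lambda>x. Q h u x - S h u x)
      = (\<integral>\<^sup>+s. pairing m (?f h B s) (S s u) * indicator {0..h} s \<partial>lborel)"
      using L1_pos_difference[OF Q_pos[OF h0 u] S.pos[OF h0 u] Q_minus_S[OF h0 u]] by auto
  qed
  have lim: "((\<lambda>h. L1_norm m (\<lambda>x. (Q h u x - S h u x) / h - p x)) \<longlongrightarrow> 0) (at_right 0)"
  proof (rule L1_average_tendsto[OF D p pair_D])
    fix e :: real assume e: "0 < e"
    then have e2: "0 < e / 2" by simp
    from S.small_time[OF iv e2] obtain d where d: "0 < d"
      "\<And>s. 0 \<le> s \<Longrightarrow> s \<le> d \<Longrightarrow> L1_norm m (\<lambda>x. S s v x - v x) \<le> e / 2" by blast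
    from Q.small_time[OF ip e2] obtain d' where d': "0 < d'"
      "\<And>s. 0 \<le> s \<Longrightarrow> s \<le> d' \<Longrightarrow> L1_norm m (\<lambda>x. Q s p x - p x) \<le> e / 2" by blast
    have "((\<lambda>h. (exp (r * h) - 1) * L1_norm m p) \<longlongrightarrow> 0 * L1_norm m p) (at_right 0)"
      by (intro tendsto_mult tendsto_const) real_asymp
    then have "\<forall>\<^sub>F h in at_right 0. (exp (r * h) - 1) * L1_norm m p < e / 2"
      using e2 by (intro order_tendstoD) auto
    moreover have "\<forall>\<^sub>F h in at_right 0. 0 < h \<and> h < min d d'"
      using d(1) d'(1) eventually_at_right_field[of "\<lambda>h. 0 < h \<and> h < min d d'" 0] by (auto intro!: exI[of _ "min d d'"])
    ultimately show "\<forall>\<^sub>F h in at_right 0. \<forall>B\<in>sets m. \<forall>s\<in>{0..h}.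
        ennreal ((LINT x:B|m. p x) - e) \<le> pairing m (?f h B s) (S s u) \<and>
        pairing m (?f h B s) (S s u) \<le> ennreal ((LINT x:B|m. p x) + e)"
    proof eventually_elim
      case (elim h)
      have "ennreal ((LINT x:B|m. p x) - e) \<le> pairing m (?f h B s) (S s u)
          \<and> pairing m (?f h B s) (S s u) \<le> ennreal ((LINT x:B|m. p x) + e)"
        if B: "B \<in> sets m" and s: "s \<in> {0..h}" for B s
      proof -
        have s0: "0 \<le> s" "0 \<le> h - s" "s \<le> d" "h - s \<le> d'" using s elim by auto
        have g: "min_op (h - s) (indicator B) \<in> borel_measurable m"
          by (intro positive_operator.meas[OF operator_on_m[OF positive_operator_min_op]] indicator_measurable(1)[OF B])
        have f: "?f h B s \<in> borel_measurable m"
          by (rule positive_operator.meas[OF operator_on_m[OF positive_operator_rate_jump] g])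
        have fle: "?f h B s x \<le> ennreal (\<phi> x)" if x: "x \<in> E" for x
        proof -
          have "?f h B s x \<le> rate_jump (\<lambda>_. 1) x"
            using sub_markov_operator.op_indicator_le_1[OF sub_markov_min_op[OF s0(2)] _ B]
            by (intro rate_jump_mono x) simp
          then show ?thesis by (simp add: rate_jump_const x)
        qed
        define q where "q = (LINT x:B|m. Q (h - s) p x)"
        have q: "0 \<le> q" "q \<le> L1_norm m p"
          using L1_pos_set_integral(2)[OF Q_pos[OF s0(2) p] B] Q.abs_set_integral_orbit_le[OF s0(2) ip B]
          by (auto simp: q_def)
        have qb: "\<bar>q - (LINT x:B|m. p x)\<bar> \<le> e / 2"
          unfolding q_def using d'(2)[OF s0(2,4)] ip Q.integrable[OF s0(2) ip] B
          by (intro abs_set_integral_diff_le) auto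
        \<comment> \<open>up to the discount factor, \<open>c\<close> is the error made when \<open>S s u\<close> is replaced by the resolvent \<open>u\<close>\<close>
        let ?c = "\<integral>\<^sup>+t. pairing m (killed t (?f h B s)) v * ennreal (exp (- r * t)) * indicator {0..s} t \<partial>lborel"
        have ce: "?c \<le> ennreal (e / 2)"
          by (rule killed_rate_mass[OF v s0(1) r d(2)[OF s0(1,3)] f fle])
        have "?c < \<infinity>" using ce by (rule le_less_trans) simp
        then obtain c where c: "?c = ennreal c" "0 \<le> c" by (cases ?c) auto
        have c': "c \<le> e / 2" using ce c e by (simp add: ennreal_le_iff)
        have "pairing m (?f h B s) u = ennreal q"
          unfolding pair_p[OF g] pairing_Q[OF s0(2) p indicator_measurable(1)[OF B], symmetric] q_def
          by (rule L1_pos_set_integral(1)[OF Q_pos[OF s0(2) p] B, symmetric])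
        then have split: "ennreal q = ennreal c + ennreal (exp (- r * s)) * pairing m (?f h B s) (S s u)"
          using resolvent_split[OF uv s0(1) f] c(1) by simp
        have "ennreal (exp (- r * s)) * pairing m (?f h B s) (S s u) \<le> ennreal q"
          unfolding split by simp
        then have "ennreal (exp (- r * s)) * pairing m (?f h B s) (S s u) < \<infinity>" by (rule le_less_trans) simp
        then have "pairing m (?f h B s) (S s u) < \<infinity>"
          by (auto simp: ennreal_mult_less_top less_top[symmetric])
        then obtain i where i: "pairing m (?f h B s) (S s u) = ennreal i" "0 \<le> i"
          by (cases "pairing m (?f h B s) (S s u)") auto
        have "ennreal q = ennreal (c + exp (- r * s) * i)"
          using split c(2) i by (simp add: ennreal_mult'[symmetric] ennreal_plus[symmetric] del: ennreal_plus)
        then have q_eq: "q = c + exp (- r * s) * i"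
          by (subst (asm) ennreal_inj) (use c i q in auto)
        have "exp (- r * s) * i \<le> 1 * i" using r s0 i by (intro mult_right_mono) auto
        then have 1: "(LINT x:B|m. p x) - e \<le> i" using q_eq qb c' by linarith
        have "i = exp (r * s) * (exp (- r * s) * i)" by (simp add: mult.assoc[symmetric] flip: exp_add)
        also have "\<dots> \<le> exp (r * s) * q" using q_eq c by (intro mult_left_mono) auto
        also have "\<dots> \<le> exp (r * h) * q" using r s q by (intro mult_right_mono) auto
        also have "\<dots> = q + (exp (r * h) - 1) * q" by (simp add: algebra_simps)
        also have "(exp (r * h) - 1) * q \<le> (exp (r * h) - 1) * L1_norm m p"
          using q r elim by (intro mult_left_mono) auto
        finally have "i \<le> (LINT x:B|m. p x) + e" using elim qb by linarith
        then show ?thesis unfolding i using 1 by (auto intro: ennreal_leI)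
      qed
      then show ?case by blast
    qed
  qed
  have limS: "((\<lambda>h. L1_norm m (\<lambda>x. (S h u x - u x) / h - (r * u x - v x))) \<longlongrightarrow> 0) (at_right 0)"
    using generator_resolvent[OF uv] unfolding generator_def by blast
  have "((\<lambda>h. L1_norm m (\<lambda>x. (Q h u x - u x) / h - ((r * u x - v x) + p x))) \<longlongrightarrow> 0) (at_right 0)"
  proof (rule Lim_null_comparison[OF _ tendsto_add_zero[OF lim limS]])
    have "\<forall>\<^sub>F h in at_right (0::real). 0 < h" by (simp add: eventually_at_right_less)
    then show "\<forall>\<^sub>F h in at_right 0. norm (L1_norm m (\<lambda>x. (Q h u x - u x) / h - ((r * u x - v x) + p x)))
        \<le> L1_norm m (\<lambda>x. (Q h u x - S h u x) / h - p x) + L1_norm m (\<lambda>x. (S h u x - u x) / h - (r * u x - v x))"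
    proof eventually_elim
      case (elim h)
      then have h: "0 \<le> h" by simp
      have "L1_norm m (\<lambda>x. (Q h u x - u x) / h - ((r * u x - v x) + p x))
        = L1_norm m (\<lambda>x. ((Q h u x - S h u x) / h - p x) + ((S h u x - u x) / h - (r * u x - v x)))"
        by (simp add: diff_divide_distrib algebra_simps)
      also have "\<dots> \<le> L1_norm m (\<lambda>x. (Q h u x - S h u x) / h - p x) + L1_norm m (\<lambda>x. (S h u x - u x) / h - (r * u x - v x))"
        using Q.integrable[OF h iu] S.integrable[OF h iu] iu iv ip by (intro L1_norm_add_le) auto
      finally show ?case by (simp add: L1_norm_nonneg)
    qed
  qed
  then show ?thesis unfolding generator_def p_def[symmetric] using iu iv ip by auto
qed

lemma laplace_resolvent:
  assumes uv: "resolvent_pair r v u" and B: "B \<in> sets m"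
  shows "laplace r (\<lambda>t. LINT x:B|m. S t v x) = (LINT x:B|m. u x)"
  using S.laplace_generator[OF generator_resolvent[OF uv] resolvent_pairD(1)[OF uv] B] by simp

text \<open>
  An element of the domain need not have its positive part in the domain. Instead, \<open>u - A u\<close> is decomposed into
  its positive and negative parts and the resolvent is applied to both; that this recovers \<open>u\<close> is the uniqueness
  of Laplace transforms.
\<close>

lemma generator_domain_decomposition:
  assumes gen: "generator m S u w"
  obtains v1 u1 v2 u2 where "resolvent_pair 1 v1 u1" "resolvent_pair 1 v2 u2"
    "AE x in m. u x = u1 x - u2 x" "\<And>x. w x = (u x - (v1 x - v2 x))"
proof -
  have u: "integrable m u" and w: "integrable m w" using gen unfolding generator_def by auto
  define v where "v x = u x - w x" for x
  have v: "integrable m v" using u w by (auto simp: v_def[abs_def])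
  obtain v1 v2 where vp: "v1 \<in> L1_pos m" "v2 \<in> L1_pos m" and v_parts: "v = (\<lambda>x. v1 x - v2 x)"
    by (rule L1_parts[OF v])
  note vi = L1_posD(1)[OF vp(1)] L1_posD(1)[OF vp(2)]
  have v_eq: "v x = 1 * v1 x + (- 1) * v2 x" for x by (simp add: v_parts)
  obtain u1 where r1: "resolvent_pair 1 v1 u1" using resolvent_exists[OF _ vp(1)] by force
  obtain u2 where r2: "resolvent_pair 1 v2 u2" using resolvent_exists[OF _ vp(2)] by force
  note ui = L1_posD(1)[OF resolvent_pairD(3)[OF r1]] L1_posD(1)[OF resolvent_pairD(3)[OF r2]]
  have "AE x in m. u x = u1 x - u2 x"
  proof (rule density_unique_real)
    fix B assume B: "B \<in> sets m"
    have "(LINT x:B|m. u x) = laplace 1 (\<lambda>t. LINT x:B|m. S t v x)"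
      using S.laplace_generator[OF gen _ B, of 1] by (simp add: v_def[abs_def])
    also have "\<dots> = laplace 1 (\<lambda>t. 1 * (LINT x:B|m. S t v1 x) + (- 1) * (LINT x:B|m. S t v2 x))"
      unfolding laplace_def set_lebesgue_integral_def[of lborel]
    proof (intro Bochner_Integration.integral_cong refl)
      fix t :: real
      have "v = (\<lambda>x. 1 * v1 x + (- 1) * v2 x)" using v_eq by (rule ext)
      then show "indicator {0..} t *\<^sub>R (exp (- 1 * t) * (LINT x:B|m. S t v x))
        = indicator {0..} t *\<^sub>R (exp (- 1 * t) * (1 * (LINT x:B|m. S t v1 x) + (- 1) * (LINT x:B|m. S t v2 x)))"
        using S.set_integral_lincomb[OF _ vi B, of t 1 "- 1"] by (auto simp: indicator_def)
    qed
    also have "\<dots> = 1 * laplace 1 (\<lambda>t. LINT x:B|m. S t v1 x) + (- 1) * laplace 1 (\<lambda>t. LINT x:B|m. S t v2 x)"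
      by (rule laplace_lincomb[OF S.continuous_set_integral[OF vi(1) B] S.abs_set_integral_orbit_le[OF _ vi(1) B]
            S.continuous_set_integral[OF vi(2) B] S.abs_set_integral_orbit_le[OF _ vi(2) B]]) auto
    also have "\<dots> = (LINT x:B|m. u1 x) - (LINT x:B|m. u2 x)"
      unfolding laplace_resolvent[OF r1 B] laplace_resolvent[OF r2 B] by simp
    also have "\<dots> = (LINT x:B|m. u1 x - u2 x)"
      using ui B by (intro set_integral_diff(2)[symmetric] set_integrable_subset_of_integrable)
    finally show "(LINT x:B|m. u x) = (LINT x:B|m. u1 x - u2 x)" .
  qed (use u ui in auto)
  moreover have "w x = u x - (v1 x - v2 x)" for x using v_eq[of x] by (simp add: v_def)
  ultimately show thesis using that[OF r1 r2] by blast
qed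

lemma Q_extends: "extends_perturbed_generator m \<phi> P S Q"
  unfolding extends_perturbed_generator_def
proof (intro allI impI)
  fix u w assume gen: "generator m S u w"
  have u: "integrable m u" and w: "integrable m w" using gen unfolding generator_def by auto
  obtain v1 u1 v2 u2 where r1: "resolvent_pair 1 v1 u1" and r2: "resolvent_pair 1 v2 u2"
    and u_eq: "AE x in m. u x = u1 x - u2 x" and w_eq: "\<And>x. w x = (u x - (v1 x - v2 x))"
    by (rule generator_domain_decomposition[OF gen]) blast
  let ?p = "\<lambda>u. P (\<lambda>y. \<phi> y * u y)"
  have fi: "integrable m (\<lambda>y. \<phi> y * u y)" "integrable m (\<lambda>y. \<phi> y * u1 y)" "integrable m (\<lambda>y. \<phi> y * u2 y)"
    using rate_integrable_of_generator[OF gen] rate_integrable_of_generator[OF generator_resolvent[OF r1]]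
      rate_integrable_of_generator[OF generator_resolvent[OF r2]] by auto
  have "AE y in m. \<phi> y * u y = \<phi> y * u1 y - \<phi> y * u2 y"
    using u_eq by eventually_elim (simp add: right_diff_distrib)
  from L1_linearD(2)[OF P_linear fi(1) _ this] L1_linear_diff[OF P_linear fi(2,3)]
  have "AE x in m. ?p u x = ?p u1 x - ?p u2 x" using fi by (auto elim: AE_mp)
  then have "AE x in m. w x + ?p u x = ((1 * u1 x - v1 x) + ?p u1 x) - ((1 * u2 x - v2 x) + ?p u2 x)"
    using u_eq by eventually_elim (simp add: w_eq)
  moreover have "integrable m (\<lambda>x. w x + ?p u x)" using w L1_linearD(1)[OF P_linear fi(1)] by auto
  ultimately show "generator m Q u (\<lambda>x. w x + ?p u x)"
    by (intro Q.generator_diff_AE[OF generator_Q_resolvent[OF r1] generator_Q_resolvent[OF r2] u u_eq])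
qed

end

section \<open>The jump chain\<close>

lemma post_jump_cong:
  assumes "\<And>k. k \<in> {1..n} \<Longrightarrow> \<epsilon> k \<omega> = \<epsilon>' k \<omega>' \<and> \<theta> k \<omega> = \<theta>' k \<omega>'"
  shows "post_jump \<pi> \<phi> \<kappa> \<epsilon> \<theta> x n \<omega> = post_jump \<pi> \<phi> \<kappa> \<epsilon>' \<theta>' x n \<omega>'"
  using assms by (induction n) (auto simp: Let_def)

lemma jump_time_0: "jump_time \<pi> \<phi> \<kappa> \<epsilon> \<theta> x 0 \<omega> = 0"
  by (simp add: jump_time_def)

lemma jump_time_Suc: "jump_time \<pi> \<phi> \<kappa> \<epsilon> \<theta> x (Suc n) \<omega>
    = jump_time \<pi> \<phi> \<kappa> \<epsilon> \<theta> x n \<omega>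
      + cumulative_rate_inv \<pi> \<phi> (post_jump \<pi> \<phi> \<kappa> \<epsilon> \<theta> x n \<omega>) (\<epsilon> (Suc n) \<omega>)"
  by (simp add: jump_time_def sojourn_def)

lemma jump_time_cong:
  assumes "\<And>k. k \<in> {1..n} \<Longrightarrow> \<epsilon> k \<omega> = \<epsilon>' k \<omega>' \<and> \<theta> k \<omega> = \<theta>' k \<omega>'"
  shows "jump_time \<pi> \<phi> \<kappa> \<epsilon> \<theta> x n \<omega> = jump_time \<pi> \<phi> \<kappa> \<epsilon>' \<theta>' x n \<omega>'"
  using assms
proof (induction n)
  case (Suc n)
  have "post_jump \<pi> \<phi> \<kappa> \<epsilon> \<theta> x n \<omega> = post_jump \<pi> \<phi> \<kappa> \<epsilon>' \<theta>' x n \<omega>'"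
    using Suc.prems by (intro post_jump_cong) auto
  then show ?case using Suc by (auto simp: jump_time_Suc)
qed (simp add: jump_time_0)

locale pdmp_process = pdmp_characteristics E \<pi> \<phi> J
  for E :: "'a::polish_space set" and \<pi> \<phi> J +
  fixes \<kappa> :: "real \<Rightarrow> 'a \<Rightarrow> 'a" and M :: "'w measure" and \<epsilon> \<theta> :: "nat \<Rightarrow> 'w \<Rightarrow> real"
  assumes kernel: "represents_kernel E J \<kappa>" and noise: "pdmp_noise M \<epsilon> \<theta>"
begin

abbreviation "\<xi> \<equiv> post_jump \<pi> \<phi> \<kappa> \<epsilon> \<theta>"
abbreviation "\<tau> \<equiv> jump_time \<pi> \<phi> \<kappa> \<epsilon> \<theta>"
abbreviation U01 :: "real measure" where "U01 \<equiv> borel_on {0..1}"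

lemma prob_M: "prob_space M" using noise by (simp add: pdmp_noise_def)

sublocale M: prob_space M by (rule prob_M)

lemma indep: "M.indep_vars (\<lambda>_. borel) (case_sum \<epsilon> \<theta>) ({1..} <+> {1..})"
  using noise by (simp add: pdmp_noise_def)

lemma epsilon_law: "1 \<le> n \<Longrightarrow> distr M borel (\<epsilon> n) = density lborel (exponential_density 1)"
  using noise distributed_distr_eq_density[of M lborel "\<epsilon> n" "exponential_density 1"]
  by (simp add: pdmp_noise_def cong: distr_cong)

lemma theta_law: "1 \<le> n \<Longrightarrow> distr M borel (\<theta> n) = uniform_measure lborel {0<..<1}"
  and theta_in: "1 \<le> n \<Longrightarrow> \<omega> \<in> space M \<Longrightarrow> \<theta> n \<omega> \<in> {0<..<1}"
  using noise Pi_mem[of "\<theta> n" "space M" "\<lambda>_. {0<..<1}" \<omega>] unfolding pdmp_noise_def by auto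

lemma epsilon_measurable[measurable]: "1 \<le> n \<Longrightarrow> \<epsilon> n \<in> borel_measurable M"
  and theta_measurable[measurable]: "1 \<le> n \<Longrightarrow> \<theta> n \<in> borel_measurable M"
  using indep unfolding M.indep_vars_def by (auto dest: bspec[of _ _ "Inl n"] bspec[of _ _ "Inr n"])

lemma kappa_measurable[measurable (raw)]:
  assumes "f \<in> N \<rightarrow>\<^sub>M U01" "g \<in> N \<rightarrow>\<^sub>M BE"
  shows "(\<lambda>z. \<kappa> (f z) (g z)) \<in> N \<rightarrow>\<^sub>M BE"
proof -
  have "(\<lambda>(q, x). \<kappa> q x) \<in> U01 \<Otimes>\<^sub>M BE \<rightarrow>\<^sub>M BE" using kernel by (simp add: represents_kernel_def)
  from measurable_compose[OF measurable_Pair[OF assms] this] show ?thesis by simp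
qed

text \<open>
  The kernel representation \<open>\<kappa>\<close> is measurable for arguments in the unit interval only; composing it with this
  retraction gives a function that is measurable on the whole line and agrees with \<open>\<kappa>\<close> on the values of \<open>\<theta>\<close>.
\<close>

definition clamp :: "real \<Rightarrow> real" where "clamp q = max 0 (min 1 q)"

lemma clamp_measurable[measurable]: "clamp \<in> borel \<rightarrow>\<^sub>M U01"
  by (rule measurable_restrict_space2) (auto simp: clamp_def[abs_def])

text \<open>
  Stated for an arbitrary driving noise: it is applied to the given probability space, and to the coordinates
  on the product space of the first \<open>n\<close> pairs of noise variables.
\<close>

lemma chain_measurable:
  fixes \<epsilon>' \<theta>' :: "nat \<Rightarrow> 'z \<Rightarrow> real"
  assumes x: "x \<in> E" and "\<And>k. k \<in> {1..n} \<Longrightarrow> \<epsilon>' k \<in> borel_measurable N" "\<And>k. k \<in> {1..n} \<Longrightarrow> \<theta>' k \<in> N \<rightarrow>\<^sub>M U01"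
  shows "post_jump \<pi> \<phi> \<kappa> \<epsilon>' \<theta>' x n \<in> N \<rightarrow>\<^sub>M BE \<and> jump_time \<pi> \<phi> \<kappa> \<epsilon>' \<theta>' x n \<in> borel_measurable N"
  using assms(2,3)
proof (induction n)
  case 0
  then show ?case using x by (simp add: jump_time_0[abs_def])
next
  case (Suc n)
  have IH[measurable]: "post_jump \<pi> \<phi> \<kappa> \<epsilon>' \<theta>' x n \<in> N \<rightarrow>\<^sub>M BE" "jump_time \<pi> \<phi> \<kappa> \<epsilon>' \<theta>' x n \<in> borel_measurable N"
    using Suc by auto
  have [measurable]: "\<epsilon>' (Suc n) \<in> borel_measurable N" "\<theta>' (Suc n) \<in> N \<rightarrow>\<^sub>M U01" using Suc.prems by auto
  have inE: "post_jump \<pi> \<phi> \<kappa> \<epsilon>' \<theta>' x n \<omega> \<in> E" if "\<omega> \<in> space N" for \<omega>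
    using measurable_space[OF IH(1) that] by simp
  have "(\<lambda>\<omega>. \<kappa> (\<theta>' (Suc n) \<omega>) (flow (inv_rate (post_jump \<pi> \<phi> \<kappa> \<epsilon>' \<theta>' x n \<omega>) (\<epsilon>' (Suc n) \<omega>)) (post_jump \<pi> \<phi> \<kappa> \<epsilon>' \<theta>' x n \<omega>)))
      \<in> N \<rightarrow>\<^sub>M BE" by measurable
  moreover have "post_jump \<pi> \<phi> \<kappa> \<epsilon>' \<theta>' x (Suc n) \<omega>
      = \<kappa> (\<theta>' (Suc n) \<omega>) (flow (inv_rate (post_jump \<pi> \<phi> \<kappa> \<epsilon>' \<theta>' x n \<omega>) (\<epsilon>' (Suc n) \<omega>)) (post_jump \<pi> \<phi> \<kappa> \<epsilon>' \<theta>' x n \<omega>))"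
    if "\<omega> \<in> space N" for \<omega>
    using inv_rate_set(2)[OF inE[OF that]] by (simp add: Let_def flow_nonneg)
  ultimately have "post_jump \<pi> \<phi> \<kappa> \<epsilon>' \<theta>' x (Suc n) \<in> N \<rightarrow>\<^sub>M BE"
    by (rule measurable_cong[THEN iffD2, rotated])
  moreover have "jump_time \<pi> \<phi> \<kappa> \<epsilon>' \<theta>' x (Suc n) \<in> borel_measurable N"
    unfolding jump_time_Suc[abs_def] by measurable
  ultimately show ?case by blast
qed

lemma theta_measurable': "1 \<le> n \<Longrightarrow> \<theta> n \<in> M \<rightarrow>\<^sub>M U01"
  using theta_in[of n] by (intro measurable_restrict_space2 theta_measurable) (auto simp: less_imp_le)

lemma chain_M_measurable:
  assumes "x \<in> E"
  shows "\<xi> x n \<in> M \<rightarrow>\<^sub>M BE" "\<tau> x n \<in> borel_measurable M"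
  using chain_measurable[OF assms, of n \<epsilon> M \<theta>] theta_measurable' epsilon_measurable by auto

lemma chain_in_E: "x \<in> E \<Longrightarrow> \<omega> \<in> space M \<Longrightarrow> \<xi> x n \<omega> \<in> E"
  using measurable_space[OF chain_M_measurable(1)] by simp

lemma tau_Suc: "\<tau> x (Suc n) \<omega> = \<tau> x n \<omega> + inv_rate (\<xi> x n \<omega>) (\<epsilon> (Suc n) \<omega>)"
  by (rule jump_time_Suc)

lemma xi_Suc: "x \<in> E \<Longrightarrow> \<omega> \<in> space M \<Longrightarrow>
    \<xi> x (Suc n) \<omega> = \<kappa> (clamp (\<theta> (Suc n) \<omega>)) (flow (inv_rate (\<xi> x n \<omega>) (\<epsilon> (Suc n) \<omega>)) (\<xi> x n \<omega>))"
  using inv_rate_set(2)[OF chain_in_E, of x \<omega> n] theta_in[of "Suc n" \<omega>]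
  by (simp add: Let_def flow_nonneg clamp_def)

lemma tau_mono: "x \<in> E \<Longrightarrow> \<omega> \<in> space M \<Longrightarrow> incseq (\<lambda>n. \<tau> x n \<omega>)"
  by (rule incseq_SucI) (simp add: tau_Suc inv_rate_set(2)[OF chain_in_E])

text \<open>
  The first \<open>n\<close> steps of the chain are a function of the first \<open>n\<close> pairs of noise variables, which are independent
  of the next pair.
\<close>

lemma past_future_law:
  assumes x: "x \<in> E"
  shows "distr M ((BE \<Otimes>\<^sub>M borel) \<Otimes>\<^sub>M (borel \<Otimes>\<^sub>M borel))
      (\<lambda>\<omega>. ((\<xi> x n \<omega>, \<tau> x n \<omega>), (\<epsilon> (Suc n) \<omega>, \<theta> (Suc n) \<omega>)))
    = distr M (BE \<Otimes>\<^sub>M borel) (\<lambda>\<omega>. (\<xi> x n \<omega>, \<tau> x n \<omega>))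
      \<Otimes>\<^sub>M (density lborel (exponential_density 1) \<Otimes>\<^sub>M uniform_measure lborel {0<..<1})"
proof -
  let ?X = "case_sum \<epsilon> \<theta>"
  define A :: "(nat + nat) set" where "A = {1..n} <+> {1..n}"
  define B :: "(nat + nat) set" where "B = {Inl (Suc n), Inr (Suc n)}"
  have AB: "A \<inter> B = {}" "A \<subseteq> {1..} <+> {1..}" "B \<subseteq> {1..} <+> {1..}" by (auto simp: A_def B_def)
  note ind = M.indep_var_restrict[OF indep AB]
  define e' where "e' k w = w (Inl k)" for k :: nat and w :: "nat + nat \<Rightarrow> real"
  define t' where "t' k w = clamp (w (Inr k))" for k :: nat and w :: "nat + nat \<Rightarrow> real"
  \<comment> \<open>the first steps of the chain as a function on the product space of the noise\<close>
  define Z where "Z w = (post_jump \<pi> \<phi> \<kappa> e' t' x n w, jump_time \<pi> \<phi> \<kappa> e' t' x n w)" for w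
  have "e' k \<in> borel_measurable (PiM A (\<lambda>_. borel))" "t' k \<in> PiM A (\<lambda>_. borel) \<rightarrow>\<^sub>M U01" if "k \<in> {1..n}" for k
  proof -
    have 1: "Inl k \<in> A" "Inr k \<in> A" using that by (auto simp: A_def)
    show "e' k \<in> borel_measurable (PiM A (\<lambda>_. borel))"
      unfolding e'_def[abs_def] by (rule measurable_component_singleton[OF 1(1)])
    show "t' k \<in> PiM A (\<lambda>_. borel) \<rightarrow>\<^sub>M U01"
      unfolding t'_def[abs_def] by (rule measurable_compose[OF measurable_component_singleton[OF 1(2)] clamp_measurable])
  qed
  from chain_measurable[OF x, of n e' "PiM A (\<lambda>_. borel)" t', OF this]
  have Z: "Z \<in> PiM A (\<lambda>_. borel) \<rightarrow>\<^sub>M BE \<Otimes>\<^sub>M borel" unfolding Z_def[abs_def] by auto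
  define Y where "Y w = (w (Inl (Suc n)) :: real, w (Inr (Suc n)) :: real)" for w :: "nat + nat \<Rightarrow> real"
  have Y: "Y \<in> PiM B (\<lambda>_. borel) \<rightarrow>\<^sub>M borel \<Otimes>\<^sub>M borel"
    unfolding Y_def[abs_def] by (intro measurable_Pair measurable_component_singleton) (auto simp: B_def)
  let ?XA = "\<lambda>\<omega>. restrict (\<lambda>i. ?X i \<omega>) A" and ?XB = "\<lambda>\<omega>. restrict (\<lambda>i. ?X i \<omega>) B"
  let ?PA = "PiM A (\<lambda>_. borel) :: (nat + nat \<Rightarrow> real) measure"
  let ?PB = "PiM B (\<lambda>_. borel) :: (nat + nat \<Rightarrow> real) measure"
  have XA[measurable]: "?XA \<in> M \<rightarrow>\<^sub>M ?PA" and XB[measurable]: "?XB \<in> M \<rightarrow>\<^sub>M ?PB"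
    and joint: "distr M ?PA ?XA \<Otimes>\<^sub>M distr M ?PB ?XB = distr M (?PA \<Otimes>\<^sub>M ?PB) (\<lambda>\<omega>. (?XA \<omega>, ?XB \<omega>))"
    using ind unfolding M.indep_var_distribution_eq by auto
  note Z[measurable] Y[measurable]
  have ind2: "distr M (BE \<Otimes>\<^sub>M borel) (Z \<circ> ?XA) \<Otimes>\<^sub>M distr M (borel \<Otimes>\<^sub>M borel) (Y \<circ> ?XB)
      = distr M ((BE \<Otimes>\<^sub>M borel) \<Otimes>\<^sub>M (borel \<Otimes>\<^sub>M borel)) (\<lambda>\<omega>. ((Z \<circ> ?XA) \<omega>, (Y \<circ> ?XB) \<omega>))"
  proof -
    have "distr M (BE \<Otimes>\<^sub>M borel) (Z \<circ> ?XA) \<Otimes>\<^sub>M distr M (borel \<Otimes>\<^sub>M borel) (Y \<circ> ?XB)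
      = distr (distr M ?PA ?XA) (BE \<Otimes>\<^sub>M borel) Z \<Otimes>\<^sub>M distr (distr M ?PB ?XB) (borel \<Otimes>\<^sub>M borel) Y"
      by (simp add: distr_distr)
    also have "\<dots> = distr (distr M ?PA ?XA \<Otimes>\<^sub>M distr M ?PB ?XB)
        ((BE \<Otimes>\<^sub>M borel) \<Otimes>\<^sub>M (borel \<Otimes>\<^sub>M borel)) (\<lambda>(a, b). (Z a, Y b))"
    proof (rule pair_measure_distr)
      interpret XB: prob_space "distr M ?PB ?XB" by (rule M.prob_space_distr) measurable
      interpret prob_space "distr (distr M ?PB ?XB) (borel \<Otimes>\<^sub>M borel) Y" by (rule XB.prob_space_distr) measurable
      show "sigma_finite_measure (distr (distr M ?PB ?XB) (borel \<Otimes>\<^sub>M borel) Y)" by unfold_locales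
    qed measurable
    also have "\<dots> = distr M ((BE \<Otimes>\<^sub>M borel) \<Otimes>\<^sub>M (borel \<Otimes>\<^sub>M borel)) ((\<lambda>(a, b). (Z a, Y b)) \<circ> (\<lambda>\<omega>. (?XA \<omega>, ?XB \<omega>)))"
      unfolding joint by (rule distr_distr) measurable
    finally show ?thesis by (simp add: comp_def)
  qed
  have Ym[measurable]: "\<epsilon> (Suc n) \<in> borel_measurable M" "\<theta> (Suc n) \<in> borel_measurable M" by auto
  have ind3: "M.indep_var borel (\<epsilon> (Suc n)) borel (\<theta> (Suc n))"
  proof -
    have "{Inl (Suc n)} \<inter> {Inr (Suc n)} = {}" "{Inl (Suc n)} \<subseteq> {1..} <+> {1..}" "{Inr (Suc n)} \<subseteq> {1..} <+> {1..}"
      by auto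
    from M.indep_var_restrict[OF indep this]
    have "M.indep_var (PiM {Inl (Suc n)} (\<lambda>_. borel)) (\<lambda>\<omega>. restrict (\<lambda>i. ?X i \<omega>) {Inl (Suc n)})
      (PiM {Inr (Suc n)} (\<lambda>_. borel)) (\<lambda>\<omega>. restrict (\<lambda>i. ?X i \<omega>) {Inr (Suc n)})" .
    from M.indep_var_compose[OF this, of "\<lambda>w. w (Inl (Suc n))" borel "\<lambda>w. w (Inr (Suc n))" borel]
    show ?thesis by (simp add: comp_def)
  qed
  have dY: "distr M (borel \<Otimes>\<^sub>M borel) (\<lambda>\<omega>. (\<epsilon> (Suc n) \<omega>, \<theta> (Suc n) \<omega>))
      = density lborel (exponential_density 1) \<Otimes>\<^sub>M uniform_measure lborel {0<..<1}"
    using ind3[unfolded M.indep_var_distribution_eq] epsilon_law[of "Suc n"] theta_law[of "Suc n"] by simp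
  have ZX: "(Z \<circ> (\<lambda>\<omega>. restrict (\<lambda>i. ?X i \<omega>) A)) \<omega> = (\<xi> x n \<omega>, \<tau> x n \<omega>)" if \<omega>: "\<omega> \<in> space M" for \<omega>
  proof -
    have *: "e' k (restrict (\<lambda>i. ?X i \<omega>) A) = \<epsilon> k \<omega> \<and> t' k (restrict (\<lambda>i. ?X i \<omega>) A) = \<theta> k \<omega>" if "k \<in> {1..n}" for k
      using that theta_in[OF _ \<omega>, of k] by (auto simp: e'_def t'_def A_def clamp_def)
    have "post_jump \<pi> \<phi> \<kappa> e' t' x n (?XA \<omega>) = \<xi> x n \<omega>" by (rule post_jump_cong) (rule *)
    moreover have "jump_time \<pi> \<phi> \<kappa> e' t' x n (?XA \<omega>) = \<tau> x n \<omega>" by (rule jump_time_cong) (rule *)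
    ultimately show ?thesis unfolding Z_def comp_def by simp
  qed
  have YX: "(Y \<circ> (\<lambda>\<omega>. restrict (\<lambda>i. ?X i \<omega>) B)) \<omega> = (\<epsilon> (Suc n) \<omega>, \<theta> (Suc n) \<omega>)" for \<omega>
    by (simp add: Y_def B_def)
  have "distr M ((BE \<Otimes>\<^sub>M borel) \<Otimes>\<^sub>M (borel \<Otimes>\<^sub>M borel))
      (\<lambda>\<omega>. ((\<xi> x n \<omega>, \<tau> x n \<omega>), (\<epsilon> (Suc n) \<omega>, \<theta> (Suc n) \<omega>)))
    = distr M ((BE \<Otimes>\<^sub>M borel) \<Otimes>\<^sub>M (borel \<Otimes>\<^sub>M borel))
      (\<lambda>\<omega>. ((Z \<circ> (\<lambda>\<omega>. restrict (\<lambda>i. ?X i \<omega>) A)) \<omega>, (Y \<circ> (\<lambda>\<omega>. restrict (\<lambda>i. ?X i \<omega>) B)) \<omega>))"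
    by (intro distr_cong refl) (simp only: ZX YX)
  also have "\<dots> = distr M (BE \<Otimes>\<^sub>M borel) (Z \<circ> (\<lambda>\<omega>. restrict (\<lambda>i. ?X i \<omega>) A))
      \<Otimes>\<^sub>M distr M (borel \<Otimes>\<^sub>M borel) (Y \<circ> (\<lambda>\<omega>. restrict (\<lambda>i. ?X i \<omega>) B))"
    using ind2 by simp
  also have "distr M (BE \<Otimes>\<^sub>M borel) (Z \<circ> (\<lambda>\<omega>. restrict (\<lambda>i. ?X i \<omega>) A)) = distr M (BE \<Otimes>\<^sub>M borel) (\<lambda>\<omega>. (\<xi> x n \<omega>, \<tau> x n \<omega>))"
    by (intro distr_cong refl) (simp only: ZX)
  also have "distr M (borel \<Otimes>\<^sub>M borel) (Y \<circ> (\<lambda>\<omega>. restrict (\<lambda>i. ?X i \<omega>) B))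
      = density lborel (exponential_density 1) \<Otimes>\<^sub>M uniform_measure lborel {0<..<1}"
    unfolding dY[symmetric] by (intro distr_cong refl) (simp only: YX)
  finally show ?thesis .
qed

text \<open>
  The endpoints of the unit interval carry no mass, so the uniform law on the open interval represents the same
  kernel as Lebesgue measure on the closed one.
\<close>

lemma kappa_law:
  assumes z: "z \<in> E" and f: "f \<in> borel_measurable BE"
  shows "(\<integral>\<^sup>+q. f (\<kappa> (clamp q) z) \<partial>uniform_measure lborel {0<..<1}) = (\<integral>\<^sup>+y. f y \<partial>J z)"
proof -
  have zm[measurable]: "(\<lambda>q. z) \<in> N \<rightarrow>\<^sub>M BE" for N :: "'z measure" using z by auto
  have km[measurable]: "(\<lambda>q. \<kappa> (clamp q) z) \<in> uniform_measure lborel {0<..<1} \<rightarrow>\<^sub>M BE" by measurable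
  have "J z = distr (uniform_measure lborel {0<..<1}) BE (\<lambda>q. \<kappa> (clamp q) z)"
  proof (rule measure_eqI)
    show "sets (J z) = sets (distr (uniform_measure lborel {0<..<1}) BE (\<lambda>q. \<kappa> (clamp q) z))"
      using sets_J[OF z] by simp
    fix B assume "B \<in> sets (J z)"
    then have B[measurable]: "B \<in> sets BE" using sets_J[OF z] by simp
    let ?V = "{q. \<kappa> (clamp q) z \<in> B}"
    have V: "?V \<in> sets borel"
      using measurable_sets[OF km B] by (simp add: vimage_def)
    have "emeasure (J z) B = emeasure lborel {q\<in>{0..1}. \<kappa> q z \<in> B}"
      using kernel z B unfolding represents_kernel_def by blast
    also have "\<dots> = emeasure lborel ({0..1} \<inter> ?V)"
      by (intro arg_cong2[where f=emeasure] refl) (auto simp: clamp_def)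
    also have "\<dots> = emeasure lborel ({0<..<1} \<inter> ?V)"
      using V AE_lborel_singleton[of "0::real"] AE_lborel_singleton[of "1::real"]
      by (intro emeasure_eq_AE) (auto elim: AE_mp)
    also have "\<dots> = emeasure (uniform_measure lborel {0<..<1}) ?V"
      using V by (subst emeasure_uniform_measure) (auto simp: divide_ennreal_def)
    also have "\<dots> = emeasure (distr (uniform_measure lborel {0<..<1}) BE (\<lambda>q. \<kappa> (clamp q) z)) B"
      by (subst emeasure_distr[OF km B]) (simp add: vimage_def)
    finally show "emeasure (J z) B = emeasure (distr (uniform_measure lborel {0<..<1}) BE (\<lambda>q. \<kappa> (clamp q) z)) B" .
  qed
  then show ?thesis using nn_integral_distr[OF km, of f] f by simp
qed

lemma one_step:
  assumes F: "case_prod F \<in> borel_measurable (borel \<Otimes>\<^sub>M BE)" and y: "y \<in> E"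
  shows "(\<integral>\<^sup>+e. (\<integral>\<^sup>+q. F (t - inv_rate y e) (\<kappa> (clamp q) (flow (inv_rate y e) y)) * indicator {..t} (inv_rate y e)
      \<partial>uniform_measure lborel {0<..<1}) \<partial>density lborel (exponential_density 1)) = first_jump F t y"
proof -
  have ym[measurable]: "(\<lambda>q. y) \<in> N \<rightarrow>\<^sub>M BE" for N :: "'z measure" using y by auto
  define g where "g s = (\<integral>\<^sup>+z. F (t - s) z \<partial>J (flow s y)) * indicator {..t} s" for s
  have [measurable]: "(\<lambda>p. F (t - fst p) (snd p)) \<in> borel_measurable (borel \<Otimes>\<^sub>M BE)"
    using measurable_compose[OF _ F, of "\<lambda>p. (t - fst p, snd p)" "borel \<Otimes>\<^sub>M BE"] by simp
  have g: "g \<in> borel_measurable borel" unfolding g_def[abs_def] by measurable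
  have "(\<integral>\<^sup>+q. F (t - s) (\<kappa> (clamp q) (flow s y)) * indicator {..t} s \<partial>uniform_measure lborel {0<..<1}) = g s" for s
  proof -
    note fm = section_measurable[OF F, of "t - s"]
    have "(\<lambda>q. \<kappa> (clamp q) (flow s y)) \<in> uniform_measure lborel {0<..<1} \<rightarrow>\<^sub>M BE" by measurable
    from measurable_compose[OF this fm]
    have "(\<integral>\<^sup>+q. F (t - s) (\<kappa> (clamp q) (flow s y)) * indicator {..t} s \<partial>uniform_measure lborel {0<..<1})
      = (\<integral>\<^sup>+q. F (t - s) (\<kappa> (clamp q) (flow s y)) \<partial>uniform_measure lborel {0<..<1}) * indicator {..t} s"
      by (rule nn_integral_multc)
    then show ?thesis using kappa_law[OF _ fm, of "flow s y"] y by (simp add: g_def)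
  qed
  then have "(\<integral>\<^sup>+e. (\<integral>\<^sup>+q. F (t - inv_rate y e) (\<kappa> (clamp q) (flow (inv_rate y e) y)) * indicator {..t} (inv_rate y e)
      \<partial>uniform_measure lborel {0<..<1}) \<partial>density lborel (exponential_density 1))
    = (\<integral>\<^sup>+s. ennreal (exp (- \<Phi> y s)) * ennreal (\<phi> (flow s y)) * g s * indicator {0..} s \<partial>lborel)"
    using sojourn_law[OF y g] by simp
  also have "\<dots> = first_jump F t y"
    unfolding first_jump_def by (intro nn_integral_cong) (auto simp: g_def killed_def rate_jump_def indicator_def mult.assoc)
  finally show ?thesis .
qed

text \<open>
  One step of the chain, given its past, is one application of the first-jump operator: freeze the state and the
  time after \<open>n\<close> jumps by independence, and compute the law of the next step.
\<close>

lemma chain_step: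
  assumes x: "x \<in> E" and F: "case_prod F \<in> borel_measurable (borel \<Otimes>\<^sub>M BE)"
  shows "(\<integral>\<^sup>+\<omega>. F (t - \<tau> x (Suc n) \<omega>) (\<xi> x (Suc n) \<omega>) * indicator {..t} (\<tau> x (Suc n) \<omega>) \<partial>M)
    = (\<integral>\<^sup>+\<omega>. first_jump F (t - \<tau> x n \<omega>) (\<xi> x n \<omega>) * indicator {..t} (\<tau> x n \<omega>) \<partial>M)"
proof -
  let ?N = "(BE \<Otimes>\<^sub>M borel) \<Otimes>\<^sub>M (borel \<Otimes>\<^sub>M borel)"
  let ?\<epsilon> = "density lborel (exponential_density 1)" and ?\<theta> = "uniform_measure lborel {0<..<1::real}"
  let ?Z = "distr M (BE \<Otimes>\<^sub>M borel) (\<lambda>\<omega>. (\<xi> x n \<omega>, \<tau> x n \<omega>))"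
  define G where "G p = (case p of ((y, a), (e, q)) \<Rightarrow>
    F (t - a - inv_rate y e) (\<kappa> (clamp q) (flow (inv_rate y e) y)) * indicator {..t - a} (inv_rate y e))" for p
  note [measurable] = chain_M_measurable[OF x]
  have Fm: "(\<lambda>p. F (f p) (g p)) \<in> borel_measurable N" if "f \<in> borel_measurable N" "g \<in> N \<rightarrow>\<^sub>M BE" for N :: "'z measure" and f g
    using measurable_compose[OF measurable_Pair[OF that] F] by simp
  have G: "G \<in> borel_measurable ?N"
  proof -
    have [measurable]: "(\<lambda>p. F (t - snd (fst p) - inv_rate (fst (fst p)) (fst (snd p)))
        (\<kappa> (clamp (snd (snd p))) (flow (inv_rate (fst (fst p)) (fst (snd p))) (fst (fst p))))) \<in> borel_measurable ?N"
      by (rule Fm) measurable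
    have "(\<lambda>p. F (t - snd (fst p) - inv_rate (fst (fst p)) (fst (snd p)))
        (\<kappa> (clamp (snd (snd p))) (flow (inv_rate (fst (fst p)) (fst (snd p))) (fst (fst p))))
        * (if inv_rate (fst (fst p)) (fst (snd p)) \<le> t - snd (fst p) then 1 else 0)) \<in> borel_measurable ?N"
      by measurable
    then show ?thesis
      by (rule measurable_cong[THEN iffD1, rotated]) (auto simp: G_def indicator_def split: prod.split)
  qed
  interpret e: prob_space ?\<epsilon> by (rule prob_space_exponential_density) simp
  interpret th: prob_space ?\<theta> by (rule prob_space_uniform_measure) auto
  interpret eth: pair_sigma_finite ?\<epsilon> ?\<theta> by unfold_locales
  have "(\<integral>\<^sup>+\<omega>. F (t - \<tau> x (Suc n) \<omega>) (\<xi> x (Suc n) \<omega>) * indicator {..t} (\<tau> x (Suc n) \<omega>) \<partial>M)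
    = (\<integral>\<^sup>+\<omega>. G ((\<xi> x n \<omega>, \<tau> x n \<omega>), (\<epsilon> (Suc n) \<omega>, \<theta> (Suc n) \<omega>)) \<partial>M)"
    unfolding G_def tau_Suc using xi_Suc[OF x]
    by (intro nn_integral_cong) (auto simp: indicator_def algebra_simps simp del: post_jump.simps)
  also have "\<dots> = (\<integral>\<^sup>+p. G p \<partial>distr M ?N (\<lambda>\<omega>. ((\<xi> x n \<omega>, \<tau> x n \<omega>), (\<epsilon> (Suc n) \<omega>, \<theta> (Suc n) \<omega>))))"
    using G by (intro nn_integral_distr[symmetric]) auto
  also have "\<dots> = (\<integral>\<^sup>+p. G p \<partial>(?Z \<Otimes>\<^sub>M (?\<epsilon> \<Otimes>\<^sub>M ?\<theta>)))" unfolding past_future_law[OF x] ..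
  also have "\<dots> = (\<integral>\<^sup>+z. (\<integral>\<^sup>+w. G (z, w) \<partial>(?\<epsilon> \<Otimes>\<^sub>M ?\<theta>)) \<partial>?Z)"
  proof (rule sigma_finite_measure.nn_integral_fst[symmetric])
    show "sigma_finite_measure (?\<epsilon> \<Otimes>\<^sub>M ?\<theta>)" by unfold_locales
    show "G \<in> borel_measurable (?Z \<Otimes>\<^sub>M (?\<epsilon> \<Otimes>\<^sub>M ?\<theta>))"
      using G by (rule measurable_cong_sets[THEN eqset_imp_iff, THEN iffD1, rotated 2])
        (auto intro!: sets_pair_measure_cong)
  qed
  also have "\<dots> = (\<integral>\<^sup>+z. first_jump F (t - snd z) (fst z) * indicator {..t} (snd z) \<partial>?Z)"
  proof (intro nn_integral_cong)
    fix z assume "z \<in> space ?Z"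
    then have z: "fst z \<in> E" by (auto simp: space_pair_measure)
    obtain y a where za: "z = (y, a)" by (cases z)
    have y: "y \<in> E" using z za by simp
    have "(\<lambda>w. G (z, w)) \<in> borel_measurable (borel \<Otimes>\<^sub>M borel)"
      by (rule measurable_compose[OF measurable_Pair1' G]) (auto simp: space_pair_measure z za y)
    then have Gz: "(\<lambda>w. G (z, w)) \<in> borel_measurable (?\<epsilon> \<Otimes>\<^sub>M ?\<theta>)"
      by (rule measurable_cong_sets[THEN eqset_imp_iff, THEN iffD1, rotated 2])
        (auto intro!: sets_pair_measure_cong)
    have "(\<integral>\<^sup>+w. G (z, w) \<partial>(?\<epsilon> \<Otimes>\<^sub>M ?\<theta>)) = (\<integral>\<^sup>+e. (\<integral>\<^sup>+q. G (z, (e, q)) \<partial>?\<theta>) \<partial>?\<epsilon>)"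
      by (rule th.nn_integral_fst[OF Gz, symmetric])
    also have "\<dots> = first_jump F (t - a) y"
      unfolding za G_def using one_step[OF F y, of "t - a"] by simp
    also have "\<dots> = first_jump F (t - snd z) (fst z) * indicator {..t} (snd z)"
      by (cases "a \<le> t") (auto simp: za first_jump_def)
    finally show "(\<integral>\<^sup>+w. G (z, w) \<partial>(?\<epsilon> \<Otimes>\<^sub>M ?\<theta>)) = first_jump F (t - snd z) (fst z) * indicator {..t} (snd z)" .
  qed
  also have "\<dots> = (\<integral>\<^sup>+\<omega>. first_jump F (t - \<tau> x n \<omega>) (\<xi> x n \<omega>) * indicator {..t} (\<tau> x n \<omega>) \<partial>M)"
  proof -
    have [measurable]: "(\<lambda>z. first_jump F (t - snd z) (fst z)) \<in> borel_measurable (BE \<Otimes>\<^sub>M borel)"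
      by (rule first_jump_measurable[OF F]) auto
    show ?thesis by (subst nn_integral_distr) auto
  qed
  finally show ?thesis .
qed

text \<open>
  Running \<open>n\<close> steps of the chain and asking for \<open>k\<close> further jumps in the remaining time is asking for \<open>n + k\<close>
  jumps. The induction on \<open>n\<close> moves one jump at a time from the chain into the analytic expression; \<open>k = 0\<close> is the
  law of the \<open>n\<close>-th jump time.
\<close>

lemma jumps_by_chain:
  assumes x: "x \<in> E" and t: "0 \<le> t"
  shows "(\<integral>\<^sup>+\<omega>. jumps_by k (t - \<tau> x n \<omega>) (\<xi> x n \<omega>) * indicator {..t} (\<tau> x n \<omega>) \<partial>M) = jumps_by (n + k) t x"
proof (induction n arbitrary: k)
  case 0
  then show ?case using t by (simp add: jump_time_0 M.emeasure_space_1)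
next
  case (Suc n)
  show ?case
    unfolding chain_step[OF x jumps_by_joint_measurable] using Suc[of "Suc k"] by simp
qed

lemma jumps_by_eq_prob:
  assumes x: "x \<in> E" and t: "0 \<le> t"
  shows "jumps_by n t x = emeasure M {\<omega> \<in> space M. \<tau> x n \<omega> \<le> t}"
proof -
  have [measurable]: "\<tau> x n \<in> borel_measurable M" by (rule chain_M_measurable(2)[OF x])
  have "jumps_by n t x = (\<integral>\<^sup>+\<omega>. indicator {\<omega> \<in> space M. \<tau> x n \<omega> \<le> t} \<omega> \<partial>M)"
    using jumps_by_chain[OF x t, of 0 n] by (simp add: indicator_def cong: nn_integral_cong_simp)
  then show ?thesis by simp
qed

end

section \<open>The probability of no explosion\<close>

context pdmp_characteristics
begin

text \<open>
  By \<open>survival_eq_prob\<close> this is the probability that the process started from \<open>x\<close> does not explode.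
\<close>

definition survival :: "'a \<Rightarrow> ennreal" where
  "survival x = (INF N. min_op (real N) (\<lambda>_. 1) x)"

lemma survival_measurable: "survival \<in> borel_measurable BE"
  unfolding survival_def[abs_def] using min_op_measurable[of "\<lambda>_. 1"] by measurable

lemma min_op_1_antimono:
  assumes x: "x \<in> E" and st: "0 \<le> s" "s \<le> t"
  shows "min_op t (\<lambda>_. 1) x \<le> min_op s (\<lambda>_. 1) x"
proof -
  have "min_op t (\<lambda>_. 1) x = min_op s (min_op (t - s) (\<lambda>_. 1)) x"
    using min_op_add[of "\<lambda>_. 1" x s "t - s"] x st by simp
  also have "\<dots> \<le> min_op s (\<lambda>_. 1) x"
    using x st by (intro positive_operator.op_mono[OF positive_operator_min_op] min_op_measurable)
      (auto intro: min_op_1_le)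
  finally show ?thesis .
qed

end

context pdmp_process
begin

lemma survival_eq_prob:
  assumes x: "x \<in> E"
  shows "survival x = ennreal (measure M {\<omega> \<in> space M. explosion_time \<pi> \<phi> \<kappa> \<epsilon> \<theta> x \<omega> = \<infinity>})"
proof -
  have tm[measurable]: "\<tau> x n \<in> borel_measurable M" for n by (rule chain_M_measurable(2)[OF x])
  have dyson: "dyson n (real N) (\<lambda>_. 1) x = emeasure M {\<omega> \<in> space M. real N < \<tau> x n \<omega>}" for n N
  proof -
    let ?A = "{\<omega> \<in> space M. real N < \<tau> x n \<omega>}" and ?B = "{\<omega> \<in> space M. \<tau> x n \<omega> \<le> real N}"
    have "emeasure M ?A + emeasure M ?B = emeasure M (?A \<union> ?B)"
      by (intro plus_emeasure) auto
    also have "?A \<union> ?B = space M" by auto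
    finally have "emeasure M ?A + emeasure M ?B = 1" by (simp add: M.emeasure_space_1)
    moreover have "dyson n (real N) (\<lambda>_. 1) x + emeasure M ?B = 1"
      using dyson_1_plus_jumps_by[OF x, of "real N" n] jumps_by_eq_prob[OF x, of "real N" n] by simp
    ultimately have "emeasure M ?B + dyson n (real N) (\<lambda>_. 1) x = emeasure M ?B + emeasure M ?A"
      by (simp add: add.commute)
    then show ?thesis using M.emeasure_finite[of ?B] by (simp add: ennreal_add_left_cancel)
  qed
  have "min_op (real N) (\<lambda>_. 1) x = emeasure M {\<omega> \<in> space M. \<exists>n. real N < \<tau> x n \<omega>}" for N
  proof -
    have "min_op (real N) (\<lambda>_. 1) x = (SUP n. emeasure M {\<omega> \<in> space M. real N < \<tau> x n \<omega>})"
      unfolding min_op_def dyson ..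
    also have "\<dots> = emeasure M (\<Union>n. {\<omega> \<in> space M. real N < \<tau> x n \<omega>})"
      using tau_mono[OF x] by (intro SUP_emeasure_incseq incseq_SucI) (auto dest: incseq_SucD intro: less_le_trans)
    also have "(\<Union>n. {\<omega> \<in> space M. real N < \<tau> x n \<omega>}) = {\<omega> \<in> space M. \<exists>n. real N < \<tau> x n \<omega>}" by auto
    finally show ?thesis .
  qed
  then have "survival x = (INF N. emeasure M {\<omega> \<in> space M. \<exists>n. real N < \<tau> x n \<omega>})"
    by (simp add: survival_def)
  also have "\<dots> = emeasure M (\<Inter>N. {\<omega> \<in> space M. \<exists>n. real N < \<tau> x n \<omega>})"
  proof (intro INF_emeasure_decseq decseq_SucI)
    fix N
    have "\<exists>n. real N < \<tau> x n \<omega>" if "\<exists>n. real (Suc N) < \<tau> x n \<omega>" for \<omega>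
    proof -
      from that obtain n where "real (Suc N) < \<tau> x n \<omega>" by blast
      then have "real N < \<tau> x n \<omega>" by simp
      then show ?thesis by blast
    qed
    then show "{\<omega> \<in> space M. \<exists>n. real (Suc N) < \<tau> x n \<omega>} \<subseteq> {\<omega> \<in> space M. \<exists>n. real N < \<tau> x n \<omega>}" by blast
  qed auto
  also have "(\<Inter>N. {\<omega> \<in> space M. \<exists>n. real N < \<tau> x n \<omega>}) = {\<omega> \<in> space M. explosion_time \<pi> \<phi> \<kappa> \<epsilon> \<theta> x \<omega> = \<infinity>}"
  proof (intro set_eqI iffI)
    fix \<omega> assume "\<omega> \<in> {\<omega> \<in> space M. explosion_time \<pi> \<phi> \<kappa> \<epsilon> \<theta> x \<omega> = \<infinity>}"
    then have \<omega>: "\<omega> \<in> space M" and inf: "explosion_time \<pi> \<phi> \<kappa> \<epsilon> \<theta> x \<omega> = \<infinity>" by auto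
    have "incseq (\<lambda>n. ereal (\<tau> x n \<omega>))" using tau_mono[OF x \<omega>] by (auto simp: incseq_def)
    from limI[OF LIMSEQ_SUP[OF this]] have sup: "(SUP n. ereal (\<tau> x n \<omega>)) = \<infinity>"
      using inf by (simp add: explosion_time_def)
    have "\<exists>n. real N < \<tau> x n \<omega>" for N
      using less_SUP_iff[of "ereal (real N)" "\<lambda>n. ereal (\<tau> x n \<omega>)" UNIV] sup by auto
    then show "\<omega> \<in> (\<Inter>N. {\<omega> \<in> space M. \<exists>n. real N < \<tau> x n \<omega>})" using \<omega> by auto
  next
    fix \<omega> assume "\<omega> \<in> (\<Inter>N. {\<omega> \<in> space M. \<exists>n. real N < \<tau> x n \<omega>})"
    then have \<omega>: "\<omega> \<in> space M" and ex: "\<exists>n. real N < \<tau> x n \<omega>" for N by auto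
    have "incseq (\<lambda>n. ereal (\<tau> x n \<omega>))" using tau_mono[OF x \<omega>] by (auto simp: incseq_def)
    from limI[OF LIMSEQ_SUP[OF this]] have lim: "explosion_time \<pi> \<phi> \<kappa> \<epsilon> \<theta> x \<omega> = (SUP n. ereal (\<tau> x n \<omega>))"
      by (simp add: explosion_time_def)
    have "(SUP n. ereal (\<tau> x n \<omega>)) = \<infinity>"
    proof (rule SUP_PInfty)
      fix N :: nat
      obtain n where "real N < \<tau> x n \<omega>" using ex by blast
      then show "\<exists>n\<in>UNIV. ereal (real N) \<le> ereal (\<tau> x n \<omega>)" by (auto intro!: exI[of _ n])
    qed
    then show "\<omega> \<in> {\<omega> \<in> space M. explosion_time \<pi> \<phi> \<kappa> \<epsilon> \<theta> x \<omega> = \<infinity>}" using \<omega> lim by simp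
  qed
  finally show ?thesis by (simp add: M.emeasure_eq_measure)
qed

end

section \<open>Laplace transforms of the jump times\<close>

context pdmp_L1
begin

text \<open>
  In probabilistic terms \<open>jump_resolvent r n x\<close> is the mean of \<open>exp (- r t\<^sub>n)\<close> for the chain started from \<open>x\<close>.
\<close>

abbreviation jump_resolvent :: "real \<Rightarrow> nat \<Rightarrow> 'a \<Rightarrow> ennreal" where
  "jump_resolvent r n \<equiv> ((\<lambda>f. resolvent_op r (rate_jump f)) ^^ n) (\<lambda>_. 1)"

lemma jump_resolvent_measurable: "jump_resolvent r n \<in> borel_measurable m"
  by (induction n) (auto intro!: positive_operator.meas[OF positive_operator_resolvent_op]
      positive_operator.meas[OF operator_on_m[OF positive_operator_rate_jump]])

text \<open>
  The second bound is the mean of \<open>exp (- r t\<^sub>n) \<le> 1\<^bsub>t\<^sub>n \<le> t\<^esub> + exp (- r t)\<close>. It is proved by induction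
  through the first-jump equation, where the two summands are discounted differently: in the first the discount is
  dropped, and in the second the discounts before and after the first jump multiply to \<open>exp (- r t)\<close>.
\<close>

lemma jump_resolvent_bound:
  assumes r: "0 < r" and x: "x \<in> E" and t: "0 \<le> t"
  shows "jump_resolvent r n x \<le> 1 \<and> jump_resolvent r n x \<le> jumps_by n t x + ennreal (exp (- r * t))"
  using x t
proof (induction n arbitrary: x t)
  case (Suc n)
  have xm[measurable]: "(\<lambda>q. x) \<in> N \<rightarrow>\<^sub>M BE" for N :: "'z measure" using Suc.prems by auto
  have m1: "(\<lambda>s. killed s (rate_jump (jumps_by n (t - s))) x * indicator {0..t} s) \<in> borel_measurable lborel"
  proof (rule borel_measurable_times_ennreal)
    show "(\<lambda>s. killed s (rate_jump (jumps_by n (t - s))) x) \<in> borel_measurable lborel"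
      unfolding measurable_lborel2 by (rule first_jump_integrand_measurable'[OF jumps_by_joint_measurable Suc.prems(1)])
    show "(indicator {0..t} :: real \<Rightarrow> ennreal) \<in> borel_measurable lborel" by simp
  qed
  have m0[measurable]: "(\<lambda>s. ennreal (exp (- \<Phi> x s)) * ennreal (\<phi> (flow s x)) * indicator {0..} s) \<in> borel_measurable lborel"
    by measurable
  have m2: "(\<lambda>s. ennreal (exp (- r * t)) * (ennreal (exp (- \<Phi> x s)) * ennreal (\<phi> (flow s x)) * indicator {0..} s)) \<in> borel_measurable lborel"
    by (rule borel_measurable_times_ennreal[OF measurable_const m0]) simp
  let ?K = "rate_jump (jump_resolvent r n)"
  have K_le: "?K z \<le> ennreal (\<phi> z)" if z: "z \<in> E" for z
  proof -
    have "?K z \<le> rate_jump (\<lambda>_. 1) z" using Suc.IH[OF _ order_refl] by (intro rate_jump_mono z) auto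
    then show ?thesis by (simp add: rate_jump_const z)
  qed
  have total: "(\<integral>\<^sup>+s. ennreal (exp (- \<Phi> x s)) * ennreal (\<phi> (flow s x)) * indicator {0..} s \<partial>lborel) = 1"
    using rate_tail[OF Suc.prems(1), of 0] by (simp add: Phi_0)
  have "jump_resolvent r (Suc n) x = (\<integral>\<^sup>+s. killed s ?K x * (ennreal (exp (- r * s)) * indicator {0..} s) \<partial>lborel)"
    by (simp add: resolvent_op_def)
  note eq = this
  have "jump_resolvent r (Suc n) x \<le> (\<integral>\<^sup>+s. ennreal (exp (- \<Phi> x s)) * ennreal (\<phi> (flow s x)) * indicator {0..} s \<partial>lborel)"
    unfolding eq
  proof (intro nn_integral_mono)
    fix s :: real
    have "ennreal (exp (- \<Phi> x s)) * ?K (flow s x) * ennreal (exp (- r * s)) \<le> ennreal (exp (- \<Phi> x s)) * ennreal (\<phi> (flow s x)) * 1"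
      if "0 \<le> s" using that r Suc.prems by (intro mult_mono K_le) auto
    then show "killed s ?K x * (ennreal (exp (- r * s)) * indicator {0..} s)
        \<le> ennreal (exp (- \<Phi> x s)) * ennreal (\<phi> (flow s x)) * indicator {0..} s"
      by (auto simp: killed_def indicator_def)
  qed
  then have 1: "jump_resolvent r (Suc n) x \<le> 1" unfolding total .
  have "jump_resolvent r (Suc n) x \<le> (\<integral>\<^sup>+s. killed s (rate_jump (jumps_by n (t - s))) x * indicator {0..t} s
      + ennreal (exp (- r * t)) * (ennreal (exp (- \<Phi> x s)) * ennreal (\<phi> (flow s x)) * indicator {0..} s) \<partial>lborel)"
    unfolding eq
  proof (intro nn_integral_mono)
    fix s :: real
    let ?a = "ennreal (exp (- \<Phi> x s))" and ?z = "flow s x"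
    have z: "?z \<in> E" using Suc.prems by simp
    consider "s < 0" | "0 \<le> s" "s \<le> t" | "t < s" by linarith
    then show "killed s ?K x * (ennreal (exp (- r * s)) * indicator {0..} s)
      \<le> killed s (rate_jump (jumps_by n (t - s))) x * indicator {0..t} s
      + ennreal (exp (- r * t)) * (?a * ennreal (\<phi> ?z) * indicator {0..} s)"
    proof cases
      case 2
      then have ts: "0 \<le> t - s" by simp
      have jm: "jumps_by n (t - s) \<in> borel_measurable BE" by (rule section_measurable[OF jumps_by_joint_measurable])
      have "?K ?z \<le> rate_jump (\<lambda>y. jumps_by n (t - s) y + ennreal (exp (- r * (t - s)))) ?z"
        using Suc.IH[OF _ ts] by (intro rate_jump_mono z) auto
      also have "\<dots> = rate_jump (jumps_by n (t - s)) ?z + ennreal (\<phi> ?z) * ennreal (exp (- r * (t - s)))"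
        using rate_jump_add[OF jm _ z, of "\<lambda>_. ennreal (exp (- r * (t - s)))"] by (simp add: rate_jump_const z)
      finally have "?K ?z * ennreal (exp (- r * s))
          \<le> (rate_jump (jumps_by n (t - s)) ?z + ennreal (\<phi> ?z) * ennreal (exp (- r * (t - s)))) * ennreal (exp (- r * s))"
        by (rule mult_right_mono) simp
      also have "\<dots> = rate_jump (jumps_by n (t - s)) ?z * ennreal (exp (- r * s))
          + ennreal (\<phi> ?z) * (ennreal (exp (- r * (t - s))) * ennreal (exp (- r * s)))"
        by (simp add: distrib_right mult.assoc)
      also have "ennreal (exp (- r * (t - s))) * ennreal (exp (- r * s)) = ennreal (exp (- r * t))"
        by (simp add: ennreal_mult'[symmetric] exp_add[symmetric] algebra_simps)
      also have "rate_jump (jumps_by n (t - s)) ?z * ennreal (exp (- r * s)) \<le> rate_jump (jumps_by n (t - s)) ?z * 1"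
        using 2 r by (intro mult_left_mono) auto
      finally have "?K ?z * ennreal (exp (- r * s)) \<le> rate_jump (jumps_by n (t - s)) ?z + ennreal (\<phi> ?z) * ennreal (exp (- r * t))"
        by (simp add: add_right_mono)
      from mult_left_mono[OF this, of ?a] show ?thesis using 2 by (simp add: killed_def distrib_left mult_ac)
    next
      case 3
      have "?a * ?K ?z * ennreal (exp (- r * s)) \<le> ?a * ennreal (\<phi> ?z) * ennreal (exp (- r * t))"
        using 3 r z by (intro mult_mono K_le) auto
      then show ?thesis using 3 Suc.prems by (simp add: killed_def mult_ac)
    qed simp
  qed
  also have "\<dots> = first_jump (jumps_by n) t x
      + (\<integral>\<^sup>+s. ennreal (exp (- r * t)) * (ennreal (exp (- \<Phi> x s)) * ennreal (\<phi> (flow s x)) * indicator {0..} s) \<partial>lborel)"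
    unfolding first_jump_def by (rule nn_integral_add[OF m1 m2])
  also have "\<dots> = jumps_by (Suc n) t x + ennreal (exp (- r * t))"
    by (subst nn_integral_cmult[OF m0]) (simp add: total)
  finally show ?case using 1 by blast
qed simp

lemma jump_resolvent_decreasing:
  assumes r: "0 < r" and x: "x \<in> E"
  shows "jump_resolvent r (Suc n) x \<le> jump_resolvent r n x"
  using x
proof (induction n arbitrary: x)
  case 0
  then show ?case using jump_resolvent_bound[OF r, of x 0 "Suc 0"] by simp
next
  case (Suc n)
  have "rate_jump (jump_resolvent r (Suc n)) y \<le> rate_jump (jump_resolvent r n) y" if "y \<in> E" for y
    using Suc.IH that by (intro rate_jump_mono) auto
  then have "resolvent_op r (rate_jump (jump_resolvent r (Suc n))) x \<le> resolvent_op r (rate_jump (jump_resolvent r n)) x"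
    using Suc.prems
    by (intro positive_operator.op_mono[OF positive_operator_resolvent_op]
        positive_operator.meas[OF operator_on_m[OF positive_operator_rate_jump]] jump_resolvent_measurable) auto
  then show ?case by simp
qed

text \<open>
  In the limit of many jumps, \<open>exp (- r t\<^sub>n)\<close> vanishes on the event of no explosion and is at most \<open>1\<close> otherwise.
\<close>

lemma survival_plus_jump_resolvent:
  assumes r: "0 < r" and x: "x \<in> E"
  shows "survival x + (INF n. jump_resolvent r n x) \<le> 1"
proof -
  let ?k = "INF n. jump_resolvent r n x"
  have le: "survival x + ?k \<le> 1 + ennreal (exp (- r * real N))" for N
  proof -
    have "survival x + ?k \<le> min_op (real N) (\<lambda>_. 1) x + ?k"
      unfolding survival_def by (intro add_right_mono INF_lower) simp
    also have "\<dots> = (SUP n. dyson n (real N) (\<lambda>_. 1) x + ?k)"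
      unfolding min_op_def by (simp add: ennreal_SUP_add_left)
    also have "\<dots> \<le> 1 + ennreal (exp (- r * real N))"
    proof (rule SUP_least)
      fix n
      have "dyson n (real N) (\<lambda>_. 1) x + ?k \<le> dyson n (real N) (\<lambda>_. 1) x + (jumps_by n (real N) x + ennreal (exp (- r * real N)))"
        using jump_resolvent_bound[OF r x, of "real N" n] by (intro add_left_mono INF_lower2[of n]) auto
      also have "\<dots> = 1 + ennreal (exp (- r * real N))"
        using dyson_1_plus_jumps_by[OF x, of "real N" n] by (simp add: add.assoc[symmetric])
      finally show "dyson n (real N) (\<lambda>_. 1) x + ?k \<le> 1 + ennreal (exp (- r * real N))" .
    qed
    finally show ?thesis .
  qed
  show ?thesis
  proof (rule ennreal_le_epsilon)
    fix e :: real assume e: "0 < e"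
    have "((\<lambda>N. exp (- r * real N)) \<longlonglongrightarrow> 0)" using r by real_asymp
    then have "\<forall>\<^sub>F N in sequentially. exp (- r * real N) < e" using e by (rule order_tendstoD)
    then obtain N where "exp (- r * real N) < e" by (auto simp: eventually_sequentially)
    then have "1 + ennreal (exp (- r * real N)) \<le> 1 + ennreal e" by (intro add_left_mono ennreal_leI) simp
    with le show "survival x + ?k \<le> 1 + ennreal e" by (rule order_trans)
  qed
qed

lemma pairing_INF:
  assumes f: "\<And>n::nat. f n \<in> borel_measurable m" and u: "u \<in> L1_pos m"
    and dec: "\<And>n x. x \<in> E \<Longrightarrow> f (Suc n) x \<le> f n x" and le1: "\<And>x. x \<in> E \<Longrightarrow> f 0 x \<le> 1"
  shows "pairing m (\<lambda>x. INF n. f n x) u = (INF n. pairing m (f n) u)"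
proof -
  let ?D = "density m (\<lambda>x. ennreal (u x))"
  note [measurable] = L1_posD(3)[OF u] f
  have pair: "pairing m g u = (\<integral>\<^sup>+x. g x \<partial>?D)" if "g \<in> borel_measurable m" for g
    using that by (subst nn_integral_density) (auto simp: mult.commute)
  have "pairing m (f 0) u \<le> pairing m (\<lambda>_. 1) u" using le1 by (intro pairing_mono) auto
  also have "\<dots> < \<infinity>" unfolding L1_pos_norm(2)[OF u, symmetric] by simp
  finally have fin: "(\<integral>\<^sup>+x. f 0 x \<partial>?D) < \<infinity>" by (simp add: pair)
  have "pairing m (\<lambda>x. INF n. f n x) u = (\<integral>\<^sup>+x. (INF n. f n x) \<partial>?D)" by (rule pair) measurable
  also have "\<dots> = (INF n. \<integral>\<^sup>+x. f n x \<partial>?D)"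
    using dec fin by (intro nn_integral_monotone_convergence_INF_AE' AE_I2) auto
  finally show ?thesis by (simp add: pair)
qed

end

section \<open>Stability of the minimal semigroup\<close>

locale pdmp_minimal = pdmp_L1 E \<pi> \<phi> J m P S
  for E :: "'a::polish_space set" and \<pi> \<phi> J m P S +
  fixes Pt :: "real \<Rightarrow> ('a \<Rightarrow> real) \<Rightarrow> 'a \<Rightarrow> real"
  assumes minimal: "minimal_semigroup m \<phi> P S Pt"
begin

sublocale Pt: L1_semigroup m Pt
  using minimal by unfold_locales (simp add: minimal_semigroup_def)

lemma Pt_le_Q: "0 \<le> t \<Longrightarrow> u \<in> L1_pos m \<Longrightarrow> AE x in m. Pt t u x \<le> Q t u x"
  using minimal Q_substochastic Q_extends unfolding minimal_semigroup_def by blast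

lemma Pt_norm_antimono:
  assumes u: "integrable m u" and st: "0 \<le> s" "s \<le> t"
  shows "L1_norm m (Pt t u) \<le> L1_norm m (Pt s u)"
proof -
  have ts: "0 \<le> t - s" using st by simp
  note i = Pt.integrable[OF st(1) u]
  have "L1_norm m (Pt t u) = L1_norm m (Pt (t - s) (Pt s u))"
    using Pt.add[OF st(1) ts u] Pt.integrable[OF _ u, of t] Pt.integrable[OF ts i] st
    by (intro L1_norm_cong_AE) auto
  also have "\<dots> \<le> L1_norm m (Pt s u)" by (rule Pt.contraction[OF ts i])
  finally show ?thesis .
qed

text \<open>
  The mass of \<open>Q t u\<close> decreases to the integral of the survival probability against \<open>u\<close>, and it dominates the mass of
  the minimal semigroup.
\<close>

lemma stable_if_survival_null:
  assumes null: "AE x in m. survival x = 0"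
  shows "strongly_stable m Pt"
  unfolding strongly_stable_def
proof (intro allI impI)
  have pos: "((\<lambda>t. L1_norm m (Pt t u)) \<longlongrightarrow> 0) at_top" if u: "u \<in> L1_pos m" for u
  proof (rule tendstoI)
    fix e :: real assume e: "0 < e"
    have "(INF N. pairing m (min_op (real N) (\<lambda>_. 1)) u) = pairing m survival u"
      unfolding survival_def[abs_def] using min_op_measurable[of "\<lambda>_. 1"]
      by (intro pairing_INF[symmetric] u) (auto simp: measurable_m intro: min_op_1_antimono min_op_1_le)
    also have "\<dots> = 0" by (rule pairing_zero_of_AE_zero[OF null])
    finally have "(INF N. pairing m (min_op (real N) (\<lambda>_. 1)) u) < ennreal e" using e by simp
    then obtain N where N: "pairing m (min_op (real N) (\<lambda>_. 1)) u < ennreal e" by (auto simp: INF_less_iff)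
    have QN: "ennreal (L1_norm m (Q (real N) u)) < ennreal e"
      unfolding L1_pos_norm(2)[OF Q_pos[OF of_nat_0_le_iff u]] using pairing_Q[OF of_nat_0_le_iff u, of "\<lambda>_. 1" N] N by simp
    have "L1_norm m (Pt (real N) u) \<le> L1_norm m (Q (real N) u)"
      unfolding L1_pos_norm(1)[OF Pt.pos[OF of_nat_0_le_iff u]] L1_pos_norm(1)[OF Q_pos[OF of_nat_0_le_iff u]]
      using Pt_le_Q[OF of_nat_0_le_iff u] L1_posD(1)[OF Pt.pos[OF of_nat_0_le_iff u]] L1_posD(1)[OF Q_pos[OF of_nat_0_le_iff u]]
      by (intro integral_mono_AE)
    also have "\<dots> < e" using QN L1_norm_nonneg[of m "Q (real N) u"] by (simp add: ennreal_less_iff)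
    finally have PN: "L1_norm m (Pt (real N) u) < e" .
    show "\<forall>\<^sub>F t in at_top. dist (L1_norm m (Pt t u)) 0 < e"
      using eventually_ge_at_top[of "real N"]
    proof eventually_elim
      case (elim t)
      then show ?case
        using Pt_norm_antimono[OF L1_posD(1)[OF u], of "real N" t] PN L1_norm_nonneg[of m "Pt t u"] by simp
    qed
  qed
  fix u :: "'a \<Rightarrow> real" assume u: "integrable m u"
  obtain p n where pn: "p \<in> L1_pos m" "n \<in> L1_pos m" and u_eq: "u = (\<lambda>x. p x - n x)"
    by (rule L1_parts[OF u])
  show "((\<lambda>t. L1_norm m (Pt t u)) \<longlongrightarrow> 0) at_top"
  proof (rule Lim_null_comparison[OF _ tendsto_add_zero[OF pos[OF pn(1)] pos[OF pn(2)]]])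
    show "\<forall>\<^sub>F t in at_top. norm (L1_norm m (Pt t u)) \<le> L1_norm m (Pt t p) + L1_norm m (Pt t n)"
      using eventually_ge_at_top[of "0::real"]
    proof eventually_elim
      case (elim t)
      from L1_norm_linear_diff_le[OF Pt.linear[OF elim] pn[THEN L1_posD(1)]]
      show ?case unfolding u_eq by (simp add: L1_norm_nonneg)
    qed
  qed
qed

text \<open>
  The Laplace transform of the mass of an orbit, that is, the mass of \<open>R(r, C) v\<close> for the generator \<open>C\<close> of the
  minimal semigroup.
\<close>

definition mean_mass :: "real \<Rightarrow> ('a \<Rightarrow> real) \<Rightarrow> real" where
  "mean_mass r v = laplace r (\<lambda>t. LINT x:space m|m. Pt t v x)"

lemma mass_orbit:
  assumes v: "v \<in> L1_pos m"
  shows "continuous_on {0..} (\<lambda>t. LINT x:space m|m. Pt t v x)"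
    and "\<And>t. 0 \<le> t \<Longrightarrow> (LINT x:space m|m. Pt t v x) = L1_norm m (Pt t v)"
    and "\<And>t. 0 \<le> t \<Longrightarrow> \<bar>LINT x:space m|m. Pt t v x\<bar> \<le> L1_norm m v"
proof -
  show "continuous_on {0..} (\<lambda>t. LINT x:space m|m. Pt t v x)"
    by (rule Pt.continuous_set_integral[OF L1_posD(1)[OF v] sets.top])
  show "(LINT x:space m|m. Pt t v x) = L1_norm m (Pt t v)" if t: "0 \<le> t" for t
    unfolding L1_pos_norm(1)[OF Pt.pos[OF t v]] by (rule set_integral_space[OF L1_posD(1)[OF Pt.pos[OF t v]]])
  show "\<bar>LINT x:space m|m. Pt t v x\<bar> \<le> L1_norm m v" if t: "0 \<le> t" for t
    by (rule Pt.abs_set_integral_orbit_le[OF t L1_posD(1)[OF v] sets.top])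
qed

lemma mean_mass_nonneg: "v \<in> L1_pos m \<Longrightarrow> 0 \<le> mean_mass r v"
  unfolding mean_mass_def laplace_def set_lebesgue_integral_def[of lborel]
proof (intro integral_nonneg_AE AE_I2)
  fix t :: real assume v: "v \<in> L1_pos m"
  show "0 \<le> indicator {0..} t *\<^sub>R (exp (- r * t) * (LINT x:space m|m. Pt t v x))"
  proof (cases "0 \<le> t")
    case True
    show ?thesis unfolding mass_orbit(2)[OF v True] by (simp add: L1_norm_nonneg)
  qed simp
qed

text \<open>
  The mass of \<open>R(r, C) = R(r, A) + R(r, C) P \<phi> R(r, A)\<close>. It follows from the resolvent identity because \<open>C\<close> extends
  \<open>A + P \<phi>\<close>, so that \<open>(r - C) R(r, A) v = v - P \<phi> R(r, A) v\<close>.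
\<close>

lemma mean_mass_resolvent:
  assumes uv: "resolvent_pair r v u"
  shows "mean_mass r v = L1_norm m u + mean_mass r (P (\<lambda>x. \<phi> x * u x))"
proof -
  note r = resolvent_pairD(1)[OF uv] and v = resolvent_pairD(2)[OF uv] and u = resolvent_pairD(3)[OF uv]
  let ?p = "P (\<lambda>x. \<phi> x * u x)"
  note p = inflow_pos(2)[OF uv]
  have "generator m Pt u (\<lambda>x. (r * u x - v x) + ?p x)"
    using minimal generator_resolvent[OF uv] unfolding minimal_semigroup_def extends_perturbed_generator_def by blast
  from Pt.laplace_generator[OF this r sets.top]
  have "laplace r (\<lambda>t. LINT x:space m|m. Pt t (\<lambda>x. v x - ?p x) x) = (LINT x:space m|m. u x)" by simp
  moreover have "laplace r (\<lambda>t. LINT x:space m|m. Pt t (\<lambda>x. v x - ?p x) x)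
      = laplace r (\<lambda>t. 1 * (LINT x:space m|m. Pt t v x) + (- 1) * (LINT x:space m|m. Pt t ?p x))"
    unfolding laplace_def set_lebesgue_integral_def[of lborel]
    using Pt.set_integral_lincomb[OF _ L1_posD(1)[OF v] L1_posD(1)[OF p] sets.top, of _ 1 "- 1"]
    by (intro Bochner_Integration.integral_cong refl) (auto simp: indicator_def)
  moreover have "\<dots> = 1 * mean_mass r v + (- 1) * mean_mass r ?p"
    unfolding mean_mass_def
    by (rule laplace_lincomb[OF mass_orbit(1,3)[OF v] mass_orbit(1,3)[OF p] r])
  moreover have "(LINT x:space m|m. u x) = L1_norm m u"
    unfolding L1_pos_norm(1)[OF u] by (rule set_integral_space[OF L1_posD(1)[OF u]])
  ultimately show ?thesis by simp
qed

text \<open>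
  Iterate the previous identity \<open>n\<close> times and drop the last term \<open>R(r, C) (P \<phi> R(r, A))\<^sup>n v\<close>; by the mass balance the
  remaining sum telescopes. The dual of \<open>P \<phi> R(r, A)\<close> is one step of the discounted jump chain, which turns the
  mass of \<open>(P \<phi> R(r, A))\<^sup>n v\<close> into the pairing on the right.
\<close>

lemma mass_le_mean_mass_plus_jump_resolvent:
  assumes r: "0 < r" and v: "v \<in> L1_pos m"
  shows "ennreal (L1_norm m v) \<le> ennreal (r * mean_mass r v) + pairing m (jump_resolvent r n) v"
  using v
proof (induction n arbitrary: v)
  case 0
  then show ?case using L1_pos_norm(2)[OF 0] by simp
next
  case (Suc n)
  obtain u where uv: "resolvent_pair r v u" using resolvent_exists[OF r Suc.prems] by blast
  let ?p = "P (\<lambda>x. \<phi> x * u x)"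
  note p = inflow_pos(2)[OF uv] and u = resolvent_pairD(3)[OF uv]
  have jm: "rate_jump (jump_resolvent r n) \<in> borel_measurable m"
    by (intro positive_operator.meas[OF operator_on_m[OF positive_operator_rate_jump]] jump_resolvent_measurable)
  have "ennreal (L1_norm m v) = ennreal (r * L1_norm m u) + ennreal (L1_norm m ?p)"
    unfolding inflow_pos(4)[OF uv] using r by (simp add: L1_norm_nonneg)
  also have "\<dots> \<le> ennreal (r * L1_norm m u) + (ennreal (r * mean_mass r ?p) + pairing m (jump_resolvent r n) ?p)"
    by (intro add_left_mono Suc.IH p)
  also have "\<dots> = ennreal (r * mean_mass r v) + pairing m (jump_resolvent r n) ?p"
    unfolding mean_mass_resolvent[OF uv] using r mean_mass_nonneg[OF p]
    by (simp add: distrib_left L1_norm_nonneg add.assoc)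
  also have "pairing m (jump_resolvent r n) ?p = pairing m (jump_resolvent r (Suc n)) v"
    unfolding inflow_pos(3)[OF uv jump_resolvent_measurable, symmetric] resolvent_pairD(4)[OF uv jm] by simp
  finally show ?case .
qed

text \<open>
  Let the number of jumps grow in the previous estimate.
\<close>

lemma survival_le_mean_mass:
  assumes r: "0 < r" and v: "v \<in> L1_pos m"
  shows "pairing m survival v \<le> ennreal (r * mean_mass r v)"
proof -
  let ?k = "\<lambda>x. INF n. jump_resolvent r n x"
  have km: "?k \<in> borel_measurable m" using jump_resolvent_measurable by measurable
  have sm: "survival \<in> borel_measurable m" using survival_measurable by (simp add: measurable_m)
  have "pairing m survival v + pairing m ?k v = pairing m (\<lambda>x. survival x + ?k x) v"
    by (rule pairing_add[OF sm km L1_posD(3)[OF v], symmetric])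
  also have "\<dots> \<le> pairing m (\<lambda>_. 1) v"
    using survival_plus_jump_resolvent[OF r] by (intro pairing_mono) simp
  also have "\<dots> = ennreal (L1_norm m v)" unfolding L1_pos_norm(2)[OF v] ..
  also have "\<dots> \<le> (INF n. ennreal (r * mean_mass r v) + pairing m (jump_resolvent r n) v)"
    using mass_le_mean_mass_plus_jump_resolvent[OF r v] by (intro INF_greatest)
  also have "\<dots> = ennreal (r * mean_mass r v) + pairing m ?k v"
    unfolding INF_ennreal_const_add
    using jump_resolvent_decreasing[OF r] by (subst pairing_INF[OF jump_resolvent_measurable v]) auto
  finally have le: "pairing m survival v + pairing m ?k v \<le> ennreal (r * mean_mass r v) + pairing m ?k v" .
  have "pairing m ?k v \<le> pairing m (\<lambda>_. 1) v" by (intro pairing_mono INF_lower2[of 0]) auto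
  also have "\<dots> < \<infinity>" unfolding L1_pos_norm(2)[OF v, symmetric] by simp
  finally have "pairing m ?k v < top" by simp
  moreover have "pairing m ?k v + pairing m survival v \<le> pairing m ?k v + ennreal (r * mean_mass r v)"
    using le by (simp only: add.commute)
  ultimately show ?thesis by (simp only: ennreal_add_left_cancel_le infinity_ennreal_def) auto
qed

text \<open>
  The Abelian half of Tauberian theory: \<open>r\<close> times the Laplace transform is an average of the masses over times of
  order \<open>1 / r\<close>, so for small \<open>r\<close> only late times count.
\<close>

lemma mean_mass_bound:
  assumes r: "0 < r" and v: "v \<in> L1_pos m" and t0: "0 \<le> t0"
    and small: "\<And>t. t0 \<le> t \<Longrightarrow> L1_norm m (Pt t v) \<le> e"
  shows "r * mean_mass r v \<le> e + r * t0 * L1_norm m v"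
proof -
  have e: "0 \<le> e" using small[of t0] L1_norm_nonneg[of m "Pt t0 v"] by simp
  have i1: "set_integrable lborel {0..} (\<lambda>t. e * exp (- r * t))"
    by (intro set_integrable_mult_right exp_integral_atLeast r)
  have i2: "set_integrable lborel {0..} (\<lambda>t. L1_norm m v * indicator {0..t0} t)"
  proof -
    have "integrable lborel (\<lambda>t. L1_norm m v * indicator {0..t0} t)"
      using t0 by (intro integrable_mult_right integrable_real_indicator) auto
    moreover have "(\<lambda>t. indicator {0..} t *\<^sub>R (L1_norm m v * indicator {0..t0} t)) = (\<lambda>t. L1_norm m v * indicator {0..t0} t)"
      by (auto simp: indicator_def)
    ultimately show ?thesis unfolding set_integrable_def by simp
  qed
  have "mean_mass r v \<le> (LINT t:{0..}|lborel. e * exp (- r * t) + L1_norm m v * indicator {0..t0} t)"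
    unfolding mean_mass_def laplace_def
  proof (intro set_integral_mono laplace_integrable[OF mass_orbit(1,3)[OF v] r] set_integral_add(1) i1 i2)
    fix t :: real assume "t \<in> {0..}"
    then have t: "0 \<le> t" by simp
    have N: "0 \<le> L1_norm m (Pt t v)" "L1_norm m (Pt t v) \<le> L1_norm m v"
      using L1_norm_nonneg Pt.contraction[OF t L1_posD(1)[OF v]] by auto
    have ex: "exp (- r * t) \<le> 1" using r t by simp
    show "exp (- r * t) * (LINT x:space m|m. Pt t v x) \<le> e * exp (- r * t) + L1_norm m v * indicator {0..t0} t"
    proof (cases "t \<le> t0")
      case True
      have "exp (- r * t) * L1_norm m (Pt t v) \<le> 1 * L1_norm m v" using N ex by (intro mult_mono) auto
      moreover have "0 \<le> e * exp (- r * t)" using e by simp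
      ultimately show ?thesis unfolding mass_orbit(2)[OF v t] using True t by simp
    next
      case False
      have "exp (- r * t) * L1_norm m (Pt t v) \<le> exp (- r * t) * e" using small[of t] False by (intro mult_left_mono) auto
      then show ?thesis unfolding mass_orbit(2)[OF v t] using False t by (simp add: mult.commute)
    qed
  qed
  also have "\<dots> = (LINT t:{0..}|lborel. e * exp (- r * t)) + (LINT t:{0..}|lborel. L1_norm m v * indicator {0..t0} t)"
    by (rule set_integral_add(2)[OF i1 i2])
  also have "(LINT t:{0..}|lborel. L1_norm m v * indicator {0..t0} t) = L1_norm m v * t0"
  proof -
    have "(LINT t:{0..}|lborel. L1_norm m v * indicator {0..t0} t) = (LINT t|lborel. L1_norm m v * indicator {0..t0} t)"
      unfolding set_lebesgue_integral_def by (intro Bochner_Integration.integral_cong) (auto simp: indicator_def)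
    then show ?thesis using t0 by simp
  qed
  finally have "mean_mass r v \<le> e / r + L1_norm m v * t0" using exp_integral_atLeast(2)[OF r] by simp
  from mult_left_mono[OF this, of r] have "r * mean_mass r v \<le> r * (e / r + L1_norm m v * t0)" using r by simp
  also have "\<dots> = e + r * t0 * L1_norm m v" using r by (simp add: distrib_left)
  finally show ?thesis .
qed

lemma survival_null_if_stable:
  assumes stable: "strongly_stable m Pt"
  shows "AE x in m. survival x = 0"
proof -
  obtain v where v: "v \<in> L1_pos m" "\<And>x. x \<in> space m \<Longrightarrow> 0 < v x" by (rule strictly_positive_L1) auto
  have "pairing m survival v \<le> 0"
  proof (rule ennreal_le_epsilon)
    fix e :: real assume e: "0 < e"
    have "((\<lambda>t. L1_norm m (Pt t v)) \<longlongrightarrow> 0) at_top"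
      using stable L1_posD(1)[OF v(1)] unfolding strongly_stable_def by blast
    then have "\<forall>\<^sub>F t in at_top. L1_norm m (Pt t v) < e / 2" using e by (intro order_tendstoD) auto
    then obtain t1 where t1: "\<And>t. t1 \<le> t \<Longrightarrow> L1_norm m (Pt t v) < e / 2"
      by (auto simp: eventually_at_top_linorder)
    define t0 where "t0 = max 0 t1"
    have t0: "0 \<le> t0" "\<And>t. t0 \<le> t \<Longrightarrow> L1_norm m (Pt t v) \<le> e / 2" using t1 by (auto simp: t0_def intro: less_imp_le)
    define c where "c = t0 * L1_norm m v"
    have c: "0 \<le> c" unfolding c_def using t0 L1_norm_nonneg by (intro mult_nonneg_nonneg)
    \<comment> \<open>with this \<open>r\<close> the times before \<open>t0\<close> contribute at most \<open>e / 2\<close>; the \<open>1\<close> covers \<open>c = 0\<close>\<close>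
    define r where "r = e / (2 * (c + 1))"
    have r: "0 < r" using e c by (simp add: r_def)
    have "r * c \<le> e / 2" unfolding r_def using c e by (simp add: field_simps)
    then have "r * mean_mass r v \<le> e"
      using mean_mass_bound[OF r v(1) t0] by (simp add: c_def mult.assoc)
    then have "ennreal (r * mean_mass r v) \<le> 0 + ennreal e" by (simp add: ennreal_leI)
    with survival_le_mean_mass[OF r v(1)] show "pairing m survival v \<le> 0 + ennreal e" by (rule order_trans)
  qed
  then show ?thesis
    using survival_measurable by (intro AE_zero_of_pairing_zero[OF _ v]) (auto simp: measurable_m)
qed

end

theorem corollary5p4:
  fixes E :: "'a::polish_space set"
    and \<pi> :: "real \<Rightarrow> 'a \<Rightarrow> 'a"
    and \<phi> :: "'a \<Rightarrow> real"
    and J :: "'a \<Rightarrow> 'a measure"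
    and \<kappa> :: "real \<Rightarrow> 'a \<Rightarrow> 'a"
    and M :: "'w measure"
    and \<epsilon> \<theta> :: "nat \<Rightarrow> 'w \<Rightarrow> real"
    and m :: "'a measure"
    and P :: "('a \<Rightarrow> real) \<Rightarrow> 'a \<Rightarrow> real"
    and S Pt :: "real \<Rightarrow> ('a \<Rightarrow> real) \<Rightarrow> 'a \<Rightarrow> real"
  assumes "pdmp_characteristics E \<pi> \<phi> J"
    and "represents_kernel E J \<kappa>"
    and "pdmp_noise M \<epsilon> \<theta>"
    and "sigma_finite_measure m" and "sets m = sets (borel_on E)"
    and "stochastic_operator m P" and "transition_operator m J P"
    and "killed_flow_semigroup m \<pi> \<phi> S"
    and "minimal_semigroup m \<phi> P S Pt"
  shows "strongly_stable m Pt \<longleftrightarrow>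
    {x \<in> E. measure M {\<omega> \<in> space M. explosion_time \<pi> \<phi> \<kappa> \<epsilon> \<theta> x \<omega> = \<infinity>} > 0} \<in> null_sets m"
proof -
  interpret pdmp_characteristics E \<pi> \<phi> J by fact
  interpret sigma_finite_measure m by fact
  interpret pdmp_minimal E \<pi> \<phi> J m P S Pt by unfold_locales fact+
  interpret pdmp_process E \<pi> \<phi> J \<kappa> M \<epsilon> \<theta> by unfold_locales fact+
  have "{x \<in> E. measure M {\<omega> \<in> space M. explosion_time \<pi> \<phi> \<kappa> \<epsilon> \<theta> x \<omega> = \<infinity>} > 0}
      = {x \<in> space m. \<not> survival x = 0}"
    using survival_eq_prob by (auto simp: zero_less_measure_iff)
  moreover have "{x \<in> space m. \<not> survival x = 0} \<in> sets m"
  proof -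
    have [measurable]: "survival \<in> borel_measurable m" using survival_measurable by (simp add: measurable_m)
    show ?thesis by measurable
  qed
  ultimately show ?thesis
    using stable_if_survival_null survival_null_if_stable AE_iff_null[of m "\<lambda>x. survival x = 0"] by auto
qed

end
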